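(* Let $F_\omega$ be a one-variable random Bedford-McMullen carpet (as defined in the context). Then the following dichotomy holds. (1) Let $\phi$ be a dimension function with $\phi(x)\le\log\overline n/\log\overline m-1$ such that $\sum_{k=1}^\infty e^{-\phi(e^{-k})k}<\infty$. Then for dimension functions $\varphi$ with $\varphi(x)=\omega(\phi(x))$ (i.e. $\phi(x)/\varphi(x)\to0$ as $x\to0$), almost surely $\dim_{\mathrm A}^{\varphi}F_\omega=\dim_{\mathrm{qA}}F_\omega$. (2) Conversely, let $\phi$ be a dimension function such that $\sum_{k=1}^\infty e^{-\phi(e^{-k})k}=\infty$. Then there exists $C>0$ such that $\dim_{\mathrm A}^{\varphi}F_\omega=\dim_{\mathrm A}F_\omega$ for all dimension functions $\varphi$ with $\varphi(x)\le C\phi(x)$, almost surely.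
   Context: Dimension function: a function $\phi$ with values in $(0,\infty)$ such that $x\mapsto\phi(x)$ and $x\mapsto\phi(x)|\log x|$ are both monotone on $(0,1)$. Generalised Assouad spectrum: for a metric space $F$ let $N_r(E)$ be the minimal number of balls of radius at most $r$ needed to cover $E$, and let $B(x,R)$ be the ball of radius $R$ centred at $x$. For a dimension function $\phi$, $\dim_{\mathrm A}^{\phi}F$ is the infimum of all $s$ for which there is $C'>0$ such that for all $0<R<1$, with $r=R^{1+\phi(R)}$, one has $\sup_{x\in F}N_r(F\cap B(x,R))\le C'(R/r)^s=C' R^{-\phi(R)s}$. For $\theta\in(0,1)$ the Assouad spectrum $\dim_{\mathrm A}^{\theta}F$ is the case of the constant function $\phi\equiv1/\theta-1$, and the quasi-Assouad dimension is $\dim_{\mathrm{qA}}F=\lim_{\theta\to1}\dim_{\mathrm A}^{\theta}F$. The Assouad dimension $\dim_{\mathrm A}F$ is the infimum of all $s$ for which there is $C'>0$ such that $\sup_{x\in F}N_r(F\cap B(x,R))\le C'(R/r)^s$ for all $0<r\le R<1$. One-variable random Bedford-McMullen carpets: $\Lambda$ is a finite set with a probability measure $\mu$ supported on $\Lambda$, $p_\lambda=\mu(\lambda)>0$ for each $\lambda\in\Lambda$. To each $\lambda\in\Lambda$ are associated integers $2\le m_\lambda<n_\lambda$ and an iterated function system of $N_\lambda\ge1$ distinct maps of the unit square $\Delta=[0,1]^2$, $$f_i^\lambda(x)=\begin{pmatrix}1/m_\lambda&0\\0&1/n_\lambda\end{pmatrix}x+\begin{pmatrix}a_i^\lambda/m_\lambda\\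 b_i^\lambda/n_\lambda\end{pmatrix},\qquad a_i^\lambda\in\{0,\dots,m_\lambda-1\},\ b_i^\lambda\in\{0,\dots,n_\lambda-1\}.$$ Let $\Omega=\Lambda^{\mathbb N}$ with product measure $\mathbb P=\mu^{\mathbb N}$. For $\omega=(\omega_1,\omega_2,\dots)\in\Omega$, $$F_\omega=\bigcap_{k=1}^\infty\ \bigcup_{\substack{1\le i_j\le N_{\omega_j}\\ 1\le j\le k}} f_{i_1}^{\omega_1}\circ\cdots\circ f_{i_k}^{\omega_k}(\Delta).$$ "Almost surely" refers to $\omega$ chosen according to $\mathbb P$. Let $C_\lambda$ be the maximal number of maps of the IFS $\lambda$ that lie in a common column (same $a_i^\lambda$), and $B_\lambda$ the number of non-empty columns. Bars denote geometric means: $\overline n=\exp\big(\sum_\lambda p_\lambda\log n_\lambda\big)$, and similarly $\overline m,\overline B,\overline C$. It is known that almost surely $$\dim_{\mathrm{qA}}F_\omega=\frac{\log\overline B}{\log\overline m}+\frac{\log\overline C}{\log\overline n},\qquad \dim_{\mathrm A}F_\omega=\max_{\lambda\in\Lambda}\frac{\log B_\lambda}{\log m_\lambda}+\max_{\lambda\in\Lambda}\frac{\log C_\lambda}{\log n_\lambda}.$$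
   Formalization: In (1) the bound log n̄/log m̄ − 1 is also required of varphi(x) for all sufficiently small x, and in (2) varphi(x)|log x| → ∞ as x → 0 is also required; without these conditions each part is false. *)

theory Defs
  imports "HOL-Probability.Probability"
begin

section \<open>Dimension functions and Assouad-type dimensions\<close>

text \<open>Dimension functions live on the open unit interval; values elsewhere are irrelevant.
  ``Monotone'' means non-decreasing or non-increasing.\<close>

definition monotone_on_unit :: "(real \<Rightarrow> real) \<Rightarrow> bool" where
  "monotone_on_unit f \<longleftrightarrow> mono_on {0<..<1} f \<or> antimono_on {0<..<1} f"

definition dimension_function :: "(real \<Rightarrow> real) \<Rightarrow> bool" where
  "dimension_function \<phi> \<longleftrightarrow>
     (\<forall>x\<in>{0<..<1}. \<phi> x > 0) \<and>
     monotone_on_unit \<phi> \<and> monotone_on_unit (\<lambda>x. \<phi> x * \<bar>ln x\<bar>)"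

text \<open>The metric space is a subset \<open>F\<close> of an ambient metric type; all balls are balls of \<open>F\<close>,
  so that the notions depend only on \<open>F\<close> with its induced metric. The value is \<open>\<infinity>\<close> if there is
  no finite cover.\<close>

definition covering_number :: "'a::metric_space set \<Rightarrow> real \<Rightarrow> 'a set \<Rightarrow> enat" where
  "covering_number F r E =
     Inf {enat (card \<B>) |\<B>. finite \<B> \<and>
            \<B> \<subseteq> {F \<inter> ball c \<rho> |c \<rho>. c \<in> F \<and> 0 < \<rho> \<and> \<rho> \<le> r} \<and> E \<subseteq> \<Union>\<B>}"

definition sup_covering :: "'a::metric_space set \<Rightarrow> real \<Rightarrow> real \<Rightarrow> ereal" where
  "sup_covering F R r = (SUP x\<in>F. ereal_of_enat (covering_number F r (F \<inter> ball x R)))"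

definition gen_assouad_spectrum :: "(real \<Rightarrow> real) \<Rightarrow> 'a::metric_space set \<Rightarrow> ereal" where
  "gen_assouad_spectrum \<phi> F =
     Inf {ereal s |s. \<exists>C'>0. \<forall>R. 0 < R \<and> R < 1 \<longrightarrow>
            (let r = R powr (1 + \<phi> R) in sup_covering F R r \<le> ereal (C' * (R / r) powr s))}"

definition assouad_spectrum :: "real \<Rightarrow> 'a::metric_space set \<Rightarrow> ereal" where
  "assouad_spectrum \<theta> F = gen_assouad_spectrum (\<lambda>_. 1 / \<theta> - 1) F"

definition quasi_assouad_dim :: "'a::metric_space set \<Rightarrow> ereal" where
  "quasi_assouad_dim F = Lim (at_left 1) (\<lambda>\<theta>. assouad_spectrum \<theta> F)"

definition assouad_dim :: "'a::metric_space set \<Rightarrow> ereal" where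
  "assouad_dim F =
     Inf {ereal s |s. \<exists>C'>0. \<forall>r R. 0 < r \<and> r \<le> R \<and> R < 1 \<longrightarrow>
            sup_covering F R r \<le> ereal (C' * (R / r) powr s)}"


section \<open>One-variable random Bedford--McMullen carpets\<close>

definition unit_square :: "(real \<times> real) set" where
  "unit_square = {0..1} \<times> {0..1}"

definition bm_map :: "nat \<Rightarrow> nat \<Rightarrow> nat \<Rightarrow> nat \<Rightarrow> real \<times> real \<Rightarrow> real \<times> real" where
  "bm_map m n a b = (\<lambda>(x, y). (x / real m + real a / real m, y / real n + real b / real n))"

text \<open>The maps of the \<open>l\<close>-th iterated function system are \<open>bm_map (m l) (n l) (a l i) (b l i)\<close>
  for \<open>1 \<le> i \<le> N l\<close>. That \<open>\<mu>\<close> has support exactly \<open>\<Lambda>\<close> says that every \<open>p\<^sub>l\<close> is positive.\<close>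

locale random_bm_carpet =
  fixes \<Lambda> :: "'l set" and \<mu> :: "'l pmf"
    and m n N :: "'l \<Rightarrow> nat" and a b :: "'l \<Rightarrow> nat \<Rightarrow> nat"
  assumes finite_index: "finite \<Lambda>"
    and support: "set_pmf \<mu> = \<Lambda>"
    and subdivisions: "\<And>l. l \<in> \<Lambda> \<Longrightarrow> 2 \<le> m l \<and> m l < n l"
    and maps_nonempty: "\<And>l. l \<in> \<Lambda> \<Longrightarrow> 1 \<le> N l"
    and digits: "\<And>l i. l \<in> \<Lambda> \<Longrightarrow> i \<in> {1..N l} \<Longrightarrow> a l i < m l \<and> b l i < n l"
    and maps_distinct:
      "\<And>l. l \<in> \<Lambda> \<Longrightarrow> inj_on (\<lambda>i. bm_map (m l) (n l) (a l i) (b l i)) {1..N l}"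

text \<open>Realisations are indexed from 0, so \<open>\<omega> j\<close> is the \<open>(j+1)\<close>-st letter. The innermost map of
  a cylinder of level \<open>k\<close> is the one chosen from the IFS \<open>\<omega> (k - 1)\<close>.\<close>

primrec cylinder_map ::
  "('l \<Rightarrow> nat) \<Rightarrow> ('l \<Rightarrow> nat) \<Rightarrow> ('l \<Rightarrow> nat \<Rightarrow> nat) \<Rightarrow> ('l \<Rightarrow> nat \<Rightarrow> nat) \<Rightarrow>
   (nat \<Rightarrow> 'l) \<Rightarrow> (nat \<Rightarrow> nat) \<Rightarrow> nat \<Rightarrow> real \<times> real \<Rightarrow> real \<times> real" where
  "cylinder_map m n a b \<omega> i 0 = id"
| "cylinder_map m n a b \<omega> i (Suc k) =
     cylinder_map m n a b \<omega> i k \<circ> bm_map (m (\<omega> k)) (n (\<omega> k)) (a (\<omega> k) (i k)) (b (\<omega> k) (i k))"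

definition carpet ::
  "('l \<Rightarrow> nat) \<Rightarrow> ('l \<Rightarrow> nat) \<Rightarrow> ('l \<Rightarrow> nat) \<Rightarrow> ('l \<Rightarrow> nat \<Rightarrow> nat) \<Rightarrow> ('l \<Rightarrow> nat \<Rightarrow> nat) \<Rightarrow>
   (nat \<Rightarrow> 'l) \<Rightarrow> (real \<times> real) set" where
  "carpet m n N a b \<omega> =
     (\<Inter>k\<in>{1..}. \<Union>i\<in>{i. \<forall>j<k. 1 \<le> i j \<and> i j \<le> N (\<omega> j)}.
        cylinder_map m n a b \<omega> i k ` unit_square)"

text \<open>The product measure is carried by sequences of arbitrary elements of the letter type; almost
  every such sequence has all its letters in the support of \<open>\<mu>\<close>.\<close>

definition realisation_measure :: "'l pmf \<Rightarrow> (nat \<Rightarrow> 'l) measure" where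
  "realisation_measure \<mu> = PiM UNIV (\<lambda>_. measure_pmf \<mu>)"

definition geometric_mean :: "'l set \<Rightarrow> 'l pmf \<Rightarrow> ('l \<Rightarrow> nat) \<Rightarrow> real" where
  "geometric_mean \<Lambda> \<mu> f = exp (\<Sum>l\<in>\<Lambda>. pmf \<mu> l * ln (real (f l)))"

end

theory Submission
  imports Defs "HOL-Real_Asymp.Real_Asymp"
begin

text \<open>
  Put \<open>r = R powr (1 + \<psi> R)\<close> and \<open>T = ln (R / r) = \<psi> R * \<bar>ln R\<bar>\<close>. Let \<open>l(R)\<close> and \<open>k(R)\<close> be the
  levels at which rows have height about \<open>R\<close> and columns have width about \<open>R\<close>. Up to constants the
  covering number at scales \<open>R\<close>, \<open>r\<close> is at most the product of the maximal column sizes over the letters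
  in \<open>[l(R), l(r))\<close> and of the numbers of columns over the letters in \<open>[k(R), k(r))\<close>; the same holds from
  below once the overlap of the two windows is discarded. Both windows have length comparable to \<open>T\<close>.

  If \<open>\<Sum> exp (- \<phi> (exp (- k)) * k)\<close> converges and \<open>\<psi>\<close> dominates \<open>\<phi>\<close>, Hoeffding's inequality and
  Borel--Cantelli show that the averages over all such windows are eventually typical, and the overlap is
  negligible by the law of large numbers. Constant functions are covered by the law of large numbers
  alone, for all \<open>\<theta>\<close> at once, which gives the quasi-Assouad dimension.

  If the series diverges, then \<open>\<phi>\<close> decreases to the origin and \<open>\<phi> (exp (- K)) * K \<le> 2 * ln K\<close> for
  infinitely many \<open>K\<close>. For a small constant \<open>C\<close>, near each such scale there are, with probability tending
  to 1, two windows of length a small multiple of \<open>ln K\<close>, at matching positions \<open>l(R)\<close> and \<open>k(R)\<close>, which consist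
  only of the letter maximising \<open>log C / log n\<close>, respectively \<open>log B / log m\<close>. Along these scales the
  covering numbers grow with the exponent of the Assouad dimension.
\<close>

section \<open>Mixed radix expansions\<close>

text \<open>Domination of \<open>\<phi>\<close> by \<open>\<psi>\<close> absorbs all constants in
  the first part: Hoeffding's rate and the passage from scales to positions of letters only give
  exponents \<open>c * \<psi> (exp (- k)) * k\<close> with some small \<open>c\<close>, and these
  still exceed \<open>\<phi> (exp (- k)) * k\<close> eventually. In the second part the constants
  are collected in \<open>C\<close>. There the almost sure event must not depend on
  \<open>\<psi>\<close>, of which there are uncountably many; runs long enough for
  \<open>C * \<phi>\<close> serve every \<open>\<psi>\<close> below it. The bound ln n / ln m - 1
  (geometric means) on \<open>\<psi>\<close> says that \<open>l(r)\<close> typically does not pass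
  \<open>k(R)\<close>. Before \<open>k(R)\<close> the ball has fixed the columns and the rows in
  them are free; beyond it row and column are chosen together as one map, and the product of maximal
  column sizes and numbers of columns need not be attained. That
  \<open>\<psi> R * \<bar>ln R\<bar>\<close> tends to infinity excludes bounded gauges, for which
  \<open>R / r\<close> and the covering numbers are bounded, every real \<open>s\<close> is
  admissible and the infimum over \<open>s\<close> is -\<infinity>.\<close>

primrec radix_num :: "(nat \<Rightarrow> nat) \<Rightarrow> (nat \<Rightarrow> nat) \<Rightarrow> nat \<Rightarrow> nat" where
  "radix_num q d 0 = 0"
| "radix_num q d (Suc k) = radix_num q d k * q k + d k"

abbreviation radix_den :: "(nat \<Rightarrow> nat) \<Rightarrow> nat \<Rightarrow> real" where
  "radix_den q k \<equiv> (\<Prod>j<k. real (q j))"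

lemma radix_num_cong:
  "(\<And>j. j < k \<Longrightarrow> d j = d' j) \<Longrightarrow> radix_num q d k = radix_num q d' k"
  by (induction k) auto

lemma mult_add_digit_eq_iff:
  fixes A A' p e e' :: nat
  assumes "e < p" "e' < p"
  shows "A * p + e = A' * p + e' \<longleftrightarrow> A = A' \<and> e = e'"
proof
  assume "A * p + e = A' * p + e'"
  then have "(A * p + e) div p = (A' * p + e') div p" "(A * p + e) mod p = (A' * p + e') mod p"
    by auto
  then show "A = A' \<and> e = e'" using assms by auto
qed auto

lemma radix_num_eq_iff:
  assumes "\<And>j. j < k \<Longrightarrow> d j < q j" "\<And>j. j < k \<Longrightarrow> d' j < q j"
  shows "radix_num q d k = radix_num q d' k \<longleftrightarrow> (\<forall>j<k. d j = d' j)"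
  using assms
proof (induction k)
  case (Suc k)
  then show ?case
    by (auto simp: mult_add_digit_eq_iff less_Suc_eq)
qed auto

lemma radix_den_pos: "(\<And>j. 0 < q j) \<Longrightarrow> 0 < radix_den q k"
  by (simp add: prod_pos)

lemma radix_lower_mono:
  assumes q: "\<And>j. 0 < q j" and "k \<le> k'"
  shows "radix_num q d k / radix_den q k \<le> radix_num q d k' / radix_den q k'"
proof (rule lift_Suc_mono_le[OF _ \<open>k \<le> k'\<close>])
  fix k
  have "radix_den q k > 0" "real (q k) > 0" using q by (auto intro!: prod_pos)
  then show "radix_num q d k / radix_den q k \<le> radix_num q d (Suc k) / radix_den q (Suc k)"
    by (simp add: field_simps)
qed

lemma radix_upper_antimono:
  assumes q: "\<And>j. d j < q j" and "k \<le> k'"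
  shows "(radix_num q d k' + 1) / radix_den q k' \<le> (radix_num q d k + 1) / radix_den q k"
proof (rule lift_Suc_antimono_le[OF _ \<open>k \<le> k'\<close>])
  fix k
  have *: "real (d k) + 1 \<le> real (q k)" using q[of k] by linarith
  have q0: "0 < q j" for j using q[of j] by simp
  have "radix_den q k > 0" "real (q k) > 0" using q0 by (auto intro!: prod_pos)
  then show "(radix_num q d (Suc k) + 1) / radix_den q (Suc k) \<le> (radix_num q d k + 1) / radix_den q k"
    using * mult_right_mono[OF *, of "radix_den q k"] by (simp add: field_simps)
qed

text \<open>\<open>radix_num\<close> appends later digits at the low end, so
  \<open>radix_num q d k\<close> is the index \<open>A\<close> of the cell of level \<open>k\<close>
  that the first \<open>k\<close> digits of \<open>d\<close> lead to.\<close>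

definition radix_cell :: "(nat \<Rightarrow> nat) \<Rightarrow> nat \<Rightarrow> nat \<Rightarrow> real set" where
  "radix_cell q k A = {real A / radix_den q k .. (real A + 1) / radix_den q k}"

lemma radix_cell_antimono:
  assumes "\<And>j. d j < q j" and "k \<le> k'"
  shows "radix_cell q k' (radix_num q d k') \<subseteq> radix_cell q k (radix_num q d k)"
proof -
  have q0: "0 < q j" for j using assms(1)[of j] by simp
  show ?thesis
    using radix_lower_mono[of q, OF q0 assms(2), of d] radix_upper_antimono[of d q, OF assms]
    by (auto simp: radix_cell_def add.commute)
qed

text \<open>Nested intervals: every left endpoint lies below every right endpoint, as a comparison
  at level \<open>max i k\<close> shows, so the supremum of the left endpoints lies in all
  cells.\<close>

lemma radix_point_exists:
  assumes d: "\<And>j. d j < q j"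
  shows "\<exists>x. \<forall>k. x \<in> radix_cell q k (radix_num q d k)"
proof -
  have q0: "0 < q j" for j using d[of j] by simp
  let ?lo = "\<lambda>k. radix_num q d k / radix_den q k"
  let ?hi = "\<lambda>k. (radix_num q d k + 1) / radix_den q k"
  have le: "?lo i \<le> ?hi k" for i k
  proof -
    have "?lo i \<le> ?lo (max i k)" by (rule radix_lower_mono) (auto simp: q0)
    also have "\<dots> \<le> ?hi (max i k)"
      using radix_den_pos[of q, OF q0] by (intro divide_right_mono) (auto simp: less_imp_le)
    also have "\<dots> \<le> ?hi k" by (rule radix_upper_antimono) (auto simp: d)
    finally show ?thesis .
  qed
  have "?lo k \<le> (SUP i. ?lo i) \<and> (SUP i. ?lo i) \<le> ?hi k" for k
    using le by (auto intro!: cSUP_upper cSUP_least bdd_aboveI2)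
  then show ?thesis by (auto simp: radix_cell_def add.commute)
qed

lemma card_nat_interval_le:
  fixes u v :: real
  assumes "u \<le> v"
  shows "finite {A::nat. u \<le> real A \<and> real A \<le> v}"
    and "real (card {A::nat. u \<le> real A \<and> real A \<le> v}) \<le> v - u + 1"
proof -
  let ?S = "{A::nat. u \<le> real A \<and> real A \<le> v}"
  have "?S \<subseteq> {..nat \<lfloor>v\<rfloor>}" by (auto simp: le_nat_floor)
  then show fin: "finite ?S" by (rule finite_subset) simp
  have "int ` ?S \<subseteq> {\<lceil>u\<rceil>..\<lfloor>v\<rfloor>}" by (auto simp: ceiling_le_iff le_floor_iff)
  then have "card (int ` ?S) \<le> card {\<lceil>u\<rceil>..\<lfloor>v\<rfloor>}" by (intro card_mono) auto
  then have "card ?S \<le> nat (\<lfloor>v\<rfloor> - \<lceil>u\<rceil> + 1)" by (simp add: card_image)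
  then have "real (card ?S) \<le> real (nat (\<lfloor>v\<rfloor> - \<lceil>u\<rceil> + 1))" by simp
  also have "\<dots> \<le> v - u + 1" using assms by linarith
  finally show "real (card ?S) \<le> v - u + 1" .
qed

text \<open>Rescaled by the denominator, the indices lie in an interval of length
  \<open>2 * \<kappa> + 1\<close>; the extra 1 comes from the right end \<open>A + 1\<close> of a
  closed cell. This makes counting balls and counting approximate squares equivalent up to
  constants.\<close>

lemma card_cells_meeting:
  fixes c :: real
  assumes q: "\<And>j. 0 < q j" and h: "0 \<le> h" and hq: "h * radix_den q k \<le> \<kappa>"
  shows "finite {A. radix_cell q k A \<inter> {c - h..c + h} \<noteq> {}}"
    and "real (card {A. radix_cell q k A \<inter> {c - h..c + h} \<noteq> {}}) \<le> 2 * \<kappa> + 2"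
proof -
  define Q where "Q = radix_den q k"
  have Q: "Q > 0" using q by (auto simp: Q_def intro!: prod_pos)
  let ?T = "{A. radix_cell q k A \<inter> {c - h..c + h} \<noteq> {}}"
  let ?S = "{A::nat. c * Q - \<kappa> - 1 \<le> real A \<and> real A \<le> c * Q + \<kappa>}"
  have \<kappa>: "0 \<le> \<kappa>" using h Q hq unfolding Q_def by (meson less_imp_le mult_nonneg_nonneg order_trans)
  have sub: "?T \<subseteq> ?S"
  proof
    fix A assume "A \<in> ?T"
    then obtain x where "x \<in> radix_cell q k A" "x \<in> {c - h..c + h}" by blast
    then have x: "real A / Q \<le> x" "x \<le> (real A + 1) / Q" "c - h \<le> x" "x \<le> c + h"
      by (auto simp: radix_cell_def Q_def)
    from x Q have "real A \<le> x * Q" "x * Q \<le> real A + 1" by (auto simp: field_simps)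
    moreover have "(c - h) * Q \<le> x * Q" "x * Q \<le> (c + h) * Q" using x Q by auto
    moreover have "h * Q \<le> \<kappa>" using hq by (simp add: Q_def)
    ultimately show "A \<in> ?S" by (auto simp: algebra_simps)
  qed
  have le: "c * Q - \<kappa> - 1 \<le> c * Q + \<kappa>" using \<kappa> by simp
  show "finite ?T" using sub card_nat_interval_le(1)[OF le] by (rule finite_subset)
  have "real (card ?T) \<le> real (card ?S)"
    using card_mono[OF card_nat_interval_le(1)[OF le] sub] by simp
  also have "\<dots> \<le> (c * Q + \<kappa>) - (c * Q - \<kappa> - 1) + 1" by (rule card_nat_interval_le(2)[OF le])
  finally show "real (card ?T) \<le> 2 * \<kappa> + 2" by simp
qed

section \<open>Cylinders as products of radix cells\<close>

lemma cylinder_map_eq: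
  fixes x y :: real
  assumes "\<And>j. 0 < m (\<omega> j)" "\<And>j. 0 < n (\<omega> j)"
  shows "cylinder_map m n a b \<omega> i k (x, y) =
    ((radix_num (\<lambda>j. m (\<omega> j)) (\<lambda>j. a (\<omega> j) (i j)) k + x) / radix_den (\<lambda>j. m (\<omega> j)) k,
     (radix_num (\<lambda>j. n (\<omega> j)) (\<lambda>j. b (\<omega> j) (i j)) k + y) / radix_den (\<lambda>j. n (\<omega> j)) k)"
proof (induction k arbitrary: x y)
  case (Suc k)
  have step: "(A + (x + e) / p) / Q = (A * p + e + x) / (Q * p)" if "p \<noteq> 0" for A p e x Q :: real
    using that by (simp add: divide_simps add.commute add.left_commute)
  have "real (m (\<omega> k)) \<noteq> 0" "real (n (\<omega> k)) \<noteq> 0" using assms[of k] by auto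
  then show ?case
    using step[of "real (m (\<omega> k))" _ x "real (a (\<omega> k) (i k))"]
      step[of "real (n (\<omega> k))" _ y "real (b (\<omega> k) (i k))"]
    by (simp add: bm_map_def add_divide_distrib[symmetric] Suc.IH)
qed auto

lemma cylinder_map_unit_square:
  assumes m: "\<And>j. 0 < m (\<omega> j)" and n: "\<And>j. 0 < n (\<omega> j)"
  shows "cylinder_map m n a b \<omega> i k ` unit_square =
    radix_cell (\<lambda>j. m (\<omega> j)) k (radix_num (\<lambda>j. m (\<omega> j)) (\<lambda>j. a (\<omega> j) (i j)) k) \<times>
    radix_cell (\<lambda>j. n (\<omega> j)) k (radix_num (\<lambda>j. n (\<omega> j)) (\<lambda>j. b (\<omega> j) (i j)) k)"
proof -
  have unit: "(\<lambda>x. (A + x) / Q) ` {0..1} = {A / Q..(A + 1) / Q}" if "0 < Q" for A Q :: real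
  proof -
    have "x \<in> (\<lambda>x. (A + x) / Q) ` {0..1}" if "x \<in> {A / Q..(A + 1) / Q}" for x
      using that \<open>0 < Q\<close> by (intro image_eqI[of _ _ "x * Q - A"]) (auto simp: field_simps)
    then show ?thesis using that by (auto intro!: divide_right_mono)
  qed
  have "cylinder_map m n a b \<omega> i k = map_prod
      (\<lambda>x::real. (radix_num (\<lambda>j. m (\<omega> j)) (\<lambda>j. a (\<omega> j) (i j)) k + x) / radix_den (\<lambda>j. m (\<omega> j)) k)
      (\<lambda>y::real. (radix_num (\<lambda>j. n (\<omega> j)) (\<lambda>j. b (\<omega> j) (i j)) k + y) / radix_den (\<lambda>j. n (\<omega> j)) k)"
    using cylinder_map_eq[of m \<omega> n, OF m n] by (auto simp: fun_eq_iff)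
  then show ?thesis
    unfolding unit_square_def radix_cell_def
    by (simp only: map_prod_surj_on[OF refl refl] unit radix_den_pos m n)
qed

section \<open>Levels of approximate squares\<close>

lemma ln2_pos: "0 < ln (2::real)" by simp

lemma ln2_gt_half: "1 / 2 < ln (2::real)"
  using ln2_ge_two_thirds by simp

text \<open>For \<open>g = ln m\<close> or \<open>g = ln n\<close> along a realisation this is the
  first level at which cells have side at most \<open>exp (- t)\<close>.\<close>

definition level :: "(nat \<Rightarrow> real) \<Rightarrow> real \<Rightarrow> nat" where
  "level g t = (LEAST k. t \<le> (\<Sum>j<k. g j))"

context
  fixes g :: "nat \<Rightarrow> real" and c G :: real
  assumes c: "0 < c" and lower: "\<And>j. c \<le> g j" and upper: "\<And>j. g j \<le> G"
begin

lemma sum_ge_linear: "c * real k \<le> (\<Sum>j<k. g j)"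
  using sum_bounded_below[of "{..<k}" c g] lower by (simp add: mult.commute)

lemma level_exists: "\<exists>k. t \<le> (\<Sum>j<k. g j)"
proof -
  obtain k :: nat where "t / c \<le> real k" using real_arch_simple by blast
  then have "t \<le> c * real k" using c by (simp add: field_simps)
  then show ?thesis using sum_ge_linear order_trans by blast
qed

lemma level_ge: "t \<le> (\<Sum>j<level g t. g j)"
  unfolding level_def using level_exists by (rule LeastI_ex)

lemma level_le_iff: "level g t \<le> k \<longleftrightarrow> t \<le> (\<Sum>j<k. g j)"
proof
  assume "level g t \<le> k"
  moreover have "0 \<le> g j" for j using lower[of j] c by linarith
  ultimately have "(\<Sum>j<level g t. g j) \<le> (\<Sum>j<k. g j)" by (intro sum_mono2) auto
  then show "t \<le> (\<Sum>j<k. g j)" using level_ge[of t] by linarith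
qed (simp add: level_def Least_le)

lemma level_mono: "s \<le> t \<Longrightarrow> level g s \<le> level g t"
  using level_le_iff level_ge order_trans by blast

lemma level_upper: "0 \<le> t \<Longrightarrow> (\<Sum>j<level g t. g j) \<le> t + G"
proof (cases "level g t")
  case 0
  have "0 \<le> G" using c lower[of 0] upper[of 0] by linarith
  then show "0 \<le> t \<Longrightarrow> ?thesis" using 0 by simp
next
  case (Suc k)
  have "\<not> level g t \<le> k" using Suc by simp
  then have "(\<Sum>j<k. g j) < t" using level_le_iff by simp
  then show ?thesis using upper[of k] Suc by simp
qed

text \<open>Permits a choice of scale whose row level is a prescribed number.\<close>

lemma level_at_sum: "level g (\<Sum>j<k. g j) = k"
proof (rule antisym)
  show "level g (\<Sum>j<k. g j) \<le> k" by (simp add: level_le_iff)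
  show "k \<le> level g (\<Sum>j<k. g j)"
  proof (cases k)
    case (Suc i)
    have "0 < g i" using lower[of i] c by linarith
    then have "\<not> level g (\<Sum>j<k. g j) \<le> i" by (simp add: level_le_iff Suc)
    then show ?thesis using Suc by simp
  qed simp
qed

text \<open>Each end overshoots its target by some amount in \<open>[0, G]\<close>, and the two
  overshoots enter the difference with opposite signs, so the total error is at most
  \<open>G\<close>. This converts intervals of logarithmic scales into numbers of letters.\<close>

lemma level_window:
  assumes "0 \<le> s" "s \<le> t"
  shows "(\<Sum>j\<in>{level g s..<level g t}. g j) \<le> t - s + G"
    and "t - s - G \<le> (\<Sum>j\<in>{level g s..<level g t}. g j)"
    and "c * real (level g t - level g s) \<le> t - s + G"
    and "t - s - G \<le> G * real (level g t - level g s)"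
proof -
  have le: "level g s \<le> level g t" using level_mono assms by simp
  have eq: "(\<Sum>j\<in>{level g s..<level g t}. g j) = (\<Sum>j<level g t. g j) - (\<Sum>j<level g s. g j)"
    using sum_diff_nat_ivl[of 0 "level g s" "level g t" g] le by (simp add: atLeast0LessThan)
  show 1: "(\<Sum>j\<in>{level g s..<level g t}. g j) \<le> t - s + G"
    and 2: "t - s - G \<le> (\<Sum>j\<in>{level g s..<level g t}. g j)"
    using eq level_ge[of s] level_ge[of t] level_upper[of s] level_upper[of t] assms by linarith+
  have "c * real (level g t - level g s) \<le> (\<Sum>j\<in>{level g s..<level g t}. g j)"
    using sum_bounded_below[of "{level g s..<level g t}" c g] lower by (simp add: mult.commute)
  then show "c * real (level g t - level g s) \<le> t - s + G" using 1 by linarith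
  have "(\<Sum>j\<in>{level g s..<level g t}. g j) \<le> G * real (level g t - level g s)"
    using sum_bounded_above[of "{level g s..<level g t}" g G] upper by (simp add: mult.commute)
  then show "t - s - G \<le> G * real (level g t - level g s)" using 2 by linarith
qed

end

section \<open>Numerical data of the letters\<close>

context random_bm_carpet
begin

definition ncols :: "'l \<Rightarrow> nat" where
  "ncols l = card (a l ` {1..N l})"

definition column_rows :: "'l \<Rightarrow> nat \<Rightarrow> nat set" where
  "column_rows l c = b l ` {i \<in> {1..N l}. a l i = c}"

text \<open>The number C of the IFS, as \<open>ncols\<close> is its B: distinct maps in a common
  column have distinct rows, so counting rows counts maps.\<close>

definition maxrows :: "'l \<Rightarrow> nat" where
  "maxrows l = Max ((\<lambda>c. card (column_rows l c)) ` a l ` {1..N l})"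

definition best :: "'l \<Rightarrow> nat" where
  "best l = (SOME i. i \<in> {1..N l} \<and> card (column_rows l (a l i)) = maxrows l)"

definition log_max :: real where
  "log_max = ln (real (Max (n ` \<Lambda>)))"

lemma index_nonempty: "\<Lambda> \<noteq> {}"
  using support set_pmf_not_empty by metis

lemma card_column_rows_le:
  assumes "i \<in> {1..N l}" shows "card (column_rows l (a l i)) \<le> maxrows l"
  unfolding maxrows_def using assms by (intro Max_ge) auto

lemma finite_column_rows [simp]: "finite (column_rows l c)"
  by (simp add: column_rows_def)

lemma best:
  assumes "l \<in> \<Lambda>"
  shows "best l \<in> {1..N l}" "card (column_rows l (a l (best l))) = maxrows l"
proof -
  have "maxrows l \<in> (\<lambda>c. card (column_rows l c)) ` a l ` {1..N l}"
    unfolding maxrows_def using maps_nonempty[OF assms] by (intro Max_in) auto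
  then have "\<exists>i. i \<in> {1..N l} \<and> card (column_rows l (a l i)) = maxrows l" by auto
  from someI_ex[OF this] show "best l \<in> {1..N l}" "card (column_rows l (a l (best l))) = maxrows l"
    by (auto simp: best_def)
qed

lemma ncols_pos: "l \<in> \<Lambda> \<Longrightarrow> 1 \<le> ncols l"
  using maps_nonempty[of l] by (simp add: ncols_def Suc_le_eq card_gt_0_iff)

lemma maxrows_pos: assumes "l \<in> \<Lambda>" shows "1 \<le> maxrows l"
proof -
  have "b l (best l) \<in> column_rows l (a l (best l))"
    using best(1)[OF assms] by (auto simp: column_rows_def)
  then have "card (column_rows l (a l (best l))) \<noteq> 0" by auto
  then show ?thesis using best(2)[OF assms] by simp
qed

lemma ln_n_le_log_max:
  assumes "l \<in> \<Lambda>" shows "ln (real (n l)) \<le> log_max"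
proof -
  have "n l \<le> Max (n ` \<Lambda>)" using assms finite_index by (intro Max_ge) auto
  moreover have "0 < n l" using subdivisions[OF assms] by simp
  ultimately show ?thesis by (simp add: log_max_def)
qed

lemma ln_m_less_ln_n: "l \<in> \<Lambda> \<Longrightarrow> ln (real (m l)) < ln (real (n l))"
  using subdivisions[of l] by simp

lemma ln_m_ge: "l \<in> \<Lambda> \<Longrightarrow> ln 2 \<le> ln (real (m l))"
  using subdivisions[of l] by simp

lemma log_max_pos: "0 < log_max"
proof -
  obtain l where "l \<in> \<Lambda>" using index_nonempty by auto
  moreover have "0 < ln (2::real)" by simp
  ultimately show ?thesis using ln_m_ge[of l] ln_m_less_ln_n[of l] ln_n_le_log_max[of l] by linarith
qed

end

section \<open>Symbolic coding of a fixed realisation\<close>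

locale carpet_realisation = random_bm_carpet \<Lambda> \<mu> m n N a b
  for \<Lambda> :: "'l set" and \<mu> :: "'l pmf" and m n N :: "'l \<Rightarrow> nat" and a b :: "'l \<Rightarrow> nat \<Rightarrow> nat" +
  fixes \<omega> :: "nat \<Rightarrow> 'l"
  assumes letters: "\<And>j. \<omega> j \<in> \<Lambda>"
begin

abbreviation "qm j \<equiv> m (\<omega> j)"
abbreviation "qn j \<equiv> n (\<omega> j)"
abbreviation "xnum w \<equiv> radix_num qm (\<lambda>j. a (\<omega> j) (w j))"
abbreviation "ynum w \<equiv> radix_num qn (\<lambda>j. b (\<omega> j) (w j))"
abbreviation "xcell \<equiv> radix_cell qm"
abbreviation "ycell \<equiv> radix_cell qn"
abbreviation "lnm j \<equiv> ln (real (m (\<omega> j)))"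
abbreviation "lnn j \<equiv> ln (real (n (\<omega> j)))"
abbreviation "xlevel \<equiv> level lnm"
abbreviation "ylevel \<equiv> level lnn"

definition words :: "(nat \<Rightarrow> nat) set" where
  "words = {w. \<forall>j. w j \<in> {1..N (\<omega> j)}}"

lemma qm_pos: "0 < qm j" and qn_pos: "0 < qn j"
  using subdivisions[OF letters[of j]] by auto

lemma lnm_bounds: "ln 2 \<le> lnm j" "lnm j \<le> log_max"
  and lnn_bounds: "ln 2 \<le> lnn j" "lnn j \<le> log_max"
  using ln_m_ge[OF letters[of j]] ln_m_less_ln_n[OF letters[of j]] ln_n_le_log_max[OF letters[of j]]
  by linarith+

lemma xdigit: "w \<in> words \<Longrightarrow> a (\<omega> j) (w j) < qm j"
  and ydigit: "w \<in> words \<Longrightarrow> b (\<omega> j) (w j) < qn j"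
  using digits[OF letters] by (auto simp: words_def)

text \<open>The word may depend on the level \<open>k\<close>. Every estimate looks at finitely many
  levels only, so no infinite code has to be extracted for a given point.\<close>

lemma carpet_iff:
  "p \<in> carpet m n N a b \<omega> \<longleftrightarrow>
    (\<forall>k\<ge>1. \<exists>w\<in>words. fst p \<in> xcell k (xnum w k) \<and> snd p \<in> ycell k (ynum w k))"
proof -
  \<comment> \<open>Digits from position \<open>k\<close> on do not affect the cylinder; 1 is an
    admissible choice as each IFS has at least one map.\<close>
  have ext: "\<exists>w\<in>words. \<forall>j<k. w j = i j" if "\<forall>j<k. 1 \<le> i j \<and> i j \<le> N (\<omega> j)" for i k
    using that maps_nonempty[OF letters] by (intro bexI[of _ "\<lambda>j. if j < k then i j else 1"]) (auto simp: words_def)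
  have cyl: "cylinder_map m n a b \<omega> w k ` unit_square = xcell k (xnum w k) \<times> ycell k (ynum w k)" for w k
    using cylinder_map_unit_square[of m \<omega> n a b w k] qm_pos qn_pos by simp
  have "p \<in> (\<Union>i\<in>{i. \<forall>j<k. 1 \<le> i j \<and> i j \<le> N (\<omega> j)}. cylinder_map m n a b \<omega> i k ` unit_square)
    \<longleftrightarrow> (\<exists>w\<in>words. fst p \<in> xcell k (xnum w k) \<and> snd p \<in> ycell k (ynum w k))" (is "?L k \<longleftrightarrow> ?R k") for k
  proof
    assume "?L k"
    then obtain i where i: "\<forall>j<k. 1 \<le> i j \<and> i j \<le> N (\<omega> j)" "p \<in> xcell k (xnum i k) \<times> ycell k (ynum i k)"
      unfolding cyl by blast
    obtain w where w: "w \<in> words" "\<forall>j<k. w j = i j" using ext[OF i(1)] by blast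
    have "xnum w k = xnum i k" "ynum w k = ynum i k" by (rule radix_num_cong; simp add: w)+
    then show "?R k" using w i(2) by (intro bexI[OF _ w(1)]) auto
  next
    assume "?R k"
    then obtain w where w: "w \<in> words" "p \<in> xcell k (xnum w k) \<times> ycell k (ynum w k)"
      by (auto simp: mem_Times_iff)
    then show "?L k" unfolding cyl by (intro UN_I[of w]) (auto simp: words_def)
  qed
  then show ?thesis by (auto simp: carpet_def)
qed

lemma carpet_word:
  assumes "p \<in> carpet m n N a b \<omega>"
  obtains w where "w \<in> words" "\<And>j. j \<le> k \<Longrightarrow> fst p \<in> xcell j (xnum w j)"
    "\<And>j. j \<le> k \<Longrightarrow> snd p \<in> ycell j (ynum w j)"
proof -
  \<comment> \<open>\<open>Suc k\<close> covers the case \<open>k = 0\<close>, because the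
    intersection defining the carpet starts at level 1.\<close>
  obtain w where w: "w \<in> words" "fst p \<in> xcell (Suc k) (xnum w (Suc k))" "snd p \<in> ycell (Suc k) (ynum w (Suc k))"
    using assms[unfolded carpet_iff, rule_format, of "Suc k"] by auto
  show ?thesis
  proof (rule that[OF w(1)])
    fix j assume "j \<le> k"
    then have "j \<le> Suc k" by simp
    then show "fst p \<in> xcell j (xnum w j)" "snd p \<in> ycell j (ynum w j)"
      using radix_cell_antimono[of "\<lambda>j. a (\<omega> j) (w j)" qm, OF xdigit[OF w(1)], of j "Suc k"]
        radix_cell_antimono[of "\<lambda>j. b (\<omega> j) (w j)" qn, OF ydigit[OF w(1)], of j "Suc k"] w
      by blast+
  qed
qed

lemma word_point:
  assumes "w \<in> words"
  shows "\<exists>p\<in>carpet m n N a b \<omega>. \<forall>k. fst p \<in> xcell k (xnum w k) \<and> snd p \<in> ycell k (ynum w k)"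
proof -
  obtain x where "\<forall>k. x \<in> xcell k (xnum w k)"
    using radix_point_exists[of "\<lambda>j. a (\<omega> j) (w j)" qm] xdigit[OF assms] by blast
  moreover obtain y where "\<forall>k. y \<in> ycell k (ynum w k)"
    using radix_point_exists[of "\<lambda>j. b (\<omega> j) (w j)" qn] ydigit[OF assms] by blast
  ultimately show ?thesis using assms by (intro bexI[of _ "(x, y)"]) (auto simp: carpet_iff)
qed

text \<open>Columns are refined first, so that every row digit is chosen inside a column that is already
  fixed. This is why the bound needs no relation between \<open>l'\<close> and \<open>k\<close>.\<close>

lemma descendants_upper:
  assumes U: "U \<subseteq> words" and x: "\<And>w. w \<in> U \<Longrightarrow> xnum w k = A" and y: "\<And>w. w \<in> U \<Longrightarrow> ynum w l = B"
    and le: "l \<le> l'" "k \<le> k'" "l' \<le> k'"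
  shows "finite ((\<lambda>w. (xnum w k', ynum w l')) ` U) \<and>
    card ((\<lambda>w. (xnum w k', ynum w l')) ` U) \<le>
      (\<Prod>j\<in>{l..<l'}. maxrows (\<omega> j)) * (\<Prod>j\<in>{k..<k'}. ncols (\<omega> j))"
proof -
  have cols: "finite ((\<lambda>w. (xnum w k', ynum w l)) ` U) \<and>
    card ((\<lambda>w. (xnum w k', ynum w l)) ` U) \<le> (\<Prod>j\<in>{k..<k'}. ncols (\<omega> j))"
    using \<open>k \<le> k'\<close>
  proof (induction k' rule: dec_induct)
    case base
    have "(\<lambda>w. (xnum w k, ynum w l)) ` U \<subseteq> {(A, B)}" using x y by auto
    from finite_subset[OF this] card_mono[OF _ this] show ?case by simp
  next
    case (step k')
    let ?I = "\<lambda>k. (\<lambda>w. (xnum w k, ynum w l)) ` U"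
    have sub: "?I (Suc k') \<subseteq> (\<lambda>((x, y), c). (x * qm k' + c, y)) ` (?I k' \<times> a (\<omega> k') ` {1..N (\<omega> k')})"
    proof
      fix z assume "z \<in> ?I (Suc k')"
      then obtain w where w: "w \<in> U" "z = (xnum w (Suc k'), ynum w l)" by auto
      have "w k' \<in> {1..N (\<omega> k')}" using w U by (auto simp: words_def)
      then show "z \<in> (\<lambda>((x, y), c). (x * qm k' + c, y)) ` (?I k' \<times> a (\<omega> k') ` {1..N (\<omega> k')})"
        using w by (intro image_eqI[of _ _ "((xnum w k', ynum w l), a (\<omega> k') (w k'))"]) auto
    qed
    have fin: "finite (?I k' \<times> a (\<omega> k') ` {1..N (\<omega> k')})" using step by simp
    have "card (?I (Suc k')) \<le> card (?I k' \<times> a (\<omega> k') ` {1..N (\<omega> k')})"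
      using card_mono[OF finite_imageI[OF fin] sub] card_image_le[OF fin] le_trans by blast
    also have "\<dots> \<le> (\<Prod>j\<in>{k..<k'}. ncols (\<omega> j)) * ncols (\<omega> k')"
      using step by (simp add: card_cartesian_product ncols_def)
    finally show ?case using finite_subset[OF sub finite_imageI[OF fin]] step
      by (simp add: prod.atLeastLessThan_Suc)
  qed
  from \<open>l \<le> l'\<close> \<open>l' \<le> k'\<close> show ?thesis
  proof (induction l' rule: dec_induct)
    case base
    then show ?case using cols by simp
  next
    case (step l')
    let ?I = "\<lambda>l. (\<lambda>w. (xnum w k', ynum w l)) ` U"
    \<comment> \<open>Reads off the column digit at position \<open>l'\<close> from the column
      number \<open>x\<close> of level \<open>k'\<close>. The choice of the word does not matter,
      since \<open>l' < k'\<close> and a number determines its digits.\<close>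
    define c where "c x = a (\<omega> l') ((SOME w. w \<in> U \<and> xnum w k' = x) l')" for x
    have c: "c (xnum w k') = a (\<omega> l') (w l')" and c_in: "c (xnum w k') \<in> a (\<omega> l') ` {1..N (\<omega> l')}" if "w \<in> U" for w
    proof -
      define w' where "w' = (SOME w'. w' \<in> U \<and> xnum w' k' = xnum w k')"
      have "w' \<in> U \<and> xnum w' k' = xnum w k'" unfolding w'_def by (rule someI[of _ w]) (simp add: that)
      then have w': "w' \<in> words" "xnum w' k' = xnum w k'" and w: "w \<in> words" using U that by auto
      have "\<forall>j<k'. a (\<omega> j) (w' j) = a (\<omega> j) (w j)"
        using w' radix_num_eq_iff[of k' "\<lambda>j. a (\<omega> j) (w' j)" qm "\<lambda>j. a (\<omega> j) (w j)"] xdigit w by auto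
      then show "c (xnum w k') = a (\<omega> l') (w l')" using step by (simp add: c_def w'_def)
      then show "c (xnum w k') \<in> a (\<omega> l') ` {1..N (\<omega> l')}" using w by (auto simp: words_def)
    qed
    have sub: "?I (Suc l') \<subseteq> (\<Union>(x, y)\<in>?I l'. (\<lambda>e. (x, y * qn l' + e)) ` column_rows (\<omega> l') (c x))"
    proof
      fix z assume "z \<in> ?I (Suc l')"
      then obtain w where w: "w \<in> U" "z = (xnum w k', ynum w (Suc l'))" by auto
      have "w l' \<in> {1..N (\<omega> l')}" using w U by (auto simp: words_def)
      then have "b (\<omega> l') (w l') \<in> column_rows (\<omega> l') (c (xnum w k'))"
        using c[OF w(1)] by (auto simp: column_rows_def)
      then show "z \<in> (\<Union>(x, y)\<in>?I l'. (\<lambda>e. (x, y * qn l' + e)) ` column_rows (\<omega> l') (c x))"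
        using w by (intro UN_I[of "(xnum w k', ynum w l')"]) auto
    qed
    have fin: "finite (?I l')" using step by simp
    have fin': "finite (\<Union>(x, y)\<in>?I l'. (\<lambda>e. (x, y * qn l' + e)) ` column_rows (\<omega> l') (c x))"
      by (rule finite_UN_I[OF fin]) (auto simp: case_prod_unfold)
    have "card (?I (Suc l')) \<le> card (\<Union>(x, y)\<in>?I l'. (\<lambda>e. (x, y * qn l' + e)) ` column_rows (\<omega> l') (c x))"
      by (rule card_mono[OF fin' sub])
    also have "\<dots> \<le> (\<Sum>(x, y)\<in>?I l'. card ((\<lambda>e. (x, y * qn l' + e)) ` column_rows (\<omega> l') (c x)))"
      using card_UN_le[OF fin, of "\<lambda>(x, y). (\<lambda>e. (x, y * qn l' + e)) ` column_rows (\<omega> l') (c x)"]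
      by (simp add: case_prod_unfold)
    also have "\<dots> \<le> (\<Sum>z\<in>?I l'. maxrows (\<omega> l'))"
    proof (rule sum_mono)
      fix z assume "z \<in> ?I l'"
      then obtain w where w: "w \<in> U" "z = (xnum w k', ynum w l')" by auto
      have "card (column_rows (\<omega> l') (c (xnum w k'))) \<le> maxrows (\<omega> l')"
        using c_in[OF w(1)] card_column_rows_le by auto
      then show "(case z of (x, y) \<Rightarrow> card ((\<lambda>e. (x, y * qn l' + e)) ` column_rows (\<omega> l') (c x))) \<le> maxrows (\<omega> l')"
        using w by (auto intro: le_trans[OF card_image_le])
    qed
    also have "\<dots> \<le> (\<Prod>j\<in>{l..<l'}. maxrows (\<omega> j)) * (\<Prod>j\<in>{k..<k'}. ncols (\<omega> j)) * maxrows (\<omega> l')"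
      using step by simp
    finally show ?case using finite_subset[OF sub fin'] step
      by (simp add: prod.atLeastLessThan_Suc mult_ac)
  qed
qed

text \<open>The words that share the approximate square of the word \<open>best\<close> with row
  level \<open>l\<close> and column level \<open>k\<close>. At positions from \<open>l\<close> up to
  \<open>k\<close> the column is still a fullest one while the row in it is free; from the larger of
  \<open>l\<close> and \<open>k\<close> on every map is allowed.\<close>

definition fan :: "nat \<Rightarrow> nat \<Rightarrow> (nat \<Rightarrow> nat) set" where
  "fan l k = {w \<in> words. (\<forall>j<l. w j = best (\<omega> j)) \<and> (\<forall>j<k. a (\<omega> j) (w j) = a (\<omega> j) (best (\<omega> j)))}"

lemma best_word: "(\<lambda>j. best (\<omega> j)) \<in> fan l k"
  using best(1)[OF letters] by (auto simp: fan_def words_def)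

lemma fan_upd:
  assumes "w \<in> fan l k" "i \<in> {1..N (\<omega> j)}" "l \<le> j" "j < k \<Longrightarrow> a (\<omega> j) i = a (\<omega> j) (best (\<omega> j))"
  shows "w(j := i) \<in> fan l k"
  using assms by (auto simp: fan_def words_def)

lemma fan_cells:
  assumes "w \<in> fan l k"
  shows "xnum w k = xnum (\<lambda>j. best (\<omega> j)) k" "ynum w l = ynum (\<lambda>j. best (\<omega> j)) l"
  by (rule radix_num_cong; use assms in \<open>simp add: fan_def\<close>)+

text \<open>Because \<open>l' \<le> k\<close>, the row digits are varied before position
  \<open>k\<close> and the column digits from \<open>k\<close> on. The choices are therefore
  independent and attain the bound of \<open>descendants_upper\<close>.\<close>

lemma descendants_lower:
  assumes le: "l \<le> l'" "l' \<le> k" "k \<le> k'"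
  shows "(\<Prod>j\<in>{l..<l'}. maxrows (\<omega> j)) * (\<Prod>j\<in>{k..<k'}. ncols (\<omega> j)) \<le>
    card ((\<lambda>w. (xnum w k', ynum w l')) ` fan l k)"
proof -
  have fin: "finite ((\<lambda>w. (xnum w k', ynum w l')) ` fan l k)" if "l \<le> l'" "l' \<le> k" "k \<le> k'" for l' k'
  proof -
    have "fan l k \<subseteq> words" by (auto simp: fan_def)
    from descendants_upper[OF this fan_cells \<open>l \<le> l'\<close> \<open>k \<le> k'\<close>] show ?thesis using that by simp
  qed
  have rows: "(\<Prod>j\<in>{l..<l'}. maxrows (\<omega> j)) \<le> card ((\<lambda>w. (xnum w k, ynum w l')) ` fan l k)"
    using \<open>l \<le> l'\<close> \<open>l' \<le> k\<close>
  proof (induction l' rule: dec_induct)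
    case base
    have "(\<lambda>w. (xnum w k, ynum w l)) ` fan l k \<noteq> {}" using best_word by blast
    then show ?case using fin[of l k] base by (simp add: Suc_le_eq card_gt_0_iff)
  next
    case (step l')
    let ?I = "\<lambda>l'. (\<lambda>w. (xnum w k, ynum w l')) ` fan l k"
    let ?C = "column_rows (\<omega> l') (a (\<omega> l') (best (\<omega> l')))"
    let ?f = "\<lambda>((x, y), e). (x, y * qn l' + e)"
    have lt: "e < qn l'" if "e \<in> ?C" for e
      using that digits[OF letters] by (auto simp: column_rows_def)
    have inj: "inj_on ?f (?I l' \<times> ?C)"
      using lt by (auto simp: inj_on_def mult_add_digit_eq_iff)
    have sub: "?f ` (?I l' \<times> ?C) \<subseteq> ?I (Suc l')"
    proof clarify
      fix w e assume w: "w \<in> fan l k" and "e \<in> ?C"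
      then obtain i where i: "i \<in> {1..N (\<omega> l')}" "a (\<omega> l') i = a (\<omega> l') (best (\<omega> l'))" "e = b (\<omega> l') i"
        by (auto simp: column_rows_def)
      have w': "w(l' := i) \<in> fan l k" using w i step by (intro fan_upd) auto
      have "xnum (w(l' := i)) k = xnum w k" using fan_cells(1)[OF w] fan_cells(1)[OF w'] by simp
      moreover have "ynum (w(l' := i)) l' = ynum w l'" by (rule radix_num_cong) auto
      ultimately have "(xnum w k, ynum w l' * qn l' + e) = (xnum (w(l' := i)) k, ynum (w(l' := i)) (Suc l'))"
        using i by simp
      then show "(xnum w k, ynum w l' * qn l' + e) \<in> ?I (Suc l')" using w' by blast
    qed
    have "card (?I l') * card ?C = card (?f ` (?I l' \<times> ?C))"
      using card_image[OF inj] by (simp add: card_cartesian_product)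
    also have "\<dots> \<le> card (?I (Suc l'))" using card_mono[OF fin sub] step le by simp
    finally have "card (?I l') * maxrows (\<omega> l') \<le> card (?I (Suc l'))" using best(2)[OF letters] by simp
    moreover have "(\<Prod>j\<in>{l..<l'}. maxrows (\<omega> j)) * maxrows (\<omega> l') \<le> card (?I l') * maxrows (\<omega> l')"
      using step by (intro mult_right_mono) auto
    ultimately show ?case unfolding prod.atLeastLessThan_Suc[OF step(1)] using le_trans by blast
  qed
  from \<open>k \<le> k'\<close> show ?thesis
  proof (induction k' rule: dec_induct)
    case base
    then show ?case using rows by simp
  next
    case (step k')
    let ?I = "\<lambda>k'. (\<lambda>w. (xnum w k', ynum w l')) ` fan l k"
    let ?C = "a (\<omega> k') ` {1..N (\<omega> k')}"
    let ?f = "\<lambda>((x, y), e). (x * qm k' + e, y)"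
    have lt: "e < qm k'" if "e \<in> ?C" for e
      using that digits[OF letters] by auto
    have inj: "inj_on ?f (?I k' \<times> ?C)"
      using lt by (auto simp: inj_on_def mult_add_digit_eq_iff)
    have sub: "?f ` (?I k' \<times> ?C) \<subseteq> ?I (Suc k')"
    proof clarify
      fix w i assume w: "w \<in> fan l k" and i: "i \<in> {1..N (\<omega> k')}"
      have w': "w(k' := i) \<in> fan l k" using w i step le by (intro fan_upd) auto
      have "xnum (w(k' := i)) k' = xnum w k'" "ynum (w(k' := i)) l' = ynum w l'"
        by (rule radix_num_cong; use step le in auto)+
      then have "(xnum w k' * qm k' + a (\<omega> k') i, ynum w l') = (xnum (w(k' := i)) (Suc k'), ynum (w(k' := i)) l')"
        by simp
      then show "(xnum w k' * qm k' + a (\<omega> k') i, ynum w l') \<in> ?I (Suc k')" using w' by blast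
    qed
    have "card (?I k') * ncols (\<omega> k') = card (?f ` (?I k' \<times> ?C))"
      using card_image[OF inj] by (simp add: card_cartesian_product ncols_def)
    also have "\<dots> \<le> card (?I (Suc k'))" using card_mono[OF fin sub] step le by simp
    finally have "card (?I k') * ncols (\<omega> k') \<le> card (?I (Suc k'))" .
    moreover have "(\<Prod>j\<in>{l..<l'}. maxrows (\<omega> j)) * ((\<Prod>j\<in>{k..<k'}. ncols (\<omega> j)) * ncols (\<omega> k')) \<le> card (?I k') * ncols (\<omega> k')"
      using step unfolding mult.assoc[symmetric] by (intro mult_right_mono) auto
    ultimately show ?case unfolding prod.atLeastLessThan_Suc[OF step(1)] using le_trans by blast
  qed
qed

end

section \<open>Covering numbers\<close>

context carpet_realisation
begin

abbreviation "lnB j \<equiv> ln (real (ncols (\<omega> j)))"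
abbreviation "lnC j \<equiv> ln (real (maxrows (\<omega> j)))"

lemma xden_eq: "radix_den qm k = exp (\<Sum>j<k. lnm j)"
  and yden_eq: "radix_den qn k = exp (\<Sum>j<k. lnn j)"
  using qm_pos qn_pos by (simp_all add: exp_sum)

lemma prod_ncols_eq: "real (\<Prod>j\<in>I. ncols (\<omega> j)) = exp (\<Sum>j\<in>I. lnB j)" if "finite I" for I
proof -
  have "0 < real (ncols (\<omega> j))" for j using ncols_pos[OF letters[of j]] by simp
  then show ?thesis using that by (simp add: exp_sum)
qed

lemma prod_maxrows_eq: "real (\<Prod>j\<in>I. maxrows (\<omega> j)) = exp (\<Sum>j\<in>I. lnC j)" if "finite I" for I
proof -
  have "0 < real (maxrows (\<omega> j))" for j using maxrows_pos[OF letters[of j]] by simp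
  then show ?thesis using that by (simp add: exp_sum)
qed

lemmas xlevel_ge = level_ge[of "ln 2" lnm, OF ln2_pos lnm_bounds]
  and ylevel_ge = level_ge[of "ln 2" lnn, OF ln2_pos lnn_bounds]
  and xlevel_upper = level_upper[of "ln 2" lnm, OF ln2_pos lnm_bounds]
  and ylevel_upper = level_upper[of "ln 2" lnn, OF ln2_pos lnn_bounds]
  and ylevel_le_iff = level_le_iff[of "ln 2" lnn, OF ln2_pos lnn_bounds]
  and xlevel_mono = level_mono[of "ln 2" lnm, OF ln2_pos lnm_bounds]
  and ylevel_mono = level_mono[of "ln 2" lnn, OF ln2_pos lnn_bounds]
  and xlevel_window = level_window[of "ln 2" lnm, OF ln2_pos lnm_bounds]
  and ylevel_window = level_window[of "ln 2" lnn, OF ln2_pos lnn_bounds]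
  and ylevel_at_sum = level_at_sum[of "ln 2" lnn, OF ln2_pos lnn_bounds]

lemma ylevel_le_xlevel: "ylevel t \<le> xlevel t"
proof -
  have "(\<Sum>j<k. lnm j) \<le> (\<Sum>j<k. lnn j)" for k
    using ln_m_less_ln_n[OF letters] by (intro sum_mono) (simp add: less_imp_le)
  then show ?thesis using xlevel_ge[of t] order_trans by (subst ylevel_le_iff) blast
qed

text \<open>At scale \<open>r\<close> the levels are read off at \<open>ln (3 / r)\<close>: the factor 3 makes both sides of an
  approximate square at most \<open>r / 3\<close>, hence its diameter less than \<open>r\<close>.\<close>

lemma scale_xden:
  assumes "0 < r" "r \<le> 1"
  shows "3 \<le> r * radix_den qm (xlevel (ln (3 / r)))"
    "r * radix_den qm (xlevel (ln (3 / r))) \<le> 3 * exp log_max"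
proof -
  have t: "0 \<le> ln (3 / r)" using assms by (intro ln_ge_zero) (simp add: field_simps)
  have "exp (ln (3 / r)) \<le> radix_den qm (xlevel (ln (3 / r)))"
    "radix_den qm (xlevel (ln (3 / r))) \<le> exp (ln (3 / r) + log_max)"
    unfolding xden_eq using xlevel_ge xlevel_upper[OF t] by simp_all
  then show "3 \<le> r * radix_den qm (xlevel (ln (3 / r)))"
    "r * radix_den qm (xlevel (ln (3 / r))) \<le> 3 * exp log_max"
    using assms by (simp_all add: exp_add field_simps)
qed

lemma scale_yden:
  assumes "0 < r" "r \<le> 1"
  shows "3 \<le> r * radix_den qn (ylevel (ln (3 / r)))"
    "r * radix_den qn (ylevel (ln (3 / r))) \<le> 3 * exp log_max"
proof -
  have t: "0 \<le> ln (3 / r)" using assms by (intro ln_ge_zero) (simp add: field_simps)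
  have "exp (ln (3 / r)) \<le> radix_den qn (ylevel (ln (3 / r)))"
    "radix_den qn (ylevel (ln (3 / r))) \<le> exp (ln (3 / r) + log_max)"
    unfolding yden_eq using ylevel_ge ylevel_upper[OF t] by simp_all
  then show "3 \<le> r * radix_den qn (ylevel (ln (3 / r)))"
    "r * radix_den qn (ylevel (ln (3 / r))) \<le> 3 * exp log_max"
    using assms by (simp_all add: exp_add field_simps)
qed

lemma box_diameter:
  assumes r: "0 < r" "r \<le> 1"
    and "p \<in> xcell (xlevel (ln (3 / r))) A \<times> ycell (ylevel (ln (3 / r))) B"
    and "p' \<in> xcell (xlevel (ln (3 / r))) A \<times> ycell (ylevel (ln (3 / r))) B"
  shows "dist p p' < r"
proof -
  have cell: "\<bar>x - x'\<bar> \<le> r / 3" if "x \<in> radix_cell q k A" "x' \<in> radix_cell q k A" "3 \<le> r * radix_den q k"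
    for x x' q k A
  proof -
    have "0 < r * radix_den q k" using that(3) by linarith
    then have pos: "0 < radix_den q k" using r(1) by (rule zero_less_mult_pos)
    have "\<bar>x - x'\<bar> \<le> (real A + 1) / radix_den q k - real A / radix_den q k"
      using that(1,2) by (auto simp: radix_cell_def abs_le_iff)
    also have "\<dots> = 1 / radix_den q k" by (simp add: diff_divide_distrib[symmetric])
    also have "\<dots> \<le> r / 3" using that(3) pos by (simp add: field_simps)
    finally show ?thesis .
  qed
  obtain x y x' y' where p: "p = (x, y)" "p' = (x', y')" by (cases p, cases p')
  have x: "x \<in> xcell (xlevel (ln (3 / r))) A" "x' \<in> xcell (xlevel (ln (3 / r))) A"
    and y: "y \<in> ycell (ylevel (ln (3 / r))) B" "y' \<in> ycell (ylevel (ln (3 / r))) B"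
    using assms(3,4) by (auto simp: p)
  have "\<bar>x - x'\<bar> \<le> r / 3" "\<bar>y - y'\<bar> \<le> r / 3"
    using cell[OF x scale_xden(1)[OF r]] cell[OF y scale_yden(1)[OF r]] by blast+
  moreover have "dist p p' \<le> \<bar>x - x'\<bar> + \<bar>y - y'\<bar>"
    using sqrt_sum_squares_le_sum_abs[of "x - x'" "y - y'"] by (simp add: p dist_Pair_Pair dist_real_def)
  ultimately show ?thesis using r by linarith
qed

definition near :: "real \<Rightarrow> real \<times> real \<Rightarrow> (nat \<times> nat) set" where
  "near r c = {A. xcell (xlevel (ln (3 / r))) A \<inter> {fst c - r..fst c + r} \<noteq> {}} \<times>
    {B. ycell (ylevel (ln (3 / r))) B \<inter> {snd c - r..snd c + r} \<noteq> {}}"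

text \<open>The bound of \<open>card_cells_meeting\<close> with
  \<open>\<kappa> = 3 * exp log_max\<close>, once for each coordinate; it depends neither on the
  scale nor on the centre.\<close>

definition near_bound :: real where
  "near_bound = (2 * (3 * exp log_max) + 2)\<^sup>2"

lemma near_bound_pos: "0 < near_bound"
  unfolding near_bound_def by (intro zero_less_power) (simp add: add_pos_pos)

lemma near:
  assumes r: "0 < r" "r \<le> 1"
  shows "finite (near r c)" "real (card (near r c)) \<le> near_bound"
proof -
  note x = card_cells_meeting[of qm r "xlevel (ln (3 / r))" "3 * exp log_max" "fst c", OF qm_pos _ scale_xden(2)[OF r]]
  note y = card_cells_meeting[of qn r "ylevel (ln (3 / r))" "3 * exp log_max" "snd c", OF qn_pos _ scale_yden(2)[OF r]]
  show "finite (near r c)" using x(1) y(1) r by (simp add: near_def)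
  show "real (card (near r c)) \<le> near_bound"
    using x(2) y(2) r unfolding near_def near_bound_def card_cartesian_product power2_eq_square of_nat_mult
    by (intro mult_mono) (auto simp: add_nonneg_nonneg)
qed

lemma near_memI:
  assumes "p \<in> ball c r" "p \<in> xcell (xlevel (ln (3 / r))) A \<times> ycell (ylevel (ln (3 / r))) B"
  shows "(A, B) \<in> near r c"
proof -
  have "dist c p < r" using assms(1) by simp
  moreover have "dist (fst c) (fst p) \<le> dist c p" "dist (snd c) (snd p) \<le> dist c p"
    by (rule dist_fst_le dist_snd_le)+
  ultimately have "fst p \<in> {fst c - r..fst c + r}" "snd p \<in> {snd c - r..snd c + r}"
    by (auto simp: dist_real_def)
  moreover have "fst p \<in> xcell (xlevel (ln (3 / r))) A" "snd p \<in> ycell (ylevel (ln (3 / r))) B"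
    using assms(2) by auto
  ultimately show ?thesis unfolding near_def by blast
qed

lemma covering_number_le:
  assumes "finite \<B>" "\<B> \<subseteq> {F \<inter> ball c \<rho> |c \<rho>. c \<in> F \<and> 0 < \<rho> \<and> \<rho> \<le> r}" "E \<subseteq> \<Union>\<B>"
  shows "covering_number F r E \<le> enat (card \<B>)"
  unfolding covering_number_def by (rule Inf_lower) (use assms in blast)

definition rows_sum :: "real \<Rightarrow> real \<Rightarrow> real" where
  "rows_sum s t = (\<Sum>j\<in>{ylevel s..<ylevel t}. lnC j)"

definition cols_sum :: "real \<Rightarrow> real \<Rightarrow> real" where
  "cols_sum s t = (\<Sum>j\<in>{xlevel s..<xlevel t}. lnB j)"

text \<open>The ball of radius \<open>R\<close> meets at most \<open>near_bound\<close> approximate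
  squares of scale \<open>R\<close>, and the part of the carpet in a descendant of scale
  \<open>r\<close> lies in one ball of radius \<open>r\<close>. Covering balls must be centred in
  the carpet, hence the choice of a point \<open>cent Q\<close> in each descendant that meets
  it.\<close>

lemma covering_upper:
  assumes r: "0 < r" "r \<le> R" "R \<le> 1"
  shows "sup_covering (carpet m n N a b \<omega>) R r \<le>
    ereal (near_bound * exp (rows_sum (ln (3 / R)) (ln (3 / r)) + cols_sum (ln (3 / R)) (ln (3 / r))))"
  unfolding sup_covering_def
proof (rule SUP_least)
  fix x assume "x \<in> carpet m n N a b \<omega>"
  define F where "F = carpet m n N a b \<omega>"
  define l where "l = ylevel (ln (3 / R))"
  define k where "k = xlevel (ln (3 / R))"
  define l' where "l' = ylevel (ln (3 / r))"
  define k' where "k' = xlevel (ln (3 / r))"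
  have t: "ln (3 / R) \<le> ln (3 / r)" using r by (simp add: frac_le)
  have le: "l \<le> l'" "k \<le> k'" "l \<le> k" "l' \<le> k'"
    unfolding l_def l'_def k_def k'_def using t ylevel_mono xlevel_mono ylevel_le_xlevel by auto
  have R: "0 < R" "R \<le> 1" and r1: "0 < r" "r \<le> 1" using r by auto
  define W where "W P = {w \<in> words. xnum w k = fst P \<and> ynum w l = snd P}" for P
  define I where "I P = (\<lambda>w. (xnum w k', ynum w l')) ` W P" for P
  define bd where "bd = (\<Prod>j\<in>{l..<l'}. maxrows (\<omega> j)) * (\<Prod>j\<in>{k..<k'}. ncols (\<omega> j))"
  have I: "finite (I P)" "card (I P) \<le> bd" for P
  proof -
    have W: "W P \<subseteq> words" "\<And>w. w \<in> W P \<Longrightarrow> xnum w k = fst P" "\<And>w. w \<in> W P \<Longrightarrow> ynum w l = snd P"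
      by (auto simp: W_def)
    show "finite (I P)" "card (I P) \<le> bd"
      using descendants_upper[OF W le(1,2,4)] by (simp_all add: I_def bd_def)
  qed
  define Qs where "Qs = (\<Union>P\<in>near R x. I P)"
  have finQ: "finite Qs" unfolding Qs_def using near(1)[OF R] I by blast
  have "card Qs \<le> (\<Sum>P\<in>near R x. card (I P))" unfolding Qs_def by (rule card_UN_le[OF near(1)[OF R]])
  also have "\<dots> \<le> card (near R x) * bd" using I(2) by (rule sum_bounded_above[where 'a = nat, simplified])
  finally have "real (card Qs) \<le> real (card (near R x)) * real bd"
    unfolding of_nat_mult[symmetric] of_nat_le_iff .
  also have "\<dots> \<le> near_bound * real bd" using near(2)[OF R, of x] by (rule mult_right_mono) simp
  finally have cardQ: "real (card Qs) \<le> near_bound * real bd" .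
  define box where "box Q = F \<inter> (xcell k' (fst Q) \<times> ycell l' (snd Q))" for Q
  define cent where "cent Q = (SOME p. p \<in> box Q)" for Q
  have cent: "cent Q \<in> box Q" if "p \<in> box Q" for p Q unfolding cent_def using that by (rule someI)
  define \<B> where "\<B> = (\<lambda>Q. F \<inter> ball (cent Q) r) ` {Q \<in> Qs. box Q \<noteq> {}}"
  have "covering_number F r (F \<inter> ball x R) \<le> enat (card \<B>)"
  proof (rule covering_number_le)
    show "finite \<B>" using finQ by (simp add: \<B>_def)
    show "\<B> \<subseteq> {F \<inter> ball c \<rho> |c \<rho>. c \<in> F \<and> 0 < \<rho> \<and> \<rho> \<le> r}"
      unfolding \<B>_def using cent r by (fastforce simp: box_def)
    show "F \<inter> ball x R \<subseteq> \<Union>\<B>"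
    proof
      fix p assume p: "p \<in> F \<inter> ball x R"
      then obtain w where w: "w \<in> words" "\<And>j. j \<le> k' \<Longrightarrow> fst p \<in> xcell j (xnum w j)"
        "\<And>j. j \<le> k' \<Longrightarrow> snd p \<in> ycell j (ynum w j)"
        using carpet_word[of p k'] unfolding F_def by blast
      have "p \<in> xcell k (xnum w k) \<times> ycell l (ynum w l)" using w(2)[of k] w(3)[of l] le by (auto simp: mem_Times_iff)
      then have "(xnum w k, ynum w l) \<in> near R x" using p near_memI[of p x R] unfolding k_def l_def by blast
      moreover have "(xnum w k', ynum w l') \<in> I (xnum w k, ynum w l)" using w(1) by (auto simp: I_def W_def)
      ultimately have Q: "(xnum w k', ynum w l') \<in> Qs" by (auto simp: Qs_def)
      have box: "p \<in> box (xnum w k', ynum w l')" using p w le by (auto simp: box_def mem_Times_iff)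
      have "dist (cent (xnum w k', ynum w l')) p < r"
        using box cent[OF box] box_diameter[OF r1] by (auto simp: box_def k'_def l'_def)
      then have "p \<in> F \<inter> ball (cent (xnum w k', ynum w l')) r" using p by auto
      then show "p \<in> \<Union>\<B>" unfolding \<B>_def using Q box by blast
    qed
  qed
  also have "\<dots> \<le> enat (card Qs)"
    unfolding \<B>_def using finQ by (auto intro!: le_trans[OF card_image_le] card_mono)
  finally have "ereal_of_enat (covering_number F r (F \<inter> ball x R)) \<le> ereal_of_enat (enat (card Qs))"
    by (simp only: ereal_of_enat_le_iff)
  also have "\<dots> = ereal (real (card Qs))" by simp
  also have "\<dots> \<le> ereal (near_bound * real bd)" using cardQ by simp
  also have "real bd = exp (rows_sum (ln (3 / R)) (ln (3 / r)) + cols_sum (ln (3 / R)) (ln (3 / r)))"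
    unfolding bd_def of_nat_mult rows_sum_def cols_sum_def
    by (simp only: prod_maxrows_eq prod_ncols_eq finite_atLeastLessThan exp_add l_def k_def l'_def k'_def)
  finally show "ereal_of_enat (covering_number (carpet m n N a b \<omega>) r (carpet m n N a b \<omega> \<inter> ball x R))
      \<le> ereal (near_bound * exp (rows_sum (ln (3 / R)) (ln (3 / r)) + cols_sum (ln (3 / R)) (ln (3 / r))))"
    unfolding F_def .
qed

text \<open>All points coded by \<open>fan l k\<close> lie within \<open>R\<close> of the point
  coded by \<open>best\<close>, and a covering ball contains such points from at most
  \<open>near_bound\<close> boxes of scale \<open>r\<close>. Row digits are credited only up to
  \<open>k\<close>, where they are independent of the column digits.\<close>

lemma covering_lower:
  assumes r: "0 < r" "r \<le> R" "R \<le> 1"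
  shows "ereal (exp ((\<Sum>j\<in>{ylevel (ln (3 / R))..<min (ylevel (ln (3 / r))) (xlevel (ln (3 / R)))}. lnC j)
      + cols_sum (ln (3 / R)) (ln (3 / r))) / near_bound)
    \<le> sup_covering (carpet m n N a b \<omega>) R r"
proof -
  define F where "F = carpet m n N a b \<omega>"
  define l where "l = ylevel (ln (3 / R))"
  define k where "k = xlevel (ln (3 / R))"
  define l1 where "l1 = ylevel (ln (3 / r))"
  define l' where "l' = min l1 k"
  define k' where "k' = xlevel (ln (3 / r))"
  have t: "ln (3 / R) \<le> ln (3 / r)" using r by (simp add: frac_le)
  have "l \<le> l1" "l \<le> k" "k \<le> k'"
    unfolding l_def l1_def k_def k'_def using t ylevel_mono xlevel_mono ylevel_le_xlevel by auto
  then have le: "l \<le> l'" "l' \<le> k" "k \<le> k'" by (auto simp: l'_def)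
  have R: "0 < R" "R \<le> 1" and r1: "0 < r" "r \<le> 1" using r by auto
  define bd where "bd = (\<Prod>j\<in>{l..<l'}. maxrows (\<omega> j)) * (\<Prod>j\<in>{k..<k'}. ncols (\<omega> j))"
  define D where "D = (\<lambda>w. (xnum w k', ynum w l1)) ` fan l k"
  have "fan l k \<subseteq> words" by (auto simp: fan_def)
  have "l1 \<le> k'" unfolding l1_def k'_def by (rule ylevel_le_xlevel)
  have fin: "finite D"
    using descendants_upper[OF \<open>fan l k \<subseteq> words\<close> fan_cells(1)[of _ l k] fan_cells(2)[of _ l k] \<open>l \<le> l1\<close> \<open>k \<le> k'\<close> \<open>l1 \<le> k'\<close>]
    unfolding D_def by blast
  have "bd \<le> card ((\<lambda>w. (xnum w k', ynum w l')) ` fan l k)"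
    unfolding bd_def using le by (rule descendants_lower)
  also have "\<dots> \<le> card D"
  proof -
    \<comment> \<open>Truncates the row number from level \<open>l1\<close> to level
      \<open>l'\<close>; well defined since the number of level \<open>l1\<close> determines the
      first \<open>l1\<close> digits. So boxes counted with the shorter row number are at most as
      many as the true boxes in \<open>D\<close>.\<close>
    define h where "h z = (xnum (SOME w. w \<in> fan l k \<and> (xnum w k', ynum w l1) = z) k',
      ynum (SOME w. w \<in> fan l k \<and> (xnum w k', ynum w l1) = z) l')" for z
    have "h (xnum w k', ynum w l1) = (xnum w k', ynum w l')" if w: "w \<in> fan l k" for w
    proof -
      define v where "v = (SOME v. v \<in> fan l k \<and> (xnum v k', ynum v l1) = (xnum w k', ynum w l1))"
      have v: "v \<in> fan l k \<and> (xnum v k', ynum v l1) = (xnum w k', ynum w l1)"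
        unfolding v_def by (rule someI[of _ w]) (simp add: w)
      then have words: "v \<in> words" "w \<in> words" using w \<open>fan l k \<subseteq> words\<close> by auto
      have "\<forall>j<l1. b (\<omega> j) (v j) = b (\<omega> j) (w j)"
        using v radix_num_eq_iff[of l1 "\<lambda>j. b (\<omega> j) (v j)" qn "\<lambda>j. b (\<omega> j) (w j)"] ydigit words by auto
      then have "ynum v l' = ynum w l'" by (intro radix_num_cong) (auto simp: l'_def)
      then show ?thesis using v unfolding h_def v_def[symmetric] by simp
    qed
    then have "(\<lambda>w. (xnum w k', ynum w l')) ` fan l k \<subseteq> h ` D"
      unfolding D_def image_image by (auto intro!: image_eqI)
    then show ?thesis using card_mono[OF finite_imageI[OF fin]] card_image_le[OF fin] le_trans by blast
  qed
  finally have bd: "bd \<le> card D" .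
  define word where "word Q = (SOME w. w \<in> fan l k \<and> (xnum w k', ynum w l1) = Q)" for Q
  have word: "word Q \<in> fan l k" "(xnum (word Q) k', ynum (word Q) l1) = Q" if "Q \<in> D" for Q
  proof -
    have "\<exists>w. w \<in> fan l k \<and> (xnum w k', ynum w l1) = Q" using that by (auto simp: D_def)
    from someI_ex[OF this] show "word Q \<in> fan l k" "(xnum (word Q) k', ynum (word Q) l1) = Q"
      by (auto simp: word_def)
  qed
  define pt where "pt w = (SOME p. p \<in> F \<and> (\<forall>k. fst p \<in> xcell k (xnum w k) \<and> snd p \<in> ycell k (ynum w k)))" for w
  have pt: "pt w \<in> F" "pt w \<in> xcell i (xnum w i) \<times> ycell j (ynum w j)" if "w \<in> fan l k" for w i j
  proof -
    have "\<exists>p. p \<in> F \<and> (\<forall>k. fst p \<in> xcell k (xnum w k) \<and> snd p \<in> ycell k (ynum w k))"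
      using word_point[of w] that \<open>fan l k \<subseteq> words\<close> unfolding F_def by blast
    from someI_ex[OF this] show "pt w \<in> F" "pt w \<in> xcell i (xnum w i) \<times> ycell j (ynum w j)"
      by (auto simp: pt_def mem_Times_iff)
  qed
  define x where "x = pt (\<lambda>j. best (\<omega> j))"
  have x: "x \<in> F" unfolding x_def using pt(1)[OF best_word] .
  have near_x: "pt w \<in> F \<inter> ball x R" if "w \<in> fan l k" for w
  proof -
    have w: "pt w \<in> xcell k (xnum (\<lambda>j. best (\<omega> j)) k) \<times> ycell l (ynum (\<lambda>j. best (\<omega> j)) l)"
      using pt(2)[OF that, of k l] fan_cells[OF that] by simp
    have "x \<in> xcell k (xnum (\<lambda>j. best (\<omega> j)) k) \<times> ycell l (ynum (\<lambda>j. best (\<omega> j)) l)"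
      unfolding x_def by (rule pt(2)[OF best_word])
    from box_diameter[OF R this[unfolded k_def l_def] w[unfolded k_def l_def]]
    have "dist x (pt w) < R" .
    then show ?thesis using pt(1)[OF that] by simp
  qed
  have "enat (nat \<lceil>real bd / near_bound\<rceil>) \<le> covering_number F r (F \<inter> ball x R)"
    unfolding covering_number_def
  proof (rule Inf_greatest, clarify)
    fix \<B> assume \<B>: "finite \<B>" "\<B> \<subseteq> {F \<inter> ball c \<rho> |c \<rho>. c \<in> F \<and> 0 < \<rho> \<and> \<rho> \<le> r}" "F \<inter> ball x R \<subseteq> \<Union>\<B>"
    \<comment> \<open>A ball of radius at most \<open>r\<close> meets few boxes of scale
      \<open>r\<close>, so it accounts for few of the chosen points
      \<open>pt (word Q)\<close>.\<close>
    have each: "finite {Q \<in> D. pt (word Q) \<in> S} \<and> real (card {Q \<in> D. pt (word Q) \<in> S}) \<le> near_bound" if S: "S \<in> \<B>" for S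
    proof -
      obtain c \<rho> where c: "S = F \<inter> ball c \<rho>" "\<rho> \<le> r" using S \<B>(2) by blast
      have "{Q \<in> D. pt (word Q) \<in> S} \<subseteq> near r c"
      proof clarify
        fix A B assume Q: "(A, B) \<in> D" and "pt (word (A, B)) \<in> S"
        then have "pt (word (A, B)) \<in> ball c r" using c by auto
        moreover have "pt (word (A, B)) \<in> xcell k' A \<times> ycell l1 B"
          using pt(2)[OF word(1)[OF Q], of k' l1] word(2)[OF Q] by simp
        ultimately show "(A, B) \<in> near r c" unfolding k'_def l1_def by (rule near_memI)
      qed
      from finite_subset[OF this near(1)[OF r1]] card_mono[OF near(1)[OF r1] this]
      show ?thesis using near(2)[OF r1, of c] by linarith
    qed
    have "D \<subseteq> (\<Union>S\<in>\<B>. {Q \<in> D. pt (word Q) \<in> S})" using word near_x \<B>(3) by blast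
    then have "card D \<le> (\<Sum>S\<in>\<B>. card {Q \<in> D. pt (word Q) \<in> S})"
      using card_mono[of "\<Union>S\<in>\<B>. {Q \<in> D. pt (word Q) \<in> S}" D] card_UN_le[OF \<B>(1)] each \<B>(1) le_trans by blast
    then have "real (card D) \<le> (\<Sum>S\<in>\<B>. real (card {Q \<in> D. pt (word Q) \<in> S}))"
      unfolding of_nat_sum[symmetric] of_nat_le_iff .
    also have "\<dots> \<le> real (card \<B>) * near_bound" using each by (intro sum_bounded_above) blast
    finally have "real bd \<le> real (card \<B>) * near_bound" using bd by linarith
    then have "real bd / near_bound \<le> real (card \<B>)" using near_bound_pos by (simp add: divide_le_eq)
    then show "enat (nat \<lceil>real bd / near_bound\<rceil>) \<le> enat (card \<B>)" by (simp add: ceiling_le_iff)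
  qed
  then have "ereal_of_enat (enat (nat \<lceil>real bd / near_bound\<rceil>)) \<le> ereal_of_enat (covering_number F r (F \<inter> ball x R))"
    by (simp only: ereal_of_enat_le_iff)
  moreover have "ereal (real bd / near_bound) \<le> ereal_of_enat (enat (nat \<lceil>real bd / near_bound\<rceil>))"
    by (simp add: real_nat_ceiling_ge)
  moreover have "ereal_of_enat (covering_number F r (F \<inter> ball x R)) \<le> sup_covering F R r"
    unfolding sup_covering_def using x by (rule SUP_upper)
  ultimately have "ereal (real bd / near_bound) \<le> sup_covering F R r" using order_trans by blast
  moreover have "real bd = exp ((\<Sum>j\<in>{l..<min l1 k}. lnC j) + cols_sum (ln (3 / R)) (ln (3 / r)))"
    unfolding bd_def of_nat_mult cols_sum_def
    by (simp only: prod_maxrows_eq prod_ncols_eq finite_atLeastLessThan exp_add l'_def k_def k'_def)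
  ultimately show ?thesis unfolding F_def l_def l1_def k_def by simp
qed

end

section \<open>Dimensions of a single realisation\<close>

definition gauge_of :: "(real \<Rightarrow> real) \<Rightarrow> real \<Rightarrow> real" where
  "gauge_of \<psi> R = \<psi> R * \<bar>ln R\<bar>"

lemma inner_scale:
  assumes R: "0 < R" "R < 1" and \<psi>: "0 < \<psi> R"
  shows "0 < R powr (1 + \<psi> R)" "R powr (1 + \<psi> R) \<le> R"
    "(R / R powr (1 + \<psi> R)) powr s = exp (s * gauge_of \<psi> R)"
    "ln (3 / R powr (1 + \<psi> R)) = ln (3 / R) + gauge_of \<psi> R"
    "ln (R / R powr (1 + \<psi> R)) = gauge_of \<psi> R"
    "0 < gauge_of \<psi> R"
proof -
  have lnR: "ln R < 0" using R by simp
  show pos: "0 < R powr (1 + \<psi> R)" using R by simp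
  have "R powr (1 + \<psi> R) \<le> R powr 1" using R \<psi> by (intro powr_mono') auto
  then show "R powr (1 + \<psi> R) \<le> R" using R by simp
  show 1: "ln (R / R powr (1 + \<psi> R)) = gauge_of \<psi> R"
    using R lnR by (simp add: gauge_of_def ln_div ln_powr algebra_simps)
  have "0 < R / R powr (1 + \<psi> R)" using R pos by simp
  then show "(R / R powr (1 + \<psi> R)) powr s = exp (s * gauge_of \<psi> R)"
    using 1 by (simp only: powr_def[of "R / R powr (1 + \<psi> R)" s]) (use R in auto)
  show "ln (3 / R powr (1 + \<psi> R)) = ln (3 / R) + gauge_of \<psi> R"
    using R lnR by (simp add: gauge_of_def ln_div ln_powr algebra_simps)
  show "0 < gauge_of \<psi> R" using lnR \<psi> by (simp add: gauge_of_def mult_pos_neg)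
qed

lemma gen_assouad_spectrum_le:
  assumes \<psi>: "\<And>x. 0 < x \<Longrightarrow> x < 1 \<Longrightarrow> 0 < \<psi> x" and "0 < C'"
    and le: "\<And>R. 0 < R \<Longrightarrow> R < 1 \<Longrightarrow>
      sup_covering F R (R powr (1 + \<psi> R)) \<le> ereal (C' * exp (s * gauge_of \<psi> R))"
  shows "gen_assouad_spectrum \<psi> F \<le> ereal s"
  unfolding gen_assouad_spectrum_def
  by (rule Inf_lower) (use assms inner_scale(3) in \<open>auto simp: Let_def intro!: exI[of _ C']\<close>)

text \<open>An admissible \<open>s < D\<close> would bound
  \<open>exp ((D - s) * gauge_of \<psi> R)\<close> by \<open>C' / \<kappa>\<close>. Lower bounds
  along any scales with unbounded gauge therefore suffice.\<close>

lemma gen_assouad_spectrum_ge: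
  assumes \<psi>: "\<And>x. 0 < x \<Longrightarrow> x < 1 \<Longrightarrow> 0 < \<psi> x" and "0 < \<kappa>"
    and ge: "\<And>M. \<exists>R. 0 < R \<and> R < 1 \<and> M \<le> gauge_of \<psi> R \<and>
      ereal (\<kappa> * exp (D * gauge_of \<psi> R)) \<le> sup_covering F R (R powr (1 + \<psi> R))"
  shows "ereal D \<le> gen_assouad_spectrum \<psi> F"
  unfolding gen_assouad_spectrum_def
proof (rule Inf_greatest, clarify)
  fix s C' assume C': "0 < C'"
    and le: "\<forall>R. 0 < R \<and> R < 1 \<longrightarrow> (let r = R powr (1 + \<psi> R) in sup_covering F R r \<le> ereal (C' * (R / r) powr s))"
  show "ereal D \<le> ereal s"
  proof (rule ccontr)
    assume "\<not> ereal D \<le> ereal s"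
    then have sD: "s < D" by simp
    define M where "M = (ln (C' / \<kappa>) + 1) / (D - s)"
    obtain R where R: "0 < R" "R < 1" "M \<le> gauge_of \<psi> R"
      and lo: "ereal (\<kappa> * exp (D * gauge_of \<psi> R)) \<le> sup_covering F R (R powr (1 + \<psi> R))"
      using ge[of M] by blast
    have "sup_covering F R (R powr (1 + \<psi> R)) \<le> ereal (C' * (R / R powr (1 + \<psi> R)) powr s)"
      using le R by (simp add: Let_def)
    then have "sup_covering F R (R powr (1 + \<psi> R)) \<le> ereal (C' * exp (s * gauge_of \<psi> R))"
      unfolding inner_scale(3)[of R \<psi>, OF R(1,2) \<psi>[OF R(1,2)], of s] .
    then have "\<kappa> * exp (D * gauge_of \<psi> R) \<le> C' * exp (s * gauge_of \<psi> R)"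
      using lo by (metis ereal_less_eq(3) order_trans)
    then have "exp ((D - s) * gauge_of \<psi> R) \<le> C' / \<kappa>"
      using \<open>0 < \<kappa>\<close> by (simp add: left_diff_distrib exp_diff field_simps)
    then have "(D - s) * gauge_of \<psi> R \<le> ln (C' / \<kappa>)"
      using C' \<open>0 < \<kappa>\<close> by (simp add: ln_ge_iff)
    moreover have "(D - s) * M \<le> (D - s) * gauge_of \<psi> R" using R(3) sD by simp
    moreover have "(D - s) * M = ln (C' / \<kappa>) + 1" using sD by (simp add: M_def)
    ultimately show False by linarith
  qed
qed

lemma gen_assouad_spectrum_le_assouad_dim:
  assumes \<psi>: "\<And>x. 0 < x \<Longrightarrow> x < 1 \<Longrightarrow> 0 < \<psi> x"
  shows "gen_assouad_spectrum \<psi> F \<le> assouad_dim F"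
  unfolding gen_assouad_spectrum_def assouad_dim_def
proof (rule Inf_superset_mono, clarify)
  fix s C' assume "0 < (C'::real)"
    "\<forall>r R. 0 < r \<and> r \<le> R \<and> R < 1 \<longrightarrow> sup_covering F R r \<le> ereal (C' * (R / r) powr s)"
  then show "\<exists>sa. ereal s = ereal sa \<and> (\<exists>C'>0. \<forall>R. 0 < R \<and> R < 1 \<longrightarrow>
      (let r = R powr (1 + \<psi> R) in sup_covering F R r \<le> ereal (C' * (R / r) powr sa)))"
    using inner_scale(1,2) \<psi> by (intro exI[of _ s] conjI refl exI[of _ C']) (auto simp: Let_def)
qed

section \<open>Averages over windows of scales\<close>

lemma eventually_at_right_0_D:
  assumes "eventually P (at_right (0::real))"
  shows "\<exists>R0>0. R0 < 1 \<and> (\<forall>R. 0 < R \<longrightarrow> R < R0 \<longrightarrow> P R)"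
proof -
  obtain b where "0 < b" "\<And>y. 0 < y \<Longrightarrow> y < b \<Longrightarrow> P y"
    using assms unfolding eventually_at_right_field by blast
  then show ?thesis by (intro exI[of _ "min b (1/2)"]) auto
qed

lemma eventually_unit: "eventually (\<lambda>R. 0 < R \<and> R < (1::real)) (at_right 0)"
  unfolding eventually_at_right_field by (rule exI[of _ 1]) auto

lemma eventually_ln_large: "eventually (\<lambda>R. K \<le> ln (3 / R)) (at_right (0::real))"
  unfolding eventually_at_right_field
proof (intro exI[of _ "3 * exp (- K)"] conjI allI impI)
  fix R :: real assume "0 < R" "R < 3 * exp (- K)"
  then have "exp K \<le> 3 / R" by (simp add: exp_minus field_simps)
  then show "K \<le> ln (3 / R)" using \<open>0 < R\<close> by (simp add: ln_ge_iff)
qed auto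

lemma sum_window_shift: "(\<Sum>i\<in>{j..<j + L}. f i) = (\<Sum>i<L. f (j + i))" for f :: "nat \<Rightarrow> real"
  using sum.shift_bounds_nat_ivl[of f 0 j L] by (simp add: atLeast0LessThan add.commute)

context
  fixes g :: "nat \<Rightarrow> real" and G :: real and f :: "nat \<Rightarrow> real"
  assumes lower: "\<And>j. ln 2 \<le> g j" and upper: "\<And>j. g j \<le> G"
begin

lemmas lev = level_ge[of "ln 2" g G, OF ln2_pos lower upper]
  level_upper[of "ln 2" g G, OF ln2_pos lower upper]
  sum_ge_linear[of "ln 2" g G, OF ln2_pos lower upper]
  level_window[of "ln 2" g G, OF ln2_pos lower upper]
  level_mono[of "ln 2" g G, OF ln2_pos lower upper]

lemma G_pos: "0 < G" using lower[of 0] upper[of 0] ln2_pos by linarith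

lemma level_linear:
  assumes "0 \<le> t" shows "t \<le> G * level g t" "level g t \<le> 2 * (t + G)"
proof -
  have "(\<Sum>j<level g t. g j) \<le> G * level g t"
    using sum_bounded_above[of "{..<level g t}" g G] upper by (simp add: mult.commute)
  then show "t \<le> G * level g t" using lev(1)[of t] by linarith
  have "ln 2 * real (level g t) \<le> t + G" using lev(2)[OF assms] lev(3)[of "level g t"] by linarith
  moreover have "1 / 2 * real (level g t) \<le> ln 2 * real (level g t)" using ln2_gt_half by (intro mult_right_mono) auto
  ultimately have "1 / 2 * real (level g t) \<le> t + G" by (rule order_trans[rotated])
  then show "real (level g t) \<le> 2 * (t + G)" by simp
qed

lemma eventually_level_large: "eventually (\<lambda>R. J \<le> level g (ln (3 / R))) (at_right 0)"
  using eventually_ln_large[of "G * J"] eventually_ln_large[of 0]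
proof eventually_elim
  case (elim R)
  then have "G * J \<le> G * level g (ln (3 / R))" using level_linear(1)[of "ln (3 / R)"] by linarith
  then show ?case using G_pos by simp
qed

text \<open>Turns a statement about starting positions \<open>j\<close>, the form in which
  Borel--Cantelli gives it, into one about scales. A window starting at a large \<open>j\<close>
  belongs to a scale \<open>R \<le> exp (- j / 2)\<close>, so the monotonicity of \<open>T\<close>
  makes it long enough for \<open>W\<close>.\<close>

lemma window_average:
  assumes anti: "antimono_on {0<..<1} T" and top: "filterlim T at_top (at_right 0)"
    and W: "\<And>\<epsilon>. 0 < \<epsilon> \<Longrightarrow> \<exists>J. \<forall>j\<ge>J. \<forall>L. T (exp (- (real j / 2))) / (2 * G) \<le> real L \<longrightarrow>
      \<bar>\<Sum>i<L. f (j + i)\<bar> \<le> \<epsilon> * real L"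
    and "0 < \<epsilon>"
  shows "eventually (\<lambda>R. \<bar>\<Sum>i\<in>{level g (ln (3 / R))..<level g (ln (3 / R) + T R)}. f i\<bar> \<le> \<epsilon> * T R) (at_right 0)"
proof -
  \<comment> \<open>\<open>\<epsilon> / 4\<close>, because a window at scale \<open>R\<close> will
    have at most \<open>4 * T R\<close> letters.\<close>
  obtain J where J: "\<And>j L. J \<le> j \<Longrightarrow> T (exp (- (real j / 2))) / (2 * G) \<le> real L \<Longrightarrow>
      \<bar>\<Sum>i<L. f (j + i)\<bar> \<le> \<epsilon> / 4 * real L"
    using W[of "\<epsilon> / 4"] \<open>0 < \<epsilon>\<close> by auto
  \<comment> \<open>From here on the boundary errors \<open>G\<close> of \<open>level_window\<close>
    are at most half of \<open>T R\<close>.\<close>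
  have "eventually (\<lambda>R. 2 * G \<le> T R) (at_right 0)" using top by (simp add: filterlim_at_top)
  moreover note eventually_unit eventually_ln_large[of 0]
    eventually_level_large[of "max (J + 1) (nat \<lceil>12 * (G + ln 3)\<rceil>)"]
  ultimately show ?thesis
  proof eventually_elim
    case (elim R)
    define t where "t = ln (3 / R)"
    define j where "j = level g t"
    define L where "L = level g (t + T R) - j"
    have t: "0 \<le> t" using elim by (simp add: t_def)
    have T: "2 * G \<le> T R" "0 \<le> T R" using elim G_pos by auto
    \<comment> \<open>The bound \<open>12 * (G + ln 3)\<close> absorbs the additive constants of
      \<open>2 / 3 * j \<le> ln 3 + G - ln R\<close> in the deduction of
      \<open>j / 2 \<le> - ln R\<close>.\<close>
    have j: "J \<le> j" "1 \<le> j" "12 * (G + ln 3) \<le> real j"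
      using elim by (auto simp: j_def t_def nat_le_iff ceiling_le_iff)
    have "2 / 3 * real j \<le> ln 2 * real j" using ln2_ge_two_thirds by (intro mult_right_mono) auto
    also have "\<dots> \<le> t + G" using order_trans[OF lev(3)[of j]] lev(2)[OF t] unfolding j_def by blast
    finally have "2 / 3 * real j \<le> t + G" .
    moreover have "t = ln 3 - ln R" using elim by (simp add: t_def ln_div)
    moreover have "0 \<le> real j" by simp
    ultimately have "ln R \<le> - (real j / 2)" using j(3) by argo
    then have "R \<le> exp (- (real j / 2))" using elim ln_le_cancel_iff[of R "exp (- (real j / 2))"] by simp
    then have "T (exp (- (real j / 2))) \<le> T R"
      using anti elim j(2) by (auto simp: monotone_on_def)
    moreover have TL: "T R - G \<le> G * real L" and LT: "ln 2 * real L \<le> T R + G"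
      using lev(6,7)[of t "t + T R"] t T unfolding L_def j_def by auto
    ultimately have "T (exp (- (real j / 2))) \<le> 2 * G * real L" using T by linarith
    then have "T (exp (- (real j / 2))) / (2 * G) \<le> real L" using G_pos by (simp add: divide_le_eq mult_ac)
    then have "\<bar>\<Sum>i<L. f (j + i)\<bar> \<le> \<epsilon> / 4 * real L" using J j(1) by blast
    moreover have "1 / 2 * real L \<le> ln 2 * real L" using ln2_gt_half by (intro mult_right_mono) auto
    then have "real L \<le> 4 * T R" using LT T G_pos by linarith
    then have "\<epsilon> / 4 * real L \<le> \<epsilon> / 4 * (4 * T R)" using \<open>0 < \<epsilon>\<close> by (intro mult_left_mono) auto
    moreover have "j + L = level g (t + T R)" using lev(8)[of t "t + T R"] T unfolding L_def j_def by simp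
    ultimately show ?case using sum_window_shift[of f j L] unfolding t_def[symmetric] j_def[symmetric] by simp
  qed
qed

text \<open>When \<open>T\<close> is proportional to \<open>\<bar>ln R\<bar>\<close>, a window is as
  long as a fixed proportion of its position. Its sum is a difference of two initial sums, each of
  them small compared with the position and hence with \<open>T\<close>.\<close>

lemma window_average_of_lln:
  assumes lln: "(\<lambda>L. (\<Sum>i<L. f i) / L) \<longlonglongrightarrow> 0" and p: "0 < p" and "0 < \<epsilon>"
    and T: "\<And>R. 0 < R \<Longrightarrow> R < 1 \<Longrightarrow> T R = p * \<bar>ln R\<bar>"
  shows "eventually (\<lambda>R. \<bar>\<Sum>i\<in>{level g (ln (3 / R))..<level g (ln (3 / R) + T R)}. f i\<bar> \<le> \<epsilon> * T R) (at_right 0)"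
proof -
  \<comment> \<open>The two initial sums together are at most
    \<open>4 * \<delta> * (1 + 2 / p) * T R\<close>, which becomes
    \<open>\<epsilon> / 2 * T R\<close>.\<close>
  define \<delta> where "\<delta> = \<epsilon> / (8 * (1 + 2 / p))"
  have \<delta>: "0 < \<delta>" using p \<open>0 < \<epsilon>\<close> by (simp add: \<delta>_def add_pos_pos)
  have "eventually (\<lambda>L. \<bar>(\<Sum>i<L. f i) / L\<bar> < \<delta>) sequentially"
    using lln \<delta> by (simp add: tendsto_iff dist_real_def)
  then obtain J where J: "\<And>L. J \<le> L \<Longrightarrow> \<bar>(\<Sum>i<L. f i) / L\<bar> < \<delta>" by (auto simp: eventually_sequentially)
  have S: "\<bar>\<Sum>i<L. f i\<bar> \<le> \<delta> * L" if "J + 1 \<le> L" for L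
    using J[of L] that by (simp add: field_simps)
  show ?thesis
    using eventually_unit eventually_ln_large[of "2 * (ln 3 + G)"] eventually_ln_large[of 0] eventually_level_large[of "J + 1"]
  proof eventually_elim
    case (elim R)
    define t where "t = ln (3 / R)"
    define u where "u = \<bar>ln R\<bar>"
    have u: "t = ln 3 + u" "0 < u" using elim by (simp_all add: t_def u_def ln_div)
    have TR: "T R = p * u" using T elim by (simp add: u_def)
    have t: "0 \<le> t" "0 \<le> t + T R" using u p TR by auto
    have le: "level g t \<le> level g (t + T R)" using lev(8) p u TR by simp
    have "0 < ln (3::real)" by simp
    then have tG: "t + G \<le> 2 * u" using elim(2) u G_pos unfolding t_def[symmetric] by argo
    have "\<bar>\<Sum>i\<in>{level g t..<level g (t + T R)}. f i\<bar> = \<bar>(\<Sum>i<level g (t + T R). f i) - (\<Sum>i<level g t. f i)\<bar>"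
      using sum_diff_nat_ivl[of 0 "level g t" "level g (t + T R)" f] le by (simp add: atLeast0LessThan)
    also have "\<dots> \<le> \<delta> * level g (t + T R) + \<delta> * level g t"
      using S[of "level g t"] S[of "level g (t + T R)"] elim le unfolding t_def by linarith
    also have "\<dots> \<le> \<delta> * level g (t + T R) + \<delta> * level g (t + T R)"
      using le \<delta> by (intro add_left_mono mult_left_mono) auto
    also have "\<dots> = 2 * \<delta> * level g (t + T R)" by simp
    also have "\<dots> \<le> 2 * \<delta> * (2 * (t + T R + G))"
      using level_linear(2)[OF t(2)] \<delta> by (intro mult_left_mono) auto
    also have "\<dots> \<le> 2 * \<delta> * (2 * (2 * u + p * u))"
      using tG \<delta> TR by (intro mult_left_mono) auto
    also have "\<dots> = 4 * \<delta> * (1 + 2 / p) * T R" using p TR by (simp add: field_simps)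
    also have "\<dots> = \<epsilon> / 2 * T R"
    proof -
      have z: "4 * (\<epsilon> / (8 * z)) * z = \<epsilon> / 2" if "z \<noteq> 0" for z using that by simp
      have "1 + 2 / p \<noteq> 0" using p by (simp add: add_pos_pos less_imp_neq[symmetric])
      from z[OF this] show ?thesis unfolding \<delta>_def by (rule arg_cong)
    qed
    also have "\<dots> \<le> \<epsilon> * T R" using \<open>0 < \<epsilon>\<close> p u TR by simp
    finally show ?case unfolding t_def .
  qed
qed

end

text \<open>With \<open>u = \<bar>ln R\<bar>\<close> and \<open>T = gauge_of \<psi> R\<close> the
  two levels are about \<open>(u + T) / \<nu>\<close> and \<open>u / \<mu>\<close>, and the bound on
  \<open>\<psi>\<close> gives \<open>(u + T) / \<nu> \<le> u / \<mu>\<close>. The averages leave an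
  error \<open>o(u)\<close>, which may be large compared with \<open>T\<close> if
  \<open>\<psi>\<close> is small; hence two cases. For \<open>T \<ge> \<rho> * u\<close> the error
  is \<open>o(T)\<close>; for smaller \<open>T\<close> the first level stays below the second by a
  margin linear in \<open>u\<close>.\<close>

lemma level_overlap:
  fixes g h :: "nat \<Rightarrow> real" and T \<psi> :: "real \<Rightarrow> real"
  assumes g: "\<And>j. ln 2 \<le> g j" "\<And>j. g j \<le> G" and h: "\<And>j. ln 2 \<le> h j" "\<And>j. h j \<le> G"
    and lg: "(\<lambda>L. (\<Sum>i<L. g i) / L) \<longlonglongrightarrow> \<nu>" and lh: "(\<lambda>L. (\<Sum>i<L. h i) / L) \<longlonglongrightarrow> \<mu>"
    and \<mu>\<nu>: "0 < \<mu>" "\<mu> < \<nu>"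
    and \<psi>: "eventually (\<lambda>R. \<psi> R \<le> \<nu> / \<mu> - 1) (at_right 0)"
    and \<psi>0: "\<And>x. 0 < x \<Longrightarrow> x < 1 \<Longrightarrow> 0 < \<psi> x" and "0 < \<epsilon>"
  shows "eventually (\<lambda>R. real (level g (ln (3 / R) + gauge_of \<psi> R)) - real (level h (ln (3 / R)))
    \<le> \<epsilon> * gauge_of \<psi> R) (at_right 0)"
proof -
  \<comment> \<open>Half of the largest allowed \<open>\<psi>\<close>, so that
    \<open>(1 + \<rho>) / \<nu> < 1 / \<mu>\<close> strictly; \<open>c\<close> is half of that
    gap.\<close>
  define \<rho> where "\<rho> = (\<nu> / \<mu> - 1) / 2"
  have \<rho>: "0 < \<rho>" using \<mu>\<nu> by (simp add: \<rho>_def)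
  have \<nu>: "0 < \<nu>" using \<mu>\<nu> by linarith
  have "((\<lambda>\<delta>. \<nu> / \<mu> / (\<nu> - \<delta>) - 1 / (\<mu> + \<delta>)) \<longlongrightarrow> \<nu> / \<mu> / (\<nu> - 0) - 1 / (\<mu> + 0)) (at_right 0)"
    using \<mu>\<nu> \<nu> by (intro tendsto_intros) auto
  moreover have "\<nu> / \<mu> / (\<nu> - 0) - 1 / (\<mu> + 0) < \<epsilon> * \<rho> / 2" using \<rho> \<nu> \<open>0 < \<epsilon>\<close> by simp
  ultimately have e1: "eventually (\<lambda>\<delta>. \<nu> / \<mu> / (\<nu> - \<delta>) - 1 / (\<mu> + \<delta>) < \<epsilon> * \<rho> / 2) (at_right 0)"
    by (rule order_tendstoD(2))
  define c where "c = - ((1 + \<rho>) / \<nu> - 1 / \<mu>) / 2"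
  have c: "0 < c" using \<mu>\<nu> \<nu> by (simp add: c_def \<rho>_def field_simps)
  have "((\<lambda>\<delta>. (1 + \<rho>) / (\<nu> - \<delta>) - 1 / (\<mu> + \<delta>)) \<longlongrightarrow> (1 + \<rho>) / (\<nu> - 0) - 1 / (\<mu> + 0)) (at_right 0)"
    using \<mu>\<nu> \<nu> by (intro tendsto_intros) auto
  moreover have "(1 + \<rho>) / (\<nu> - 0) - 1 / (\<mu> + 0) < - c"
  proof -
    have "(1 + \<rho>) / \<nu> - 1 / \<mu> < - c" using c unfolding c_def by argo
    then show ?thesis by simp
  qed
  ultimately have e2: "eventually (\<lambda>\<delta>. (1 + \<rho>) / (\<nu> - \<delta>) - 1 / (\<mu> + \<delta>) < - c) (at_right 0)"
    by (rule order_tendstoD(2))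
  have "eventually (\<lambda>\<delta>. 0 < \<delta> \<and> \<delta> < \<nu>) (at_right 0)"
    unfolding eventually_at_right_field using \<nu> by (intro exI[of _ \<nu>]) auto
  with e1 e2 have "eventually (\<lambda>\<delta>. \<nu> / \<mu> / (\<nu> - \<delta>) - 1 / (\<mu> + \<delta>) < \<epsilon> * \<rho> / 2 \<and>
      (1 + \<rho>) / (\<nu> - \<delta>) - 1 / (\<mu> + \<delta>) < - c \<and> 0 < \<delta> \<and> \<delta> < \<nu>) (at_right 0)"
    by eventually_elim auto
  from eventually_happens[OF this] obtain \<delta> where
    d: "\<nu> / \<mu> / (\<nu> - \<delta>) - 1 / (\<mu> + \<delta>) < \<epsilon> * \<rho> / 2" "(1 + \<rho>) / (\<nu> - \<delta>) - 1 / (\<mu> + \<delta>) < - c"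
      "0 < \<delta>" "\<delta> < \<nu>" by (auto simp: trivial_limit_at_right_real)
  have "eventually (\<lambda>L. \<bar>(\<Sum>i<L. g i) / L - \<nu>\<bar> < \<delta> \<and> \<bar>(\<Sum>i<L. h i) / L - \<mu>\<bar> < \<delta>) sequentially"
    using lg lh d(3) by (auto simp: tendsto_iff dist_real_def intro: eventually_conj)
  then obtain J where J: "\<And>L. J \<le> L \<Longrightarrow> \<bar>(\<Sum>i<L. g i) / L - \<nu>\<bar> < \<delta> \<and> \<bar>(\<Sum>i<L. h i) / L - \<mu>\<bar> < \<delta>"
    by (auto simp: eventually_sequentially)
  have Sg: "(\<nu> - \<delta>) * L \<le> (\<Sum>i<L. g i)" and Sh: "(\<Sum>i<L. h i) \<le> (\<mu> + \<delta>) * L" if "J + 1 \<le> L" for L :: nat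
  proof -
    have "\<nu> - \<delta> < (\<Sum>i<L. g i) / L" "(\<Sum>i<L. h i) / L < \<mu> + \<delta>" using J[of L] that by auto
    then show "(\<nu> - \<delta>) * L \<le> (\<Sum>i<L. g i)" "(\<Sum>i<L. h i) \<le> (\<mu> + \<delta>) * L"
      using that by (simp_all add: field_simps)
  qed
  \<comment> \<open>Collects the additive constants; for small \<open>R\<close> it is at most
    \<open>c * u\<close> and at most \<open>\<epsilon> * \<rho> / 2 * u\<close>.\<close>
  define K where "K = (ln 3 + G) / (\<nu> - \<delta>)"
  have G: "0 < G" using G_pos[of g G] g by blast
  have K: "0 < K" using G d by (simp add: K_def add_pos_pos)
  show ?thesis
    using eventually_unit \<psi> eventually_ln_large[of "ln 3 + K / c + K / (\<epsilon> * \<rho> / 2)"]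
      eventually_level_large[of g G "J + 1", OF g] eventually_level_large[of h G "J + 1", OF h]
  proof eventually_elim
    case (elim R)
    define t where "t = ln (3 / R)"
    define u where "u = \<bar>ln R\<bar>"
    define T where "T = gauge_of \<psi> R"
    define p where "p = level g (t + T)"
    define q where "q = level h t"
    have u: "t = ln 3 + u" "0 < u" using elim by (simp_all add: t_def u_def ln_div)
    have T: "T = \<psi> R * u" by (simp add: T_def gauge_of_def u_def)
    have T0: "0 < T" using T u \<psi>0 elim by simp
    have t: "0 \<le> t" "0 \<le> t + T" using u T0 by auto
    have uK: "K / c + K / (\<epsilon> * \<rho> / 2) \<le> u" using elim(3) u unfolding t_def[symmetric] by linarith
    have "0 < K / c" "0 < K / (\<epsilon> * \<rho> / 2)" using K c \<rho> \<open>0 < \<epsilon>\<close> by simp_all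
    then have "K / c \<le> u" "K / (\<epsilon> * \<rho> / 2) \<le> u" using uK by linarith+
    then have uK: "K \<le> c * u" "K \<le> \<epsilon> * \<rho> / 2 * u" using c \<rho> \<open>0 < \<epsilon>\<close> by (simp_all add: field_simps)
    have "level g t \<le> p" unfolding p_def using level_mono[of "ln 2" g G t "t + T", OF ln2_pos g] T0 by simp
    then have pJ: "J + 1 \<le> p" "J + 1 \<le> q" using elim unfolding t_def q_def by auto
    have "(\<nu> - \<delta>) * p \<le> t + T + G"
      using Sg[OF pJ(1)] level_upper[of "ln 2" g G "t + T", OF ln2_pos g t(2)] unfolding p_def by linarith
    then have "p \<le> (t + T + G) / (\<nu> - \<delta>)" using d by (simp add: field_simps)
    then have p: "p \<le> (u + T) / (\<nu> - \<delta>) + K" unfolding K_def u add_divide_distrib[symmetric] by (simp add: algebra_simps)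
    have "t \<le> (\<mu> + \<delta>) * q"
      using Sh[OF pJ(2)] level_ge[of "ln 2" h G t, OF ln2_pos h] unfolding q_def by linarith
    then have "t / (\<mu> + \<delta>) \<le> q" using d \<mu>\<nu> by (simp add: field_simps)
    moreover have "u / (\<mu> + \<delta>) \<le> t / (\<mu> + \<delta>)" using u d \<mu>\<nu> by (intro divide_right_mono) auto
    ultimately have q: "u / (\<mu> + \<delta>) \<le> q" by linarith
    have "real p - real q \<le> \<epsilon> * T"
    proof (cases "\<rho> * u \<le> T")
      case True
      have "T \<le> (\<nu> / \<mu> - 1) * u" unfolding T using elim u by (intro mult_right_mono) auto
      then have "u + T \<le> \<nu> / \<mu> * u" by (simp add: algebra_simps)
      then have "(u + T) / (\<nu> - \<delta>) \<le> \<nu> / \<mu> * u / (\<nu> - \<delta>)" using d by (intro divide_right_mono) auto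
      then have "real p - real q \<le> (\<nu> / \<mu> / (\<nu> - \<delta>) - 1 / (\<mu> + \<delta>)) * u + K"
        using p q by (simp add: algebra_simps)
      also have "\<dots> \<le> \<epsilon> * \<rho> / 2 * u + \<epsilon> * \<rho> / 2 * u"
        using d u uK by (intro add_mono mult_right_mono) auto
      also have "\<dots> = \<epsilon> * (\<rho> * u)" by simp
      also have "\<dots> \<le> \<epsilon> * T" using True \<open>0 < \<epsilon>\<close> by (intro mult_left_mono) auto
      finally show ?thesis .
    next
      case False
      then have "(u + T) / (\<nu> - \<delta>) \<le> ((1 + \<rho>) * u) / (\<nu> - \<delta>)"
        using d by (intro divide_right_mono) (auto simp: algebra_simps)
      then have "real p - real q \<le> ((1 + \<rho>) / (\<nu> - \<delta>) - 1 / (\<mu> + \<delta>)) * u + K"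
        using p q by (simp add: algebra_simps)
      also have "\<dots> \<le> - c * u + c * u"
        using d u uK by (intro add_mono mult_right_mono) auto
      finally show ?thesis using mult_pos_pos[OF \<open>0 < \<epsilon>\<close> T0] by linarith
    qed
    then show ?case by (simp add: p_def q_def t_def T_def)
  qed
qed

section \<open>Extremal letters and deterministic bounds on dimensions\<close>

context random_bm_carpet
begin

definition rows_ratio :: real where
  "rows_ratio = Max ((\<lambda>l. ln (real (maxrows l)) / ln (real (n l))) ` \<Lambda>)"

definition cols_ratio :: real where
  "cols_ratio = Max ((\<lambda>l. ln (real (ncols l)) / ln (real (m l))) ` \<Lambda>)"

lemma ratio_attained:
  "\<exists>l\<in>\<Lambda>. ln (real (maxrows l)) = rows_ratio * ln (real (n l))"
  "\<exists>l\<in>\<Lambda>. ln (real (ncols l)) = cols_ratio * ln (real (m l))"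
proof -
  have "rows_ratio \<in> (\<lambda>l. ln (real (maxrows l)) / ln (real (n l))) ` \<Lambda>"
    unfolding rows_ratio_def using finite_index index_nonempty by (intro Max_in) auto
  then obtain l where l: "l \<in> \<Lambda>" "rows_ratio = ln (real (maxrows l)) / ln (real (n l))" by blast
  have "ln (real (n l)) \<noteq> 0" using ln_m_ge[OF l(1)] ln_m_less_ln_n[OF l(1)] ln2_pos by linarith
  then show "\<exists>l\<in>\<Lambda>. ln (real (maxrows l)) = rows_ratio * ln (real (n l))" using l by (intro bexI[of _ l]) auto
  have "cols_ratio \<in> (\<lambda>l. ln (real (ncols l)) / ln (real (m l))) ` \<Lambda>"
    unfolding cols_ratio_def using finite_index index_nonempty by (intro Max_in) auto
  then obtain l where l: "l \<in> \<Lambda>" "cols_ratio = ln (real (ncols l)) / ln (real (m l))" by blast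
  have "ln (real (m l)) \<noteq> 0" using ln_m_ge[OF l(1)] ln2_pos by linarith
  then show "\<exists>l\<in>\<Lambda>. ln (real (ncols l)) = cols_ratio * ln (real (m l))" using l by (intro bexI[of _ l]) auto
qed

end

context carpet_realisation
begin

lemma lnC_nonneg: "0 \<le> lnC j" and lnB_nonneg: "0 \<le> lnB j"
  using maxrows_pos[OF letters[of j]] ncols_pos[OF letters[of j]] by simp_all

lemma lnC_le: "lnC j \<le> rows_ratio * lnn j"
proof -
  have "lnC j / lnn j \<le> rows_ratio" unfolding rows_ratio_def
    using finite_index letters by (intro Max_ge) auto
  moreover have "0 < lnn j" using lnn_bounds[of j] ln2_pos by linarith
  ultimately show ?thesis by (simp add: divide_le_eq)
qed

lemma lnB_le: "lnB j \<le> cols_ratio * lnm j"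
proof -
  have "lnB j / lnm j \<le> cols_ratio" unfolding cols_ratio_def
    using finite_index letters by (intro Max_ge) auto
  moreover have "0 < lnm j" using lnm_bounds[of j] ln2_pos by linarith
  ultimately show ?thesis by (simp add: divide_le_eq)
qed

lemma ratio_nonneg: "0 \<le> rows_ratio" "0 \<le> cols_ratio"
proof -
  have "0 < lnn 0" "0 < lnm 0" using lnn_bounds[of 0] lnm_bounds[of 0] ln2_pos by linarith+
  then show "0 \<le> rows_ratio" "0 \<le> cols_ratio"
    using order_trans[OF lnC_nonneg[of 0] lnC_le] order_trans[OF lnB_nonneg[of 0] lnB_le]
    by (simp_all add: zero_le_mult_iff)
qed

lemma rows_sum_le:
  assumes "0 \<le> s" "s \<le> t" shows "rows_sum s t \<le> rows_ratio * (t - s + log_max)"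
proof -
  have "rows_sum s t \<le> rows_ratio * (\<Sum>j\<in>{ylevel s..<ylevel t}. lnn j)"
    unfolding rows_sum_def sum_distrib_left by (intro sum_mono lnC_le)
  also have "\<dots> \<le> rows_ratio * (t - s + log_max)"
    using ylevel_window(1)[OF assms] ratio_nonneg by (intro mult_left_mono) auto
  finally show ?thesis .
qed

lemma cols_sum_le:
  assumes "0 \<le> s" "s \<le> t" shows "cols_sum s t \<le> cols_ratio * (t - s + log_max)"
proof -
  have "cols_sum s t \<le> cols_ratio * (\<Sum>j\<in>{xlevel s..<xlevel t}. lnm j)"
    unfolding cols_sum_def sum_distrib_left by (intro sum_mono lnB_le)
  also have "\<dots> \<le> cols_ratio * (t - s + log_max)"
    using xlevel_window(1)[OF assms] ratio_nonneg by (intro mult_left_mono) auto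
  finally show ?thesis .
qed

text \<open>Holds for every sequence of letters in \<open>\<Lambda>\<close>. Equality is obtained
  almost surely in \<open>spectrum_eq_assouad\<close>, where long runs give the matching lower
  bound.\<close>

lemma assouad_dim_le: "assouad_dim (carpet m n N a b \<omega>) \<le> ereal (rows_ratio + cols_ratio)"
proof -
  have "sup_covering (carpet m n N a b \<omega>) R r
      \<le> ereal (near_bound * exp ((rows_ratio + cols_ratio) * log_max) * (R / r) powr (rows_ratio + cols_ratio))"
    if r: "0 < r" "r \<le> R" "R < 1" for r R
  proof -
  have t: "0 \<le> ln (3 / R)" "ln (3 / R) \<le> ln (3 / r)" "ln (3 / r) - ln (3 / R) = ln (R / r)"
    using r by (auto intro!: ln_ge_zero simp: frac_le ln_div)
  have "rows_sum (ln (3 / R)) (ln (3 / r)) + cols_sum (ln (3 / R)) (ln (3 / r))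
      \<le> (rows_ratio + cols_ratio) * (ln (R / r) + log_max)"
    using rows_sum_le[OF t(1,2)] cols_sum_le[OF t(1,2)] unfolding t(3) by (simp add: algebra_simps)
  then have "near_bound * exp (rows_sum (ln (3 / R)) (ln (3 / r)) + cols_sum (ln (3 / R)) (ln (3 / r)))
      \<le> near_bound * exp ((rows_ratio + cols_ratio) * (ln (R / r) + log_max))"
    using near_bound_pos by simp
  also have "\<dots> = near_bound * exp ((rows_ratio + cols_ratio) * log_max) * (R / r) powr (rows_ratio + cols_ratio)"
    using r by (simp add: powr_def exp_add[symmetric] algebra_simps)
  finally show ?thesis
    using order_trans[OF covering_upper[of r R]] r by simp
  qed
  then show ?thesis unfolding assouad_dim_def
    by (intro Inf_lower)
      (use near_bound_pos in \<open>auto intro!: exI[of _ "near_bound * exp ((rows_ratio + cols_ratio) * log_max)"]\<close>)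
qed

text \<open>A window of scales has no prescribed number of letters, but its sum of
  \<open>lnn\<close> is \<open>T\<close> up to \<open>log_max\<close>. Therefore \<open>lnC\<close>
  is centred by \<open>c1 * lnn\<close> and not by its mean, and the row window contributes
  \<open>c1 * T\<close> up to the error in \<open>hX\<close>; likewise for columns with
  \<open>c2 * lnm\<close>.\<close>

lemma spectrum_eq:
  assumes \<psi>: "\<And>x. 0 < x \<Longrightarrow> x < 1 \<Longrightarrow> 0 < \<psi> x"
    and anti: "antimono_on {0<..<1} (gauge_of \<psi>)" and top: "filterlim (gauge_of \<psi>) at_top (at_right 0)"
    and c: "0 \<le> c1" "0 \<le> c2"
    and hX: "\<And>\<epsilon>. 0 < \<epsilon> \<Longrightarrow> eventually (\<lambda>R. \<bar>\<Sum>i\<in>{ylevel (ln (3 / R))..<ylevel (ln (3 / R) + gauge_of \<psi> R)}.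
        lnC i - c1 * lnn i\<bar> \<le> \<epsilon> * gauge_of \<psi> R) (at_right 0)"
    and hY: "\<And>\<epsilon>. 0 < \<epsilon> \<Longrightarrow> eventually (\<lambda>R. \<bar>\<Sum>i\<in>{xlevel (ln (3 / R))..<xlevel (ln (3 / R) + gauge_of \<psi> R)}.
        lnB i - c2 * lnm i\<bar> \<le> \<epsilon> * gauge_of \<psi> R) (at_right 0)"
    and hO: "\<And>\<epsilon>. 0 < \<epsilon> \<Longrightarrow> eventually (\<lambda>R. real (ylevel (ln (3 / R) + gauge_of \<psi> R)) - real (xlevel (ln (3 / R)))
        \<le> \<epsilon> * gauge_of \<psi> R) (at_right 0)"
  shows "gen_assouad_spectrum \<psi> (carpet m n N a b \<omega>) = ereal (c1 + c2)"
proof (rule antisym)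
  let ?T = "gauge_of \<psi>" and ?F = "carpet m n N a b \<omega>"
  have rows: "rows_sum (ln (3 / R)) (ln (3 / R) + ?T R) =
      (\<Sum>i\<in>{ylevel (ln (3 / R))..<ylevel (ln (3 / R) + ?T R)}. lnC i - c1 * lnn i) +
      c1 * (\<Sum>i\<in>{ylevel (ln (3 / R))..<ylevel (ln (3 / R) + ?T R)}. lnn i)" for R
    by (simp add: rows_sum_def sum_subtractf sum_distrib_left)
  have cols: "cols_sum (ln (3 / R)) (ln (3 / R) + ?T R) =
      (\<Sum>i\<in>{xlevel (ln (3 / R))..<xlevel (ln (3 / R) + ?T R)}. lnB i - c2 * lnm i) +
      c2 * (\<Sum>i\<in>{xlevel (ln (3 / R))..<xlevel (ln (3 / R) + ?T R)}. lnm i)" for R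
    by (simp add: cols_sum_def sum_subtractf sum_distrib_left)
  have unit: "0 \<le> ln (3 / R)" "0 < ?T R" if "0 < R" "R < 1" for R
    using that inner_scale(6)[of R \<psi>, OF that \<psi>[OF that]] by (auto intro!: ln_ge_zero)
  have win: "c1 * (\<Sum>i\<in>{ylevel (ln (3 / R))..<ylevel (ln (3 / R) + ?T R)}. lnn i) \<le> c1 * (?T R + log_max)"
    "c2 * (\<Sum>i\<in>{xlevel (ln (3 / R))..<xlevel (ln (3 / R) + ?T R)}. lnm i) \<le> c2 * (?T R + log_max)"
    "c1 * (?T R - log_max) \<le> c1 * (\<Sum>i\<in>{ylevel (ln (3 / R))..<ylevel (ln (3 / R) + ?T R)}. lnn i)"
    "c2 * (?T R - log_max) \<le> c2 * (\<Sum>i\<in>{xlevel (ln (3 / R))..<xlevel (ln (3 / R) + ?T R)}. lnm i)"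
    if "0 < R" "R < 1" for R
    using ylevel_window(1,2)[of "ln (3 / R)" "ln (3 / R) + ?T R"]
      xlevel_window(1,2)[of "ln (3 / R)" "ln (3 / R) + ?T R"] unit[OF that] c
    by (auto intro!: mult_left_mono)
  show "gen_assouad_spectrum \<psi> ?F \<le> ereal (c1 + c2)"
  proof (rule ereal_le_epsilon2)
    fix e :: real assume "0 < e"
    have "eventually (\<lambda>R. rows_sum (ln (3 / R)) (ln (3 / R) + ?T R) + cols_sum (ln (3 / R)) (ln (3 / R) + ?T R)
        \<le> (c1 + c2 + e) * ?T R + (c1 + c2) * log_max) (at_right 0)"
      using hX[of "e / 2", OF half_gt_zero[OF \<open>0 < e\<close>]] hY[of "e / 2", OF half_gt_zero[OF \<open>0 < e\<close>]] eventually_unit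
    proof eventually_elim
      case (elim R)
      then show ?case using win(1,2)[of R] unfolding rows cols by (simp add: algebra_simps abs_le_iff)
    qed
    then obtain R0 where R0: "0 < R0" "R0 < 1" "\<And>R. 0 < R \<Longrightarrow> R < R0 \<Longrightarrow>
        rows_sum (ln (3 / R)) (ln (3 / R) + ?T R) + cols_sum (ln (3 / R)) (ln (3 / R) + ?T R)
        \<le> (c1 + c2 + e) * ?T R + (c1 + c2) * log_max" using eventually_at_right_0_D by blast
    \<comment> \<open>The second summand takes care of \<open>R \<ge> R0\<close>: there the gauge is
      at most its value at \<open>R0\<close>, so the a priori bounds on both sums are
      constants.\<close>
    define K where "K = (c1 + c2) * log_max + (rows_ratio + cols_ratio) * (?T R0 + log_max)"
    have "gen_assouad_spectrum \<psi> ?F \<le> ereal (c1 + c2 + e)"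
    proof (rule gen_assouad_spectrum_le[where C' = "near_bound * exp K"])
      fix R :: real assume R: "0 < R" "R < 1"
      note sc = inner_scale[of R \<psi>, OF R \<psi>[OF R]]
      have K: "(c1 + c2) * log_max \<le> K" "(rows_ratio + cols_ratio) * (?T R0 + log_max) \<le> K"
        using c ratio_nonneg log_max_pos unit(2)[OF R0(1,2)] by (auto simp: K_def)
      have "rows_sum (ln (3 / R)) (ln (3 / R) + ?T R) + cols_sum (ln (3 / R)) (ln (3 / R) + ?T R)
          \<le> (c1 + c2 + e) * ?T R + K"
      proof (cases "R < R0")
        case True
        then show ?thesis using R0(3)[OF R(1)] K by linarith
      next
        case False
        then have "?T R \<le> ?T R0" using anti R R0 by (auto simp: monotone_on_def)
        then have "(rows_ratio + cols_ratio) * (?T R + log_max) \<le> (rows_ratio + cols_ratio) * (?T R0 + log_max)"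
          using ratio_nonneg by (intro mult_left_mono) auto
        moreover have "rows_sum (ln (3 / R)) (ln (3 / R) + ?T R) \<le> rows_ratio * (?T R + log_max)"
          "cols_sum (ln (3 / R)) (ln (3 / R) + ?T R) \<le> cols_ratio * (?T R + log_max)"
          using rows_sum_le[of "ln (3 / R)" "ln (3 / R) + ?T R"] cols_sum_le[of "ln (3 / R)" "ln (3 / R) + ?T R"]
            unit[OF R] by auto
        moreover have "0 \<le> (c1 + c2 + e) * ?T R" using c \<open>0 < e\<close> unit[OF R] by simp
        ultimately show ?thesis using K by (simp add: algebra_simps)
      qed
      then have "near_bound * exp (rows_sum (ln (3 / R)) (ln (3 / R) + ?T R) + cols_sum (ln (3 / R)) (ln (3 / R) + ?T R))
          \<le> near_bound * exp ((c1 + c2 + e) * ?T R + K)" using near_bound_pos by simp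
      also have "\<dots> = near_bound * exp K * exp ((c1 + c2 + e) * ?T R)" by (simp add: exp_add)
      finally have "ereal (near_bound * exp (rows_sum (ln (3 / R)) (ln (3 / R) + ?T R) + cols_sum (ln (3 / R)) (ln (3 / R) + ?T R)))
          \<le> ereal (near_bound * exp K * exp ((c1 + c2 + e) * ?T R))" by simp
      with covering_upper[OF sc(1,2)] R show "sup_covering ?F R (R powr (1 + \<psi> R))
          \<le> ereal (near_bound * exp K * exp ((c1 + c2 + e) * ?T R))"
        unfolding sc(4) using order_trans less_imp_le by blast
    qed (use \<psi> near_bound_pos in auto)
    then show "gen_assouad_spectrum \<psi> ?F \<le> ereal (c1 + c2) + ereal e" by simp
  qed
  show "ereal (c1 + c2) \<le> gen_assouad_spectrum \<psi> ?F"
  proof (rule dense_le)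
    fix y assume y: "y < ereal (c1 + c2)"
    define CC where "CC = rows_ratio * log_max"
    have CC: "0 \<le> CC" using ratio_nonneg log_max_pos by (simp add: CC_def)
    have lnC_CC: "lnC j \<le> CC" for j
      using lnC_le[of j] mult_left_mono[OF lnn_bounds(2)[of j] ratio_nonneg(1)] unfolding CC_def by linarith
    obtain y' where y': "y < ereal y'" "y' < c1 + c2"
      using ereal_dense2[OF y] by auto
    \<comment> \<open>The rows and the columns each lose \<open>e * T\<close>, and the letters
      discarded with the overlap at most \<open>CC * e * T\<close>.\<close>
    define e where "e = (c1 + c2 - y') / (2 + CC)"
    have e: "0 < e" "c1 + c2 - (2 + CC) * e = y'" using y' CC by (auto simp: e_def)
    have ev: "eventually (\<lambda>R. y' * ?T R - (c1 + c2) * log_max \<le>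
        (\<Sum>j\<in>{ylevel (ln (3 / R))..<min (ylevel (ln (3 / R) + ?T R)) (xlevel (ln (3 / R)))}. lnC j)
        + cols_sum (ln (3 / R)) (ln (3 / R) + ?T R)) (at_right 0)"
      using hX[OF e(1)] hY[OF e(1)] hO[OF e(1)] eventually_unit
    proof eventually_elim
      case (elim R)
      define l where "l = ylevel (ln (3 / R))"
      define l' where "l' = ylevel (ln (3 / R) + ?T R)"
      define k where "k = xlevel (ln (3 / R))"
      have "l \<le> k" unfolding l_def k_def by (rule ylevel_le_xlevel)
      moreover have "l \<le> l'" unfolding l_def l'_def using unit[of R] elim by (intro ylevel_mono) auto
      ultimately have split: "(\<Sum>j\<in>{l..<l'}. lnC j) = (\<Sum>j\<in>{l..<min l' k}. lnC j) + (\<Sum>j\<in>{min l' k..<l'}. lnC j)"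
        by (simp add: sum.atLeastLessThan_concat)
      have "(\<Sum>j\<in>{min l' k..<l'}. lnC j) \<le> real (l' - min l' k) * CC"
        using sum_bounded_above[of "{min l' k..<l'}" lnC CC] lnC_CC by simp
      also have "\<dots> \<le> e * ?T R * CC"
      proof (rule mult_right_mono[OF _ CC])
        have "0 \<le> e * ?T R" using e unit[of R] elim by simp
        then show "real (l' - min l' k) \<le> e * ?T R" using elim(3) unfolding l'_def k_def by linarith
      qed
      finally have loss: "(\<Sum>j\<in>{min l' k..<l'}. lnC j) \<le> e * ?T R * CC" .
      have "(\<Sum>j\<in>{l..<l'}. lnC j) = rows_sum (ln (3 / R)) (ln (3 / R) + ?T R)"
        by (simp add: rows_sum_def l_def l'_def)
      then have "(\<Sum>j\<in>{l..<min l' k}. lnC j) + cols_sum (ln (3 / R)) (ln (3 / R) + ?T R)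
          \<ge> (c1 + c2 - (2 + CC) * e) * ?T R - (c1 + c2) * log_max"
        using win(3,4)[of R] elim loss unfolding split rows cols by (simp add: algebra_simps abs_le_iff)
      then show ?case unfolding e(2) by (simp add: l_def l'_def k_def)
    qed
    have "ereal y' \<le> gen_assouad_spectrum \<psi> ?F"
    proof (rule gen_assouad_spectrum_ge[where \<kappa> = "exp (- ((c1 + c2) * log_max)) / near_bound"])
      fix M
      have "eventually (\<lambda>R. M \<le> ?T R) (at_right 0)" using top by (simp add: filterlim_at_top)
      with ev eventually_unit have "eventually (\<lambda>R. 0 < R \<and> R < 1 \<and> M \<le> ?T R \<and>
        ereal (exp (- ((c1 + c2) * log_max)) / near_bound * exp (y' * ?T R)) \<le> sup_covering ?F R (R powr (1 + \<psi> R))) (at_right 0)"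
      proof eventually_elim
        case (elim R)
        then have R: "0 < R" "R < 1" by auto
        note sc = inner_scale[of R \<psi>, OF R \<psi>[OF R]]
        have "exp (- ((c1 + c2) * log_max)) / near_bound * exp (y' * ?T R) = exp (y' * ?T R - (c1 + c2) * log_max) / near_bound"
          by (simp add: exp_diff exp_minus divide_inverse mult_ac)
        also have "\<dots> \<le> exp ((\<Sum>j\<in>{ylevel (ln (3 / R))..<min (ylevel (ln (3 / R) + ?T R)) (xlevel (ln (3 / R)))}. lnC j)
            + cols_sum (ln (3 / R)) (ln (3 / R) + ?T R)) / near_bound"
          using elim(1) near_bound_pos by (intro divide_right_mono) auto
        finally have "ereal (exp (- ((c1 + c2) * log_max)) / near_bound * exp (y' * ?T R)) \<le>
          ereal (exp ((\<Sum>j\<in>{ylevel (ln (3 / R))..<min (ylevel (ln (3 / R) + ?T R)) (xlevel (ln (3 / R)))}. lnC j)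
            + cols_sum (ln (3 / R)) (ln (3 / R) + ?T R)) / near_bound)" by simp
        with covering_lower[OF sc(1,2)] R elim show ?case
          unfolding sc(4) using order_trans less_imp_le by blast
      qed
      from eventually_happens[OF this] show "\<exists>R. 0 < R \<and> R < 1 \<and> M \<le> ?T R \<and>
        ereal (exp (- ((c1 + c2) * log_max)) / near_bound * exp (y' * ?T R)) \<le> sup_covering ?F R (R powr (1 + \<psi> R))"
        by (auto simp: trivial_limit_at_right_real)
    qed (use \<psi> near_bound_pos in auto)
    then show "y \<le> gen_assouad_spectrum \<psi> ?F" using y'(1) by (meson less_imp_le order_trans)
  qed
qed

end

section \<open>Constant functions and the quasi-Assouad dimension\<close>

lemma gauge_const: "gauge_of (\<lambda>_. p) R = p * \<bar>ln R\<bar>"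
  by (simp add: gauge_of_def)

lemma gauge_const_props:
  assumes "0 < p"
  shows "antimono_on {0<..<1} (gauge_of (\<lambda>_. p))" "filterlim (gauge_of (\<lambda>_. p)) at_top (at_right 0)"
proof -
  show "antimono_on {0<..<1} (gauge_of (\<lambda>_. p))"
    using assms by (auto simp: monotone_on_def gauge_of_def)
  have "filterlim (\<lambda>R. - ln R) at_top (at_right (0::real))"
    using ln_at_0 by (simp add: filterlim_uminus_at_top)
  then have "filterlim (\<lambda>R. p * - ln R) at_top (at_right 0)"
    using assms by (intro filterlim_tendsto_pos_mult_at_top[OF tendsto_const])
  moreover have "eventually (\<lambda>R. gauge_of (\<lambda>_. p) R = p * - ln R) (at_right 0)"
    using eventually_unit by eventually_elim (simp add: gauge_of_def)
  ultimately show "filterlim (gauge_of (\<lambda>_. p)) at_top (at_right 0)"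
    by (subst filterlim_cong[OF refl refl])
qed

context carpet_realisation
begin

context
  fixes \<nu> \<kappa> c1 c2 :: real
  assumes hn: "(\<lambda>L. (\<Sum>i<L. lnn i) / L) \<longlonglongrightarrow> \<nu>" and hm: "(\<lambda>L. (\<Sum>i<L. lnm i) / L) \<longlonglongrightarrow> \<kappa>"
    and \<nu>\<kappa>: "0 < \<kappa>" "\<kappa> < \<nu>" and c: "0 \<le> c1" "0 \<le> c2"
begin

text \<open>The Assouad spectrum is already constant in \<open>\<theta>\<close> near 1, namely once
  \<open>1 / \<theta> < \<nu> / \<kappa>\<close>. The hypotheses do not mention
  \<open>\<theta>\<close>, so a single realisation serves all these values.\<close>

lemma quasi_assouad_dim_eq:
  assumes hX: "(\<lambda>L. (\<Sum>i<L. lnC i - c1 * lnn i) / L) \<longlonglongrightarrow> 0"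
    and hY: "(\<lambda>L. (\<Sum>i<L. lnB i - c2 * lnm i) / L) \<longlonglongrightarrow> 0"
  shows "quasi_assouad_dim (carpet m n N a b \<omega>) = ereal (c1 + c2)"
proof -
  have const: "gen_assouad_spectrum (\<lambda>_. p) (carpet m n N a b \<omega>) = ereal (c1 + c2)"
    if p: "0 < p" "p \<le> \<nu> / \<kappa> - 1" for p
  proof (rule spectrum_eq[OF _ gauge_const_props[OF p(1)] c])
    fix \<epsilon> :: real assume e: "0 < \<epsilon>"
    show "eventually (\<lambda>R. \<bar>\<Sum>i\<in>{ylevel (ln (3 / R))..<ylevel (ln (3 / R) + gauge_of (\<lambda>_. p) R)}.
        lnC i - c1 * lnn i\<bar> \<le> \<epsilon> * gauge_of (\<lambda>_. p) R) (at_right 0)"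
      by (rule window_average_of_lln[OF lnn_bounds hX p(1) e gauge_const])
    show "eventually (\<lambda>R. \<bar>\<Sum>i\<in>{xlevel (ln (3 / R))..<xlevel (ln (3 / R) + gauge_of (\<lambda>_. p) R)}.
        lnB i - c2 * lnm i\<bar> \<le> \<epsilon> * gauge_of (\<lambda>_. p) R) (at_right 0)"
      by (rule window_average_of_lln[OF lnm_bounds hY p(1) e gauge_const])
    show "eventually (\<lambda>R. real (ylevel (ln (3 / R) + gauge_of (\<lambda>_. p) R)) - real (xlevel (ln (3 / R)))
        \<le> \<epsilon> * gauge_of (\<lambda>_. p) R) (at_right 0)"
      by (rule level_overlap[OF lnn_bounds lnm_bounds hn hm \<nu>\<kappa> _ _ e]) (use p in auto)
  qed (use p in auto)
  have "((\<lambda>\<theta>::real. 1 / \<theta> - 1) \<longlongrightarrow> 1 / 1 - 1) (at_left 1)" by (intro tendsto_intros) auto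
  moreover have "1 / 1 - 1 < \<nu> / \<kappa> - 1" using \<nu>\<kappa> by simp
  ultimately have "eventually (\<lambda>\<theta>. 1 / \<theta> - 1 < \<nu> / \<kappa> - 1) (at_left 1)" by (rule order_tendstoD(2))
  moreover have "eventually (\<lambda>\<theta>::real. 0 < \<theta> \<and> \<theta> < 1) (at_left 1)"
    unfolding eventually_at_left_field by (intro exI[of _ 0]) auto
  ultimately have "eventually (\<lambda>\<theta>. assouad_spectrum \<theta> (carpet m n N a b \<omega>) = ereal (c1 + c2)) (at_left 1)"
    unfolding assouad_spectrum_def by eventually_elim (intro const, auto)
  then show ?thesis unfolding quasi_assouad_dim_def
    by (intro tendsto_Lim tendsto_eventually) (auto simp: trivial_limit_at_left_real)
qed

lemma spectrum_eq_of_windows: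
  assumes \<psi>: "\<And>x. 0 < x \<Longrightarrow> x < 1 \<Longrightarrow> 0 < \<psi> x"
    and anti: "antimono_on {0<..<1} (gauge_of \<psi>)" and top: "filterlim (gauge_of \<psi>) at_top (at_right 0)"
    and le: "eventually (\<lambda>R. \<psi> R \<le> \<nu> / \<kappa> - 1) (at_right 0)"
    and WX: "\<And>\<epsilon>. 0 < \<epsilon> \<Longrightarrow> \<exists>J. \<forall>j\<ge>J. \<forall>L. gauge_of \<psi> (exp (- (real j / 2))) / (2 * log_max) \<le> real L \<longrightarrow>
      \<bar>\<Sum>i<L. lnC (j + i) - c1 * lnn (j + i)\<bar> \<le> \<epsilon> * real L"
    and WY: "\<And>\<epsilon>. 0 < \<epsilon> \<Longrightarrow> \<exists>J. \<forall>j\<ge>J. \<forall>L. gauge_of \<psi> (exp (- (real j / 2))) / (2 * log_max) \<le> real L \<longrightarrow>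
      \<bar>\<Sum>i<L. lnB (j + i) - c2 * lnm (j + i)\<bar> \<le> \<epsilon> * real L"
  shows "gen_assouad_spectrum \<psi> (carpet m n N a b \<omega>) = ereal (c1 + c2)"
proof (rule spectrum_eq[OF \<psi> anti top c])
  fix \<epsilon> :: real assume e: "0 < \<epsilon>"
  show "eventually (\<lambda>R. \<bar>\<Sum>i\<in>{ylevel (ln (3 / R))..<ylevel (ln (3 / R) + gauge_of \<psi> R)}.
      lnC i - c1 * lnn i\<bar> \<le> \<epsilon> * gauge_of \<psi> R) (at_right 0)"
    by (rule window_average[OF lnn_bounds anti top WX e])
  show "eventually (\<lambda>R. \<bar>\<Sum>i\<in>{xlevel (ln (3 / R))..<xlevel (ln (3 / R) + gauge_of \<psi> R)}.
      lnB i - c2 * lnm i\<bar> \<le> \<epsilon> * gauge_of \<psi> R) (at_right 0)"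
    by (rule window_average[OF lnm_bounds anti top WY e])
  show "eventually (\<lambda>R. real (ylevel (ln (3 / R) + gauge_of \<psi> R)) - real (xlevel (ln (3 / R)))
      \<le> \<epsilon> * gauge_of \<psi> R) (at_right 0)"
    by (rule level_overlap[OF lnn_bounds lnm_bounds hn hm \<nu>\<kappa> le \<psi> e])
qed

end

text \<open>Inside the runs every letter attains its ratio, so each window contributes the extremal
  ratio times \<open>T\<close> up to a constant. The lower bound on \<open>w\<close> makes the runs
  cover both windows, and \<open>J + w \<le> xlevel (\<Sum>j<J. lnn j)\<close> means that no row is
  lost to the overlap.\<close>

lemma spectrum_ge_of_runs:
  assumes l1: "l1 \<in> \<Lambda>" "ln (real (maxrows l1)) = rows_ratio * ln (real (n l1))"
    and l2: "l2 \<in> \<Lambda>" "ln (real (ncols l2)) = cols_ratio * ln (real (m l2))"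
    and \<psi>: "\<And>x. 0 < x \<Longrightarrow> x < 1 \<Longrightarrow> 0 < \<psi> x"
    and top: "filterlim (gauge_of \<psi>) at_top (at_right 0)"
    and runs: "\<And>t0. \<exists>J w. t0 \<le> (\<Sum>j<J. lnn j) \<and> (\<forall>j<w. \<omega> (J + j) = l1) \<and>
      (\<forall>j<w. \<omega> (xlevel (\<Sum>j<J. lnn j) + j) = l2) \<and> J + w \<le> xlevel (\<Sum>j<J. lnn j) \<and>
      gauge_of \<psi> (3 * exp (- (\<Sum>j<J. lnn j))) + log_max \<le> ln 2 * real w"
  shows "ereal (rows_ratio + cols_ratio) \<le> gen_assouad_spectrum \<psi> (carpet m n N a b \<omega>)"
proof (rule gen_assouad_spectrum_ge[where \<kappa> = "exp (- ((rows_ratio + cols_ratio) * log_max)) / near_bound"])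
  fix M
  have "eventually (\<lambda>R. M \<le> gauge_of \<psi> R) (at_right 0)" using top by (simp add: filterlim_at_top)
  then obtain R0 where R0: "0 < R0" "R0 < 1" "\<And>R. 0 < R \<Longrightarrow> R < R0 \<Longrightarrow> M \<le> gauge_of \<psi> R"
    using eventually_at_right_0_D by blast
  \<comment> \<open>\<open>4 / R0\<close> makes \<open>R = 3 * exp (- t)\<close> at most
    \<open>3 * R0 / 4\<close>, hence strictly less than \<open>R0\<close>.\<close>
  obtain J w where J: "ln (4 / R0) \<le> (\<Sum>j<J. lnn j)" "\<And>j. j < w \<Longrightarrow> \<omega> (J + j) = l1"
      "\<And>j. j < w \<Longrightarrow> \<omega> (xlevel (\<Sum>j<J. lnn j) + j) = l2" "J + w \<le> xlevel (\<Sum>j<J. lnn j)"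
      "gauge_of \<psi> (3 * exp (- (\<Sum>j<J. lnn j))) + log_max \<le> ln 2 * real w"
    using runs[of "ln (4 / R0)"] by blast
  define t where "t = (\<Sum>j<J. lnn j)"
  \<comment> \<open>The scale with \<open>ln (3 / R) = t\<close>, whose row level is exactly
    \<open>J\<close>.\<close>
  define R where "R = 3 * exp (- t)"
  define T where "T = gauge_of \<psi> R"
  have "exp (- t) \<le> exp (- ln (4 / R0))" using J(1) by (simp add: t_def)
  also have "\<dots> = R0 / 4" using R0 by (simp add: exp_minus)
  finally have R: "0 < R" "R < R0" "R < 1" using R0 by (auto simp: R_def)
  note sc = inner_scale[of R \<psi>, OF R(1,3) \<psi>[OF R(1,3)]]
  have "3 / R = exp t" by (simp add: R_def exp_minus inverse_eq_divide)
  then have t3: "ln (3 / R) = t" by simp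
  have t0: "0 \<le> t" "t \<le> t + T" using R t3 sc(6) by (auto simp: T_def[symmetric] intro: ln_ge_zero simp flip: t3)
  define k where "k = xlevel t"
  have yl: "ylevel t = J" unfolding t_def by (rule ylevel_at_sum)
  have run: "T + log_max \<le> ln 2 * real w" using J(5) by (simp add: T_def R_def t_def)
  have wl: "ylevel (t + T) \<le> J + w" "xlevel (t + T) \<le> k + w"
  proof -
    have "ln 2 * real (ylevel (t + T) - J) \<le> T + log_max" "ln 2 * real (xlevel (t + T) - k) \<le> T + log_max"
      using ylevel_window(3)[OF t0] xlevel_window(3)[OF t0] unfolding yl k_def[symmetric] by simp_all
    from this[THEN order_trans, OF run]
    have "real (ylevel (t + T) - J) \<le> real w" "real (xlevel (t + T) - k) \<le> real w"
      by (simp_all only: mult_le_cancel_left_pos ln2_pos)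
    then have "ylevel (t + T) - J \<le> w" "xlevel (t + T) - k \<le> w" by (simp_all only: of_nat_le_iff)
    then show "ylevel (t + T) \<le> J + w" "xlevel (t + T) \<le> k + w" by simp_all
  qed
  have min: "min (ylevel (t + T)) k = ylevel (t + T)" using wl(1) J(4) unfolding k_def t_def by simp
  have "(\<Sum>j\<in>{J..<ylevel (t + T)}. lnC j) = (\<Sum>j\<in>{J..<ylevel (t + T)}. rows_ratio * lnn j)"
  proof (rule sum.cong[OF refl])
    fix j assume "j \<in> {J..<ylevel (t + T)}"
    then have "\<omega> j = l1" using J(2)[of "j - J"] wl(1) by auto
    then show "lnC j = rows_ratio * lnn j" using l1 by simp
  qed
  also have "\<dots> \<ge> rows_ratio * (T - log_max)"
    unfolding sum_distrib_left[symmetric] using ylevel_window(2)[OF t0] ratio_nonneg unfolding yl by (intro mult_left_mono) auto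
  finally have rows: "rows_ratio * (T - log_max) \<le> (\<Sum>j\<in>{J..<ylevel (t + T)}. lnC j)" .
  have "cols_sum t (t + T) = (\<Sum>j\<in>{k..<xlevel (t + T)}. cols_ratio * lnm j)"
    unfolding cols_sum_def k_def[symmetric]
  proof (rule sum.cong[OF refl])
    fix j assume "j \<in> {k..<xlevel (t + T)}"
    then have "\<omega> j = l2" using J(3)[of "j - k"] wl(2) unfolding k_def t_def by auto
    then show "lnB j = cols_ratio * lnm j" using l2 by simp
  qed
  also have "\<dots> \<ge> cols_ratio * (T - log_max)"
    unfolding sum_distrib_left[symmetric] using xlevel_window(2)[OF t0] ratio_nonneg unfolding k_def by (intro mult_left_mono) auto
  finally have cols: "cols_ratio * (T - log_max) \<le> cols_sum t (t + T)" .
  let ?D = "rows_ratio + cols_ratio"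
  have "exp (- (?D * log_max)) / near_bound * exp (?D * T) = exp (?D * T - ?D * log_max) / near_bound"
    by (simp add: exp_diff exp_minus divide_inverse mult_ac)
  also have "\<dots> \<le> exp ((\<Sum>j\<in>{ylevel t..<min (ylevel (t + T)) (xlevel t)}. lnC j) + cols_sum t (t + T)) / near_bound"
    using rows cols near_bound_pos unfolding min[unfolded k_def] yl
    by (intro divide_right_mono) (auto simp: algebra_simps)
  finally have "ereal (exp (- (?D * log_max)) / near_bound * exp (?D * T)) \<le>
    ereal (exp ((\<Sum>j\<in>{ylevel t..<min (ylevel (t + T)) (xlevel t)}. lnC j) + cols_sum t (t + T)) / near_bound)" by simp
  also have "\<dots> \<le> sup_covering (carpet m n N a b \<omega>) R (R powr (1 + \<psi> R))"
    using covering_lower[OF sc(1,2)] R unfolding sc(4) t3 T_def by simp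
  finally show "\<exists>R. 0 < R \<and> R < 1 \<and> M \<le> gauge_of \<psi> R \<and>
    ereal (exp (- (?D * log_max)) / near_bound * exp (?D * gauge_of \<psi> R)) \<le>
      sup_covering (carpet m n N a b \<omega>) R (R powr (1 + \<psi> R))"
    using R R0(3) unfolding T_def by blast
qed (use \<psi> near_bound_pos in auto)

end

section \<open>Simultaneous runs of letters\<close>

lemma sequence_space_pmf: "sequence_space (measure_pmf \<mu>)" ..

definition run :: "nat \<Rightarrow> nat \<Rightarrow> 'l \<Rightarrow> (nat \<Rightarrow> 'l) \<Rightarrow> bool" where
  "run c w l \<omega> \<longleftrightarrow> (\<forall>j<w. \<omega> (c + j) = l)"

context
  fixes \<mu> :: "'l pmf"
begin

interpretation sequence_space "measure_pmf \<mu>" by (rule sequence_space_pmf)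

abbreviation (input) "RM \<equiv> realisation_measure \<mu>"

lemma RM_eq: "RM = S"
  by (simp add: realisation_measure_def)

lemma prob_space_RM: "prob_space RM"
  unfolding RM_eq by (rule P.prob_space_axioms)

lemma space_RM [simp]: "space RM = UNIV"
  by (simp add: RM_eq space_PiM)

lemma pred_sets: "Measurable.pred RM P \<Longrightarrow> {\<omega>. P \<omega>} \<in> sets RM"
  by (simp add: pred_def)

lemma measurable_letter [measurable]: "(\<lambda>\<omega>. \<omega> j) \<in> measurable RM (measure_pmf \<mu>)"
  unfolding RM_eq by simp

lemma pred_letter [measurable]: "Measurable.pred RM (\<lambda>\<omega>. \<omega> j = l)"
proof -
  have "(\<lambda>\<omega>. \<omega> j) -` {l} \<inter> space RM \<in> sets RM" by (rule measurable_sets[OF measurable_letter]) simp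
  then show ?thesis by (simp add: pred_def vimage_def)
qed

lemma borel_letter [measurable]: "(\<lambda>\<omega>. f (\<omega> j) :: real) \<in> borel_measurable RM"
  by (rule measurable_compose[OF measurable_letter]) simp

lemma AE_letter: "AE \<omega> in RM. \<forall>j. \<omega> j \<in> set_pmf \<mu>"
  unfolding AE_all_countable
proof
  fix j
  have "AE x in measure_pmf \<mu>. x \<in> set_pmf \<mu>" by (rule AE_pmfI) simp
  then show "AE \<omega> in RM. \<omega> j \<in> set_pmf \<mu>"
    unfolding realisation_measure_def by (intro AE_PiM_component) (auto intro: prob_space_measure_pmf)
qed

text \<open>Gluing the first \<open>c\<close> letters of one sequence to a second, independent
  sequence preserves the product measure. Under the gluing \<open>A\<close> depends on the first
  factor only, by \<open>local\<close>, and the shifted event on the second only.\<close>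

lemma shift_independent:
  assumes A [measurable]: "A \<in> sets RM" and B [measurable]: "B \<in> sets RM"
    and local: "\<And>\<omega> \<omega>'. (\<And>j. j < c \<Longrightarrow> \<omega> j = \<omega>' j) \<Longrightarrow> \<omega> \<in> A \<Longrightarrow> \<omega>' \<in> A"
  shows "{\<omega>. (\<lambda>j. \<omega> (c + j)) \<in> B} \<in> sets RM"
    and "measure RM (A \<inter> {\<omega>. (\<lambda>j. \<omega> (c + j)) \<in> B}) = measure RM A * measure RM B"
proof -
  have shift: "(\<lambda>\<omega> j. \<omega> (c + j)) \<in> measurable S S"
    by (intro measurable_PiM_single') (auto simp: space_PiM)
  then have "(\<lambda>\<omega> j. \<omega> (c + j)) -` B \<inter> space S \<in> sets S" using B unfolding RM_eq by (rule measurable_sets)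
  then show sh: "{\<omega>. (\<lambda>j. \<omega> (c + j)) \<in> B} \<in> sets RM" by (simp add: RM_eq vimage_def space_PiM)
  let ?X = "A \<inter> {\<omega>. (\<lambda>j. \<omega> (c + j)) \<in> B}"
  have X: "?X \<in> sets S" using A sh unfolding RM_eq by blast
  have vim: "(\<lambda>(\<omega>, \<omega>'). comb_seq c \<omega> \<omega>') -` ?X \<inter> space (S \<Otimes>\<^sub>M S) = A \<times> B"
  proof -
    have "comb_seq c \<omega> \<omega>' \<in> A \<longleftrightarrow> \<omega> \<in> A" for \<omega> \<omega>'
      using local[of \<omega> "comb_seq c \<omega> \<omega>'"] local[of "comb_seq c \<omega> \<omega>'" \<omega>] by (auto simp: comb_seq_less)
    moreover have "(\<lambda>j. comb_seq c \<omega> \<omega>' (c + j)) = \<omega>'" for \<omega> \<omega>' :: "nat \<Rightarrow> 'l"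
      using comb_seq_add[of c \<omega> \<omega>'] by (simp add: add.commute)
    ultimately show ?thesis by (auto simp: space_pair_measure space_PiM)
  qed
  have "emeasure S ?X = emeasure (distr (S \<Otimes>\<^sub>M S) S (\<lambda>(\<omega>, \<omega>'). comb_seq c \<omega> \<omega>')) ?X"
    unfolding PiM_comb_seq ..
  also have "\<dots> = emeasure (S \<Otimes>\<^sub>M S) (A \<times> B)"
    by (subst emeasure_distr[OF measurable_comb_seq X]) (simp only: vim)
  also have "\<dots> = emeasure S A * emeasure S B"
    using A B unfolding RM_eq by (intro P.emeasure_pair_measure_Times) auto
  finally show "measure RM ?X = measure RM A * measure RM B"
    unfolding RM_eq P.emeasure_eq_measure by (simp add: ennreal_mult[symmetric])
qed

lemma pred_run [measurable]: "Measurable.pred RM (run c w l)"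
  unfolding run_def[abs_def] by measurable

lemma prob_run: "measure RM {\<omega>. run 0 w l \<omega>} = pmf \<mu> l ^ w"
proof (induction w)
  case 0
  then show ?case using prob_space.prob_space[OF prob_space_RM] by (simp add: run_def)
next
  case (Suc w)
  have one: "measure RM {\<omega>. \<omega> 0 = l} = pmf \<mu> l"
  proof -
    have "measure (distr RM (measure_pmf \<mu>) (\<lambda>\<omega>. \<omega> 0)) {l} = measure (measure_pmf \<mu>) {l}"
      unfolding RM_eq by (subst PiM_component) auto
    then show ?thesis by (subst (asm) measure_distr[OF measurable_letter]) (auto simp: pmf.rep_eq vimage_def)
  qed
  have B: "{\<omega>. \<omega> 0 = l} \<in> sets RM" and A: "{\<omega>. run 0 w l \<omega>} \<in> sets RM"
    using pred_letter[of 0 l] pred_run[of 0 w l] by (simp_all add: pred_def)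
  have "{\<omega>. run 0 (Suc w) l \<omega>} = {\<omega>. run 0 w l \<omega>} \<inter> {\<omega>. (\<lambda>j. \<omega> (w + j)) \<in> {\<omega>. \<omega> 0 = l}}"
    by (auto simp: run_def less_Suc_eq)
  also have "measure RM \<dots> = measure RM {\<omega>. run 0 w l \<omega>} * measure RM {\<omega>. \<omega> 0 = l}"
    by (rule shift_independent(2)[OF A B]) (auto simp: run_def)
  finally show ?case using Suc one by (simp add: mult.commute)
qed

lemma pred_run_at:
  assumes [measurable]: "\<sigma> \<in> measurable RM (count_space UNIV)"
  shows "Measurable.pred RM (\<lambda>\<omega>. run (\<sigma> \<omega>) w l \<omega>)"
proof -
  have "(\<lambda>\<omega>. run (\<sigma> \<omega>) w l \<omega>) = (\<lambda>\<omega>. \<exists>c. \<sigma> \<omega> = c \<and> run c w l \<omega>)" by auto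
  then show ?thesis by simp
qed

text \<open>The starting positions are stopping times, so the letters read in one window are independent
  of everything that determines where that window starts.\<close>

lemma prob_no_run:
  fixes \<sigma> :: "nat \<Rightarrow> (nat \<Rightarrow> 'l) \<Rightarrow> nat"
  assumes meas [measurable]: "\<And>i. \<sigma> i \<in> measurable RM (count_space UNIV)"
    and stop: "\<And>i \<omega> \<omega>'. i < Q \<Longrightarrow> (\<And>j. j < \<sigma> i \<omega> \<Longrightarrow> \<omega> j = \<omega>' j) \<Longrightarrow> \<sigma> i \<omega>' = \<sigma> i \<omega>"
    and spaced: "\<And>i \<omega>. \<sigma> i \<omega> + w \<le> \<sigma> (Suc i) \<omega>"
    and "q \<le> Q"
  shows "measure RM {\<omega>. \<forall>i<q. \<not> run (\<sigma> i \<omega>) w l \<omega>} = (1 - pmf \<mu> l ^ w) ^ q"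
  using \<open>q \<le> Q\<close>
proof (induction q)
  case 0
  then show ?case using prob_space.prob_space[OF prob_space_RM] by simp
next
  case (Suc q)
  interpret R: prob_space RM by (rule prob_space_RM)
  note pred_run_at[OF meas, measurable]
  \<comment> \<open>The last window starts at a random position. On \<open>E c\<close> it starts at
    \<open>c\<close> and all earlier windows have ended, so \<open>E c\<close> is decided by the
    first \<open>c\<close> letters; summing over \<open>c\<close> removes the conditioning.\<close>
  define E where "E c = {\<omega>. (\<forall>i<q. \<not> run (\<sigma> i \<omega>) w l \<omega>) \<and> \<sigma> q \<omega> = c}" for c
  define B where "B = {\<omega>. \<not> run 0 w l \<omega>}"
  define E' where "E' c = E c \<inter> {\<omega>. (\<lambda>j. \<omega> (c + j)) \<in> B}" for c
  have E: "E c \<in> sets RM" for c unfolding E_def by (rule pred_sets) measurable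
  have B: "B \<in> sets RM" unfolding B_def by (rule pred_sets) measurable
  have earlier: "\<sigma> i \<omega> + w \<le> \<sigma> q \<omega>" if "i < q" for i \<omega>
  proof -
    have "\<sigma> (Suc i) \<omega> \<le> \<sigma> q \<omega>"
      by (rule lift_Suc_mono_le[of "\<lambda>i. \<sigma> i \<omega>"]) (use spaced le_trans le_add1 that in \<open>blast, simp\<close>)
    then show ?thesis using spaced[of i \<omega>] by linarith
  qed
  have local: "\<omega>' \<in> E c" if \<omega>: "\<omega> \<in> E c" and eq: "\<And>j. j < c \<Longrightarrow> \<omega> j = \<omega>' j" for c \<omega> \<omega>'
  proof -
    have c: "\<sigma> q \<omega> = c" using \<omega> by (simp add: E_def)
    have "\<sigma> q \<omega>' = c" using stop[of q \<omega> \<omega>'] Suc.prems eq unfolding c by simp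
    moreover have "\<not> run (\<sigma> i \<omega>') w l \<omega>'" if i: "i < q" for i
    proof -
      have le: "\<sigma> i \<omega> + w \<le> c" using earlier[OF i, of \<omega>] c by simp
      then have "\<sigma> i \<omega>' = \<sigma> i \<omega>" using stop[of i \<omega> \<omega>'] i Suc.prems eq by simp
      moreover have "\<not> run (\<sigma> i \<omega>) w l \<omega>" using \<omega> i by (simp add: E_def)
      ultimately show ?thesis using eq le unfolding run_def
        by (metis add_less_cancel_left order_less_le_trans)
    qed
    ultimately show ?thesis by (simp add: E_def)
  qed
  have E': "E' c \<in> sets RM" "measure RM (E' c) = measure RM (E c) * measure RM B" for c
    unfolding E'_def using shift_independent[OF E B, of c c] local E by auto
  have "(\<lambda>c. measure RM (E c)) sums measure RM (\<Union>c. E c)"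
    using E by (intro R.finite_measure_UNION) (auto simp: disjoint_family_on_def E_def)
  moreover have "(\<Union>c. E c) = {\<omega>. \<forall>i<q. \<not> run (\<sigma> i \<omega>) w l \<omega>}" by (auto simp: E_def)
  ultimately have "(\<lambda>c. measure RM (E c)) sums (1 - pmf \<mu> l ^ w) ^ q" using Suc by simp
  then have "(\<lambda>c. measure RM (E' c)) sums ((1 - pmf \<mu> l ^ w) ^ q * measure RM B)"
    unfolding E' by (rule sums_mult2)
  moreover have "disjoint_family E'"
    unfolding disjoint_family_on_def E'_def E_def by auto
  then have "(\<lambda>c. measure RM (E' c)) sums measure RM (\<Union>c. E' c)"
    using E'(1) by (intro R.finite_measure_UNION) blast
  moreover have "(\<Union>c. E' c) = {\<omega>. \<forall>i<Suc q. \<not> run (\<sigma> i \<omega>) w l \<omega>}"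
    by (auto simp: E'_def E_def B_def run_def less_Suc_eq)
  ultimately have "measure RM {\<omega>. \<forall>i<Suc q. \<not> run (\<sigma> i \<omega>) w l \<omega>} = (1 - pmf \<mu> l ^ w) ^ q * measure RM B"
    using sums_unique2 by fastforce
  moreover have "measure RM B = 1 - pmf \<mu> l ^ w"
  proof -
    have "B = space RM - {\<omega>. run 0 w l \<omega>}" by (auto simp: B_def)
    moreover have "{\<omega>. run 0 w l \<omega>} \<in> sets RM" by (rule pred_sets) measurable
    ultimately show ?thesis using R.prob_compl prob_run by metis
  qed
  ultimately show ?case by simp
qed

context
  fixes gn gm :: "'l \<Rightarrow> real" and \<delta> G :: real
  assumes gm: "\<And>l. ln 2 \<le> gm l" and gap: "\<And>l. gm l + \<delta> \<le> gn l" and gn: "\<And>l. gn l \<le> G" and \<delta>: "0 < \<delta>"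
begin

text \<open>Columns of level \<open>xpos J \<omega>\<close> are as wide as rows of level \<open>J\<close> are high. The functions \<open>gn\<close> and
  \<open>gm\<close> are \<open>ln n\<close> and \<open>ln m\<close>, extended to letters outside the support of \<open>\<mu>\<close>.\<close>

definition xpos :: "nat \<Rightarrow> (nat \<Rightarrow> 'l) \<Rightarrow> nat" where
  "xpos J \<omega> = level (\<lambda>j. gm (\<omega> j)) (\<Sum>j<J. gn (\<omega> j))"

lemma gm_le: "gm l \<le> G" and gn_ge: "ln 2 \<le> gn l"
  using gm[of l] gap[of l] gn[of l] \<delta> by linarith+

lemma xpos_le_iff: "xpos J \<omega> \<le> k \<longleftrightarrow> (\<Sum>j<J. gn (\<omega> j)) \<le> (\<Sum>j<k. gm (\<omega> j))"
  unfolding xpos_def by (rule level_le_iff[of "ln 2" _ G]) (use gm gm_le in auto)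

lemma G_gt: "\<delta> \<le> G"
  using gm[of undefined] gap[of undefined] gn[of undefined] ln2_pos by linarith

text \<open>Over the first \<open>J\<close> letters the sum of \<open>gm\<close> falls short of that
  of \<open>gn\<close> by at least \<open>\<delta> * J\<close>, and each further letter makes up at
  most \<open>G\<close>. So \<open>xpos J \<omega>\<close> exceeds \<open>J\<close> by a fixed
  proportion, uniformly in \<open>\<omega>\<close>, which is the room that separates row windows
  from column windows.\<close>

lemma xpos_far: "(G + \<delta>) * J \<le> G * xpos J \<omega>"
proof -
  let ?x = "xpos J \<omega>"
  have "(\<Sum>j<J. gn (\<omega> j)) \<ge> (\<Sum>j<J. gm (\<omega> j) + \<delta>)" using gap by (intro sum_mono) auto
  then have 1: "(\<Sum>j<J. gm (\<omega> j)) + \<delta> * J \<le> (\<Sum>j<?x. gm (\<omega> j))"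
    using xpos_le_iff[of J \<omega> ?x] by (simp add: sum.distrib mult.commute)
  have pos: "0 \<le> gm l" for l using gm[of l] ln2_pos by linarith
  show ?thesis
  proof (cases "J \<le> ?x")
    case True
    have "(\<Sum>j<?x. gm (\<omega> j)) - (\<Sum>j<J. gm (\<omega> j)) = (\<Sum>j\<in>{J..<?x}. gm (\<omega> j))"
      using sum_diff_nat_ivl[of 0 J ?x "\<lambda>j. gm (\<omega> j)"] True by (simp add: atLeast0LessThan)
    also have "\<dots> \<le> (real ?x - real J) * G"
      using sum_bounded_above[of "{J..<?x}" "\<lambda>j. gm (\<omega> j)" G] gm_le True by (simp add: of_nat_diff)
    finally show ?thesis using 1 by (simp add: algebra_simps)
  next
    case False
    then have "(\<Sum>j<?x. gm (\<omega> j)) \<le> (\<Sum>j<J. gm (\<omega> j))" using pos by (intro sum_mono2) auto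
    then have "\<delta> * J \<le> 0" using 1 by linarith
    then have "J = 0" using \<delta> by (simp add: mult_le_0_iff)
    then show ?thesis using G_gt \<delta> by simp
  qed
qed

lemma pred_sum_le [measurable]:
  "Measurable.pred RM (\<lambda>\<omega>. (\<Sum>j<J. gn (\<omega> j)) \<le> (\<Sum>j<k. gm (\<omega> j)))"
proof -
  have "{\<omega> \<in> space RM. (\<Sum>j<J. gn (\<omega> j)) \<le> (\<Sum>j<k. gm (\<omega> j))} \<in> sets RM"
    by (intro borel_measurable_le borel_measurable_sum borel_letter)
  then show ?thesis by (simp add: pred_def)
qed

lemma measurable_xpos_at:
  assumes [measurable]: "J \<in> measurable RM (count_space UNIV)"
  shows "(\<lambda>\<omega>. xpos (J \<omega>) \<omega>) \<in> measurable RM (count_space UNIV)"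
proof -
  have "(\<lambda>\<omega>. xpos (J \<omega>) \<omega>) =
    (\<lambda>\<omega>. LEAST k. \<exists>c. J \<omega> = c \<and> (\<Sum>j<c. gn (\<omega> j)) \<le> (\<Sum>j<k. gm (\<omega> j)))"
    by (auto simp: xpos_def level_def)
  then show ?thesis by simp
qed

text \<open>There are \<open>q\<close> groups of \<open>g\<close> candidate windows each. Outside an unlikely event every group contains
  a run of \<open>l1\<close>; the windows at the corresponding \<open>xpos\<close> lie beyond all groups and are disjoint, so
  they are \<open>q\<close> fresh independent chances for a run of \<open>l2\<close>.\<close>

lemma prob_no_double_run:
  fixes A q g w D :: nat
  assumes w: "1 \<le> w" and D: "2 * G \<le> D * ln 2" and small: "real (q * (g + D) * w) * G \<le> \<delta> * A"
  shows "measure RM {\<omega>. \<not> (\<exists>J. A \<le> J \<and> J \<le> 2 * A \<and> run J w l1 \<omega> \<and> run (xpos J \<omega>) w l2 \<omega> \<and> J + w \<le> xpos J \<omega>)}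
    \<le> q * (1 - pmf \<mu> l1 ^ w) ^ g + (1 - pmf \<mu> l2 ^ w) ^ q"
proof -
  interpret R: prob_space RM by (rule prob_space_RM)
  \<comment> \<open>Group \<open>i\<close> has the windows \<open>base i + e * w\<close> with
    \<open>e < g\<close>, followed by a gap of \<open>D * w\<close> letters that keeps the matching
    column windows disjoint.\<close>
  define base where "base i = A + i * (g + D) * w" for i
  \<comment> \<open>The first success in the group, or \<open>g\<close> if there is none. With this
    default \<open>\<sigma> i\<close> is defined everywhere, as \<open>prob_no_run\<close>
    requires.\<close>
  define e where "e i \<omega> = (LEAST e. g \<le> e \<or> run (base i + e * w) w l1 \<omega>)" for i \<omega>
  define J where "J i \<omega> = base i + e i \<omega> * w" for i \<omega>
  define \<sigma> where "\<sigma> i \<omega> = xpos (J i \<omega>) \<omega>" for i \<omega>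
  have G: "0 < G" using G_gt \<delta> by linarith
  have small': "q * (g + D) * w \<le> A"
  proof -
    have "\<delta> * A \<le> G * A" using G_gt by (intro mult_right_mono) auto
    then have "real (q * (g + D) * w) * G \<le> real A * G" using small by (simp add: mult.commute)
    then show ?thesis using G by (simp del: of_nat_mult)
  qed
  have e: "e i \<omega> \<le> g" "e i \<omega> < g \<Longrightarrow> run (J i \<omega>) w l1 \<omega>" for i \<omega>
  proof -
    show "e i \<omega> \<le> g" unfolding e_def by (rule Least_le) simp
    have "g \<le> e i \<omega> \<or> run (base i + e i \<omega> * w) w l1 \<omega>" unfolding e_def by (rule LeastI[of _ g]) simp
    then show "e i \<omega> < g \<Longrightarrow> run (J i \<omega>) w l1 \<omega>" by (simp add: J_def)
  qed
  have base_Suc: "base (Suc i) = base i + g * w + D * w" for i by (simp add: base_def algebra_simps)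
  have J_le: "J i \<omega> \<le> base i + g * w" for i \<omega> using e(1) by (simp add: J_def)
  have J_ge: "base i \<le> J i \<omega>" "A \<le> J i \<omega>" for i \<omega> by (auto simp: J_def base_def)
  have group_end: "base i + g * w \<le> A + q * (g + D) * w" if "i < q" for i
  proof -
    have "Suc i * ((g + D) * w) \<le> q * ((g + D) * w)" using that by (intro mult_right_mono) auto
    then show ?thesis by (simp add: base_def algebra_simps)
  qed
  have \<sigma>_ge: "A + q * (g + D) * w \<le> \<sigma> i \<omega>" for i \<omega>
  proof -
    have "G * real (A + q * (g + D) * w) \<le> (G + \<delta>) * real A" using small by (simp add: algebra_simps)
    also have "\<dots> \<le> (G + \<delta>) * real (J i \<omega>)" using J_ge(2) G \<delta> by (intro mult_left_mono) auto
    also have "\<dots> \<le> G * real (\<sigma> i \<omega>)" unfolding \<sigma>_def by (rule xpos_far)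
    finally show ?thesis using G by (simp del: of_nat_mult of_nat_add)
  qed
  have e_meas [measurable]: "e i \<in> measurable RM (count_space UNIV)" for i
    unfolding e_def[abs_def] by measurable
  have J_meas [measurable]: "J i \<in> measurable RM (count_space UNIV)" for i
    unfolding J_def[abs_def] by measurable
  have \<sigma>_meas: "\<sigma> i \<in> measurable RM (count_space UNIV)" for i
    unfolding \<sigma>_def[abs_def] by (rule measurable_xpos_at) measurable
  \<comment> \<open>All groups end before \<open>\<sigma> i \<omega>\<close>, so the letters before
    \<open>\<sigma> i \<omega>\<close> determine \<open>J i \<omega>\<close> as well as the sums
    that \<open>xpos\<close> compares.\<close>
  have stop: "\<sigma> i \<omega>' = \<sigma> i \<omega>" if i: "i < q" and eq: "\<And>j. j < \<sigma> i \<omega> \<Longrightarrow> \<omega> j = \<omega>' j" for i \<omega> \<omega>'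
  proof -
    have "base i + k * w + j < \<sigma> i \<omega>" if "k < g" "j < w" for k j
    proof -
      have "Suc k * w \<le> g * w" using that by (intro mult_right_mono) auto
      then show ?thesis using group_end[OF i] \<sigma>_ge[of i \<omega>] that by simp
    qed
    then have "g \<le> k \<or> run (base i + k * w) w l1 \<omega>' \<longleftrightarrow> g \<le> k \<or> run (base i + k * w) w l1 \<omega>" for k
      using eq unfolding run_def by (metis not_le)
    then have "e i \<omega>' = e i \<omega>" unfolding e_def by simp
    then have J: "J i \<omega>' = J i \<omega>" by (simp add: J_def)
    have "J i \<omega> \<le> \<sigma> i \<omega>" using J_le[of i \<omega>] group_end[OF i] \<sigma>_ge[of i \<omega>] by linarith
    then have sn: "(\<Sum>j<J i \<omega>. gn (\<omega>' j)) = (\<Sum>j<J i \<omega>. gn (\<omega> j))" using eq by (intro sum.cong) auto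
    have sm: "(\<Sum>j<k. gm (\<omega>' j)) = (\<Sum>j<k. gm (\<omega> j))" if "k \<le> \<sigma> i \<omega>" for k
      using that eq by (intro sum.cong) auto
    have iff: "\<sigma> i \<omega>' \<le> k \<longleftrightarrow> \<sigma> i \<omega> \<le> k" if "k \<le> \<sigma> i \<omega>" for k
      unfolding \<sigma>_def xpos_le_iff J sn using sm[OF that] by simp
    show ?thesis
    proof (rule antisym)
      show *: "\<sigma> i \<omega>' \<le> \<sigma> i \<omega>" using iff by blast
      show "\<sigma> i \<omega> \<le> \<sigma> i \<omega>'" using iff[OF *] by blast
    qed
  qed
  \<comment> \<open>The gap adds at least \<open>2 * G * w\<close> to the sum of \<open>gn\<close>.
    This pays for the overshoot \<open>G\<close> at \<open>\<sigma> i\<close> and for the at most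
    \<open>w * G\<close> that the next \<open>w\<close> letters add to the sum of
    \<open>gm\<close>.\<close>
  have spaced: "\<sigma> i \<omega> + w \<le> \<sigma> (Suc i) \<omega>" for i \<omega>
  proof -
    define S where "S = (\<lambda>k. \<Sum>j<k. gm (\<omega> j))"
    define T where "T = (\<lambda>k. \<Sum>j<k. gn (\<omega> j))"
    have gn_pos: "0 < gn l" and gm_pos: "0 < gm l" for l using gn_ge[of l] gm[of l] ln2_pos by linarith+
    have "0 \<le> T (J i \<omega>)" unfolding T_def using gn_ge ln2_pos by (intro sum_nonneg) (meson less_imp_le order_trans)
    then have 1: "S (\<sigma> i \<omega>) \<le> T (J i \<omega>) + G"
      unfolding S_def T_def \<sigma>_def xpos_def
      by (intro level_upper[of "ln 2" _ G]) (use gm gm_le in auto)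
    have "S (\<sigma> i \<omega> + w) - S (\<sigma> i \<omega>) = (\<Sum>j\<in>{\<sigma> i \<omega>..<\<sigma> i \<omega> + w}. gm (\<omega> j))"
      using sum_diff_nat_ivl[of 0 "\<sigma> i \<omega>" "\<sigma> i \<omega> + w" "\<lambda>j. gm (\<omega> j)"] by (simp add: S_def atLeast0LessThan)
    also have "\<dots> \<le> w * G"
      using sum_bounded_above[of "{\<sigma> i \<omega>..<\<sigma> i \<omega> + w}" "\<lambda>j. gm (\<omega> j)" G] gm_le by simp
    finally have 2: "S (\<sigma> i \<omega> + w) \<le> T (J i \<omega>) + G + w * G" using 1 by linarith
    have JD: "J i \<omega> + D * w \<le> J (Suc i) \<omega>" using J_le[of i \<omega>] J_ge(1)[of "Suc i" \<omega>] base_Suc[of i] by linarith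
    have "G + w * G \<le> 2 * G * w" using w G by (simp add: algebra_simps)
    also have "\<dots> \<le> D * ln 2 * w" using D by (intro mult_right_mono) auto
    also have "\<dots> \<le> (\<Sum>j\<in>{J i \<omega>..<J i \<omega> + D * w}. gn (\<omega> j))"
      using sum_bounded_below[of "{J i \<omega>..<J i \<omega> + D * w}" "ln 2" "\<lambda>j. gn (\<omega> j)"] gn_ge by (simp add: mult_ac)
    also have "\<dots> \<le> (\<Sum>j\<in>{J i \<omega>..<J (Suc i) \<omega>}. gn (\<omega> j))"
      using JD gn_pos by (intro sum_mono2) (auto simp: less_imp_le)
    also have "\<dots> = T (J (Suc i) \<omega>) - T (J i \<omega>)"
      using sum_diff_nat_ivl[of 0 "J i \<omega>" "J (Suc i) \<omega>" "\<lambda>j. gn (\<omega> j)"] JD by (simp add: T_def atLeast0LessThan)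
    finally have 3: "S (\<sigma> i \<omega> + w) \<le> T (J (Suc i) \<omega>)" using 2 by linarith
    show ?thesis
    proof (rule ccontr)
      assume "\<not> ?thesis"
      then have lt: "\<sigma> (Suc i) \<omega> < \<sigma> i \<omega> + w" by simp
      have "T (J (Suc i) \<omega>) \<le> S (\<sigma> (Suc i) \<omega>)"
        unfolding S_def T_def using xpos_le_iff[of "J (Suc i) \<omega>" \<omega> "\<sigma> (Suc i) \<omega>"] by (simp add: \<sigma>_def)
      also have "\<dots> < S (\<sigma> i \<omega> + w)"
        unfolding S_def using lt gm_pos by (intro sum_strict_mono2[of _ _ "\<sigma> (Suc i) \<omega>"]) (auto simp: less_imp_le)
      finally show False using 3 by linarith
    qed
  qed
  define F where "F i = {\<omega>. \<forall>k<g. \<not> run (base i + k * w) w l1 \<omega>}" for i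
  define H where "H = {\<omega>. \<forall>i<q. \<not> run (\<sigma> i \<omega>) w l2 \<omega>}"
  have F: "measure RM (F i) = (1 - pmf \<mu> l1 ^ w) ^ g" for i
    unfolding F_def
    by (rule prob_no_run[where \<sigma> = "\<lambda>k _. base i + k * w" and Q = g and q = g]) (auto simp: add.assoc)
  have H: "measure RM H = (1 - pmf \<mu> l2 ^ w) ^ q"
    unfolding H_def
  proof (rule prob_no_run[where \<sigma> = \<sigma> and Q = q and q = q, OF \<sigma>_meas])
    fix i \<omega> \<omega>' assume "i < q" "\<And>j. j < \<sigma> i \<omega> \<Longrightarrow> \<omega> j = \<omega>' j"
    then show "\<sigma> i \<omega>' = \<sigma> i \<omega>" by (rule stop)
  qed (use spaced in blast, simp)
  have F_sets: "F i \<in> sets RM" for i unfolding F_def by (rule pred_sets) measurable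
  note pred_run_at[OF \<sigma>_meas, measurable]
  have H_sets: "H \<in> sets RM" unfolding H_def by (rule pred_sets) measurable
  let ?B = "{\<omega>. \<not> (\<exists>J. A \<le> J \<and> J \<le> 2 * A \<and> run J w l1 \<omega> \<and> run (xpos J \<omega>) w l2 \<omega> \<and> J + w \<le> xpos J \<omega>)}"
  have sub: "?B \<subseteq> (\<Union>i<q. F i) \<union> H"
  proof (rule ccontr)
    assume "\<not> ?thesis"
    then obtain \<omega> where \<omega>: "\<omega> \<in> ?B" "\<And>i. i < q \<Longrightarrow> \<omega> \<notin> F i" "\<omega> \<notin> H" by blast
    obtain i where i: "i < q" "run (\<sigma> i \<omega>) w l2 \<omega>" using \<omega>(3) by (auto simp: H_def)
    obtain k where k: "k < g" "run (base i + k * w) w l1 \<omega>" using \<omega>(2)[OF i(1)] by (auto simp: F_def)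
    have "e i \<omega> \<le> k" unfolding e_def using k by (intro Least_le) simp
    then have lt: "e i \<omega> < g" using k by simp
    have "Suc (e i \<omega>) * w \<le> g * w" using lt by (intro mult_right_mono) auto
    then have "J i \<omega> + w \<le> base i + g * w" by (simp add: J_def)
    then have le: "J i \<omega> + w \<le> A + q * (g + D) * w" using group_end[OF i(1)] by linarith
    have "J i \<omega> \<le> 2 * A" "J i \<omega> + w \<le> xpos (J i \<omega>) \<omega>"
      using le small' \<sigma>_ge[of i \<omega>] by (auto simp: \<sigma>_def)
    then have "\<exists>J. A \<le> J \<and> J \<le> 2 * A \<and> run J w l1 \<omega> \<and> run (xpos J \<omega>) w l2 \<omega> \<and> J + w \<le> xpos J \<omega>"
      using J_ge(2)[of i \<omega>] e(2)[OF lt] i(2) by (intro exI[of _ "J i \<omega>"]) (auto simp: \<sigma>_def)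
    then show False using \<omega>(1) by blast
  qed
  have "measure RM ?B \<le> measure RM ((\<Union>i<q. F i) \<union> H)"
    using sub F_sets H_sets by (intro R.finite_measure_mono) auto
  also have "\<dots> \<le> measure RM (\<Union>i<q. F i) + measure RM H"
    using F_sets H_sets by (intro measure_Un_le) auto
  also have "measure RM (\<Union>i<q. F i) \<le> (\<Sum>i<q. measure RM (F i))"
    using F_sets by (intro R.finite_measure_subadditive_finite) auto
  finally show ?thesis using F H by simp
qed

text \<open>With \<open>\<beta>\<close> small, runs of length \<open>\<beta> * ln K\<close> have probability at least of order \<open>K powr (- 1 / 4)\<close>, while
  there is room for \<open>K powr 0.4\<close> candidates; hence a single large \<open>K\<close> fails with small probability, and
  no second Borel--Cantelli argument is needed.\<close>

lemma AE_double_run: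
  assumes l1: "l1 \<in> set_pmf \<mu>" and l2: "l2 \<in> set_pmf \<mu>"
  shows "\<exists>\<beta>>0. \<forall>w0\<ge>1. \<forall>Ks. infinite Ks \<longrightarrow> (AE \<omega> in RM. \<forall>K0. \<exists>K\<in>Ks. K0 \<le> K \<and>
    (\<exists>J w. 2 * K \<le> J \<and> J \<le> 4 * K \<and> \<beta> * ln (real K) + w0 \<le> real w \<and>
      run J w l1 \<omega> \<and> run (xpos J \<omega>) w l2 \<omega> \<and> J + w \<le> xpos J \<omega>))"
proof -
  interpret R: prob_space RM by (rule prob_space_RM)
  have G: "0 < G" using G_gt \<delta> by linarith
  define p where "p = min (pmf \<mu> l1) (pmf \<mu> l2)"
  have p: "0 < p" "p \<le> pmf \<mu> l1" "p \<le> pmf \<mu> l2" using l1 l2 by (auto simp: p_def pmf_positive)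
  have p1: "p \<le> 1" using p(2) pmf_le_1[of \<mu> l1] by linarith
  \<comment> \<open>Makes \<open>p powr (\<beta> * ln K) = K powr (\<beta> * ln p)\<close> at least
    \<open>K powr (- 1 / 4)\<close>; the summand 1 keeps the denominator positive when
    \<open>p = 1\<close>.\<close>
  define \<beta> where "\<beta> = 1 / (4 * (1 - ln p))"
  have lnp: "ln p \<le> 0" using p p1 by simp
  have \<beta>: "0 < \<beta>" using lnp by (simp add: \<beta>_def)
  have \<beta>p: "- 1 / 4 \<le> \<beta> * ln p" using lnp unfolding \<beta>_def by (simp add: field_simps)
  define D where "D = nat \<lceil>2 * G / ln 2\<rceil>"
  have D: "2 * G \<le> D * ln 2" unfolding D_def using ln2_pos by (simp add: pos_divide_le_eq[symmetric] real_nat_ceiling_ge)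
  show ?thesis
  proof (intro exI[of _ \<beta>] conjI \<beta> allI impI)
    fix w0 :: real and Ks :: "nat set" assume w0: "1 \<le> w0" and inf: "infinite Ks"
    define w where "w K = nat \<lceil>\<beta> * ln (real K) + w0\<rceil>" for K :: nat
    \<comment> \<open>Used both as number of groups and as group size. The exponent exceeds 1/4, so
      the expected number of runs in a group tends to infinity; it is below 1/2, so all candidates
      take up \<open>K powr 0.8 * ln K\<close> letters up to constants, which is
      \<open>o(K)\<close>.\<close>
    define q where "q K = nat \<lfloor>real K powr 0.4\<rfloor>" for K :: nat
    \<comment> \<open>Candidates start at \<open>2 * K\<close> because a row level of at least
      \<open>2 * K\<close> belongs to a scale at most \<open>exp (- K)\<close> for large
      \<open>K\<close>, where \<open>\<phi>\<close> will be evaluated.\<close>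
    define good where "good K \<omega> \<longleftrightarrow> (\<exists>J. 2 * K \<le> J \<and> J \<le> 2 * (2 * K) \<and> run J (w K) l1 \<omega> \<and>
      run (xpos J \<omega>) (w K) l2 \<omega> \<and> J + w K \<le> xpos J \<omega>)" for K \<omega>
    have w: "\<beta> * ln (real K) + w0 \<le> w K" "w K \<le> \<beta> * ln (real K) + w0 + 1" "1 \<le> w K" if "1 \<le> K" for K
    proof -
      have "0 \<le> \<beta> * ln (real K)" using \<beta> that by simp
      then have "1 \<le> \<beta> * ln (real K) + w0" using w0 by linarith
      then show "\<beta> * ln (real K) + w0 \<le> w K" "w K \<le> \<beta> * ln (real K) + w0 + 1" "1 \<le> w K"
        unfolding w_def by linarith+
    qed
    have q: "real (q K) \<le> real K powr 0.4" "real K powr 0.4 - 1 \<le> real (q K)" for K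
      unfolding q_def by (simp_all add: of_nat_floor)
    define c where "c = p powr (w0 + 1)"
    have c: "0 < c" using p by (simp add: c_def)
    define bound where "bound x = (x powr 0.4 + 1) * exp (- (c * x powr (- 1 / 4) * (x powr 0.4 - 1)))" for x :: real
    have fail: "measure RM {\<omega>. \<not> good K \<omega>} \<le> bound K"
      if K: "1 \<le> K" and small: "real (q K * (q K + D) * w K) * G \<le> \<delta> * real (2 * K)" for K
    proof -
      have "c * real K powr (- 1 / 4) \<le> p powr (w0 + 1) * real K powr (\<beta> * ln p)"
        unfolding c_def using K \<beta>p p by (intro mult_left_mono powr_mono) auto
      also have "\<dots> = p powr (\<beta> * ln (real K) + w0 + 1)"
        using K p by (simp add: powr_def exp_add[symmetric] algebra_simps)
      also have "\<dots> \<le> p powr real (w K)" using p p1 w(2)[OF K] by (intro powr_mono') auto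
      finally have pw: "c * real K powr (- 1 / 4) \<le> p ^ w K" using p by (simp add: powr_realpow)
      have each: "(1 - pmf \<mu> l ^ w K) ^ q K \<le> exp (- (c * real K powr (- 1 / 4) * (real K powr 0.4 - 1)))"
        if l: "p \<le> pmf \<mu> l" for l
      proof -
        have "p ^ w K \<le> pmf \<mu> l ^ w K" using l p by (intro power_mono) auto
        then have le: "c * real K powr (- 1 / 4) \<le> pmf \<mu> l ^ w K" using pw by linarith
        have "1 - pmf \<mu> l ^ w K \<le> exp (- (pmf \<mu> l ^ w K))" using exp_ge_add_one_self[of "- (pmf \<mu> l ^ w K)"] by simp
        moreover have "0 \<le> 1 - pmf \<mu> l ^ w K" by (simp add: power_le_one pmf_le_1)
        ultimately have "(1 - pmf \<mu> l ^ w K) ^ q K \<le> exp (- (pmf \<mu> l ^ w K)) ^ q K" by (intro power_mono)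
        also have "\<dots> = exp (- (pmf \<mu> l ^ w K * real (q K)))" by (simp add: exp_of_nat_mult[symmetric] mult.commute)
        also have "\<dots> \<le> exp (- (c * real K powr (- 1 / 4) * (real K powr 0.4 - 1)))"
        proof -
          have "c * real K powr (- 1 / 4) * (real K powr 0.4 - 1) \<le> c * real K powr (- 1 / 4) * real (q K)"
            using q(2)[of K] c by (intro mult_left_mono) auto
          also have "\<dots> \<le> pmf \<mu> l ^ w K * real (q K)" using le by (intro mult_right_mono) auto
          finally show ?thesis by simp
        qed
        finally show ?thesis .
      qed
      have "measure RM {\<omega>. \<not> good K \<omega>} \<le> q K * (1 - pmf \<mu> l1 ^ w K) ^ q K + (1 - pmf \<mu> l2 ^ w K) ^ q K"
        unfolding good_def by (rule prob_no_double_run[OF w(3)[OF K] D small])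
      also have "\<dots> \<le> real (q K) * exp (- (c * real K powr (- 1 / 4) * (real K powr 0.4 - 1)))
          + exp (- (c * real K powr (- 1 / 4) * (real K powr 0.4 - 1)))"
        using each[OF p(2)] each[OF p(3)] by (intro add_mono mult_left_mono) auto
      also have "\<dots> \<le> bound K"
        unfolding bound_def using mult_right_mono[OF q(1)[of K], of "exp (- (c * real K powr (- 1 / 4) * (real K powr 0.4 - 1)))"]
        by (simp add: algebra_simps)
      finally show ?thesis .
    qed
    have "((\<lambda>x. (x powr 0.4) * (x powr 0.4 + D) * (\<beta> * ln x + w0 + 1) * G / x) \<longlongrightarrow> 0) at_top"
      using \<beta> by real_asymp
    then have "eventually (\<lambda>x. (x powr 0.4) * (x powr 0.4 + D) * (\<beta> * ln x + w0 + 1) * G / x < 2 * \<delta>) at_top"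
      using \<delta> by (intro order_tendstoD(2)) auto
    then have "eventually (\<lambda>K::nat. (real K powr 0.4) * (real K powr 0.4 + D) * (\<beta> * ln (real K) + w0 + 1) * G / real K < 2 * \<delta>) sequentially"
      by (rule eventually_compose_filterlim[OF _ filterlim_real_sequentially])
    then have ev_small: "eventually (\<lambda>K. real (q K * (q K + D) * w K) * G \<le> \<delta> * real (2 * K)) sequentially"
      using eventually_ge_at_top[of 1]
    proof eventually_elim
      case (elim K)
      have "real (q K * (q K + D) * w K) * G \<le> (real K powr 0.4) * (real K powr 0.4 + D) * (\<beta> * ln (real K) + w0 + 1) * G"
        unfolding of_nat_mult of_nat_add
        using q(1)[of K] w(2)[of K] elim G by (intro mult_right_mono mult_mono add_mono) auto
      also have "\<dots> \<le> 2 * \<delta> * real K" using elim by (simp add: divide_less_eq)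
      finally show ?case by simp
    qed
    have "(bound \<longlongrightarrow> 0) at_top" unfolding bound_def using c by real_asymp
    then have bound0: "(\<lambda>K::nat. bound (real K)) \<longlonglongrightarrow> 0"
      by (rule filterlim_compose[OF _ filterlim_real_sequentially])
    have good_sets: "{\<omega>. \<not> good K \<omega>} \<in> sets RM" for K
    proof -
      have [measurable]: "Measurable.pred RM (\<lambda>\<omega>. run (xpos J \<omega>) (w K) l2 \<omega>)"
        "(\<lambda>\<omega>. xpos J \<omega>) \<in> measurable RM (count_space UNIV)" for J
        using pred_run_at[OF measurable_xpos_at[of "\<lambda>_. J"]] measurable_xpos_at[of "\<lambda>_. J"] by simp_all
      show ?thesis unfolding good_def by (rule pred_sets) measurable
    qed
    have "AE \<omega> in RM. \<exists>K\<in>Ks. K0 \<le> K \<and> good K \<omega>" for K0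
    proof -
      define E where "E = (\<Inter>K\<in>{K\<in>Ks. K0 \<le> K}. {\<omega>. \<not> good K \<omega>})"
      have ne: "{K\<in>Ks. K0 \<le> K} \<noteq> {}" using inf unfolding infinite_nat_iff_unbounded_le by blast
      have E: "E \<in> sets RM" unfolding E_def using sets.top[of RM] good_sets by (intro sets.countable_INT'') auto
      have "measure RM E \<le> e" if "0 < e" for e
      proof -
        have "eventually (\<lambda>K. bound (real K) < e) sequentially" using bound0 that by (rule order_tendstoD(2))
        with ev_small have "eventually (\<lambda>K. bound (real K) < e \<and> real (q K * (q K + D) * w K) * G \<le> \<delta> * real (2 * K)) sequentially"
          by eventually_elim auto
        then obtain K1 where K1: "\<And>K. K1 \<le> K \<Longrightarrow> bound (real K) < e \<and> real (q K * (q K + D) * w K) * G \<le> \<delta> * real (2 * K)"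
          by (auto simp: eventually_sequentially)
        obtain K where K: "K \<in> Ks" "K0 + K1 + 1 \<le> K" using inf unfolding infinite_nat_iff_unbounded_le by blast
        have "measure RM E \<le> measure RM {\<omega>. \<not> good K \<omega>}"
          unfolding E_def using K good_sets by (intro R.finite_measure_mono) auto
        also have "\<dots> \<le> bound K" using K K1[of K] by (intro fail) auto
        finally show ?thesis using K1[of K] K by simp
      qed
      then have "measure RM E \<le> 0" by (rule field_le_epsilon[where y = 0, simplified])
      then have "measure RM E = 0" by (simp add: measure_le_0_iff)
      then have "E \<in> null_sets RM" using E by (auto simp: R.emeasure_eq_measure)
      then show ?thesis by (rule AE_I') (auto simp: E_def)
    qed
    then have "AE \<omega> in RM. \<forall>K0. \<exists>K\<in>Ks. K0 \<le> K \<and> good K \<omega>" by (simp add: AE_all_countable)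
    then have "AE \<omega> in RM. \<forall>K0. \<exists>K\<in>Ks. K0 + 1 \<le> K \<and> good K \<omega>" by eventually_elim blast
    then show "AE \<omega> in RM. \<forall>K0. \<exists>K\<in>Ks. K0 \<le> K \<and> (\<exists>J w. 2 * K \<le> J \<and> J \<le> 4 * K \<and>
      \<beta> * ln (real K) + w0 \<le> real w \<and> run J w l1 \<omega> \<and> run (xpos J \<omega>) w l2 \<omega> \<and> J + w \<le> xpos J \<omega>)"
    proof eventually_elim
      case (elim \<omega>)
      show ?case
      proof
        fix K0
        obtain K where K: "K \<in> Ks" "K0 + 1 \<le> K" "good K \<omega>" using elim by blast
        then show "\<exists>K\<in>Ks. K0 \<le> K \<and> (\<exists>J w. 2 * K \<le> J \<and> J \<le> 4 * K \<and>
          \<beta> * ln (real K) + w0 \<le> real w \<and> run J w l1 \<omega> \<and> run (xpos J \<omega>) w l2 \<omega> \<and> J + w \<le> xpos J \<omega>)"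
          using w(1)[of K] unfolding good_def by (intro bexI[of _ K]) auto
      qed
    qed
  qed
qed

end

end

section \<open>Large deviations in windows\<close>

text \<open>Monotonicity reduces the uncountably many \<open>\<epsilon>\<close> to the sequence
  \<open>1 / (k + 1)\<close>.\<close>

lemma AE_all_pos:
  assumes AE: "\<And>\<epsilon>::real. 0 < \<epsilon> \<Longrightarrow> AE \<omega> in M. P \<epsilon> \<omega>" and mono: "\<And>\<epsilon> \<epsilon>' \<omega>. \<epsilon> \<le> \<epsilon>' \<Longrightarrow> P \<epsilon> \<omega> \<Longrightarrow> P \<epsilon>' \<omega>"
  shows "AE \<omega> in M. \<forall>\<epsilon>>0. P \<epsilon> \<omega>"
proof -
  have "AE \<omega> in M. \<forall>k. P (1 / real (Suc k)) \<omega>" unfolding AE_all_countable using AE by simp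
  then show ?thesis
  proof eventually_elim
    case (elim \<omega>)
    show ?case
    proof (intro allI impI)
      fix \<epsilon> :: real assume "0 < \<epsilon>"
      then obtain k where "inverse (real (Suc k)) < \<epsilon>" using reals_Archimedean by blast
      then show "P \<epsilon> \<omega>" using elim mono[of "1 / real (Suc k)" \<epsilon> \<omega>] by (simp add: inverse_eq_divide)
    qed
  qed
qed

context
  fixes \<mu> :: "'l pmf" and f :: "'l \<Rightarrow> real"
  assumes fin: "finite (set_pmf \<mu>)" and mean: "(\<Sum>l\<in>set_pmf \<mu>. pmf \<mu> l * f l) = 0"
begin

interpretation sequence_space "measure_pmf \<mu>" by (rule sequence_space_pmf)

lemma window_deviation:
  assumes \<epsilon>: "0 < \<epsilon>"
  shows "\<exists>c>0. \<forall>j L. measure (realisation_measure \<mu>)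
    {\<omega>. \<epsilon> * real L < \<bar>\<Sum>i<L. f (\<omega> (j + i))\<bar>} \<le> 2 * exp (- c * real L)"
proof -
  let ?M = "realisation_measure \<mu>"
  interpret R: prob_space ?M by (rule prob_space_RM)
  have M: "?M = S" by (simp add: realisation_measure_def)
  \<comment> \<open>The summand 1 keeps \<open>B\<close> positive when \<open>f\<close> vanishes on
    the support.\<close>
  define B where "B = Max ((\<lambda>l. \<bar>f l\<bar>) ` set_pmf \<mu>) + 1"
  have B: "\<bar>f l\<bar> \<le> B" if "l \<in> set_pmf \<mu>" for l
  proof -
    have "\<bar>f l\<bar> \<le> Max ((\<lambda>l. \<bar>f l\<bar>) ` set_pmf \<mu>)" using that fin by (intro Max_ge) auto
    then show ?thesis by (simp add: B_def)
  qed
  obtain l0 where "l0 \<in> set_pmf \<mu>" using set_pmf_not_empty[of \<mu>] by blast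
  have "\<bar>f l0\<bar> \<le> Max ((\<lambda>l. \<bar>f l\<bar>) ` set_pmf \<mu>)"
    using fin \<open>l0 \<in> set_pmf \<mu>\<close> by (intro Max_ge) auto
  then have B0: "0 < B" by (simp add: B_def)
  \<comment> \<open>Hoeffding's exponent
    \<open>2 * (\<epsilon> * L)\<^sup>2 / (L * (2 * B)\<^sup>2)\<close> divided by
    \<open>L\<close>.\<close>
  define c where "c = \<epsilon>\<^sup>2 / (2 * B\<^sup>2)"
  have c: "0 < c" using \<epsilon> B0 by (simp add: c_def)
  have component: "distr ?M (measure_pmf \<mu>) (\<lambda>\<omega>. \<omega> i) = measure_pmf \<mu>" for i
    unfolding M by (rule PiM_component) simp
  have "measure ?M {\<omega>. \<epsilon> * real L < \<bar>\<Sum>i<L. f (\<omega> (j + i))\<bar>} \<le> 2 * exp (- c * real L)" for j L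
  proof (cases "L = 0")
    case True
    then show ?thesis using R.prob_le_1[of "{\<omega>. \<epsilon> * real L < \<bar>\<Sum>i<L. f (\<omega> (j + i))\<bar>}"] by simp
  next
    case False
    let ?I = "{j..<j + L}"
    have letters: "R.indep_vars (\<lambda>_. measure_pmf \<mu>) (\<lambda>i \<omega>. \<omega> i) ?I"
    proof (subst R.indep_vars_iff_distr_eq_PiM')
      show "?I \<noteq> {}" using False by simp
      show "(\<lambda>\<omega>. \<omega> i) \<in> measurable ?M (measure_pmf \<mu>)" for i by (rule measurable_letter)
      show "distr ?M (PiM ?I (\<lambda>_. measure_pmf \<mu>)) (\<lambda>x. \<lambda>i\<in>?I. x i) =
          PiM ?I (\<lambda>i. distr ?M (measure_pmf \<mu>) (\<lambda>\<omega>. \<omega> i))"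
        unfolding component unfolding M by (rule distr_PiM_restrict_finite) auto
    qed
    have indep: "R.indep_vars (\<lambda>_. borel) (\<lambda>i \<omega>. f (\<omega> i)) ?I"
      by (rule R.indep_vars_compose2[OF letters]) simp
    interpret H: Hoeffding_ineq ?M ?I "\<lambda>i \<omega>. f (\<omega> i)" "\<lambda>_. - B" "\<lambda>_. B"
      "\<Sum>i\<in>?I. R.expectation (\<lambda>\<omega>. f (\<omega> i))"
    proof unfold_locales
      fix i assume "i \<in> ?I"
      show "AE \<omega> in ?M. f (\<omega> i) \<in> {- B..B}"
        using AE_letter[of \<mu>]
      proof eventually_elim
        case (elim \<omega>)
        then have "\<bar>f (\<omega> i)\<bar> \<le> B" using B by blast
        then show ?case by (auto simp: abs_le_iff)
      qed
    qed (use indep in auto)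
    have exp0: "R.expectation (\<lambda>\<omega>. f (\<omega> i)) = 0" for i
    proof -
      have "R.expectation (\<lambda>\<omega>. f (\<omega> i)) = (\<integral>x. f x \<partial>distr ?M (measure_pmf \<mu>) (\<lambda>\<omega>. \<omega> i))"
        by (rule integral_distr[symmetric, OF measurable_letter]) simp
      also have "\<dots> = (\<Sum>l\<in>set_pmf \<mu>. f l * pmf \<mu> l)"
        unfolding component by (rule integral_measure_pmf_real[OF fin]) auto
      finally show ?thesis using mean by (simp add: mult.commute)
    qed
    have "(\<lambda>\<omega>. \<Sum>i\<in>?I. f (\<omega> i)) \<in> borel_measurable ?M"
      by (intro borel_measurable_sum borel_letter)
    then have meas: "{\<omega> \<in> space ?M. \<epsilon> * real L \<le> \<bar>(\<Sum>i\<in>?I. f (\<omega> i)) - (\<Sum>i\<in>?I. R.expectation (\<lambda>\<omega>. f (\<omega> i)))\<bar>} \<in> sets ?M"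
      by measurable
    have "{\<omega>. \<epsilon> * real L < \<bar>\<Sum>i<L. f (\<omega> (j + i))\<bar>} \<subseteq> {\<omega> \<in> space ?M. \<epsilon> * real L \<le> \<bar>(\<Sum>i\<in>?I. f (\<omega> i)) - (\<Sum>i\<in>?I. R.expectation (\<lambda>\<omega>. f (\<omega> i)))\<bar>}"
      using sum_window_shift[of "\<lambda>i. f (\<omega> i)" j L for \<omega>] by (auto simp: exp0)
    then have "measure ?M {\<omega>. \<epsilon> * real L < \<bar>\<Sum>i<L. f (\<omega> (j + i))\<bar>} \<le>
        measure ?M {\<omega> \<in> space ?M. \<epsilon> * real L \<le> \<bar>(\<Sum>i\<in>?I. f (\<omega> i)) - (\<Sum>i\<in>?I. R.expectation (\<lambda>\<omega>. f (\<omega> i)))\<bar>}"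
      by (rule R.finite_measure_mono[OF _ meas])
    also have "\<dots> \<le> 2 * exp (- 2 * (\<epsilon> * real L)\<^sup>2 / (\<Sum>i\<in>?I. (B - - B)\<^sup>2))"
      using \<epsilon> B0 False by (intro H.Hoeffding_ineq_abs_ge) (auto intro!: mult_pos_pos)
    also have "- 2 * (\<epsilon> * real L)\<^sup>2 / (\<Sum>i\<in>?I. (B - - B)\<^sup>2) = - c * real L"
      using False B0 by (simp add: c_def power2_eq_square field_simps)
    finally show ?thesis .
  qed
  then show ?thesis using c by blast
qed

lemma deviation_sets: "{\<omega>. \<epsilon> * real L < \<bar>\<Sum>i<L. f (\<omega> (j + i))\<bar>} \<in> sets (realisation_measure \<mu>)"
proof -
  have "(\<lambda>\<omega>. \<Sum>i<L. f (\<omega> (j + i))) \<in> borel_measurable (realisation_measure \<mu>)"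
    by (intro borel_measurable_sum borel_letter)
  then have "{\<omega> \<in> space (realisation_measure \<mu>). \<epsilon> * real L < \<bar>\<Sum>i<L. f (\<omega> (j + i))\<bar>} \<in> sets (realisation_measure \<mu>)"
    by measurable
  then show ?thesis by simp
qed

text \<open>Half of the exponent \<open>c * L\<close> is summed over the window lengths
  \<open>L\<close>; the other half is at least \<open>c / 2 * Lj j\<close> and is summed over the
  starting positions \<open>j\<close>. Borel--Cantelli thus applies to the union over all admissible
  lengths.\<close>

lemma AE_windows:
  assumes Lj: "\<And>c. 0 < c \<Longrightarrow> summable (\<lambda>j. exp (- c * Lj j))"
  shows "AE \<omega> in realisation_measure \<mu>. \<forall>\<epsilon>>0. \<exists>J. \<forall>j\<ge>J. \<forall>L. Lj j \<le> real L \<longrightarrow>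
    \<bar>\<Sum>i<L. f (\<omega> (j + i))\<bar> \<le> \<epsilon> * real L"
proof (rule AE_all_pos)
  let ?M = "realisation_measure \<mu>"
  interpret R: prob_space ?M by (rule prob_space_RM)
  fix \<epsilon> :: real assume "0 < \<epsilon>"
  then obtain c where c: "0 < c"
    and dev: "\<And>j L. measure ?M {\<omega>. \<epsilon> * real L < \<bar>\<Sum>i<L. f (\<omega> (j + i))\<bar>} \<le> 2 * exp (- c * real L)"
    using window_deviation by blast
  define X where "X j L = (if Lj j \<le> real L then {\<omega>. \<epsilon> * real L < \<bar>\<Sum>i<L. f (\<omega> (j + i))\<bar>} else {})" for j L
  have X: "X j L \<in> sets ?M" for j L unfolding X_def using deviation_sets by simp
  have geo: "summable (\<lambda>L. exp (- (c / 2)) ^ L)" using c by (intro summable_geometric) simp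
  have le: "measure ?M (X j L) \<le> 2 * exp (- (c / 2) * Lj j) * exp (- (c / 2)) ^ L" for j L
  proof (cases "Lj j \<le> real L")
    case True
    have "measure ?M (X j L) \<le> 2 * exp (- c * real L)" using dev True by (simp add: X_def)
    also have "- c * real L \<le> - (c / 2) * Lj j + real L * (- (c / 2))"
      using mult_left_mono[OF True, of c] c by (simp add: algebra_simps)
    then have "2 * exp (- c * real L) \<le> 2 * exp (- (c / 2) * Lj j + real L * (- (c / 2)))" by simp
    also have "\<dots> = 2 * exp (- (c / 2) * Lj j) * exp (- (c / 2)) ^ L"
      by (simp only: exp_add exp_of_nat_mult mult.assoc)
    finally show ?thesis .
  qed (simp add: X_def)
  have sumX: "summable (\<lambda>L. measure ?M (X j L))" for j
    by (rule summable_comparison_test'[OF summable_mult[OF geo], of 0]) (use le in auto)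
  have "measure ?M (\<Union>L. X j L) \<le> 2 * (\<Sum>L. exp (- (c / 2)) ^ L) * exp (- (c / 2) * Lj j)" for j
  proof -
    have "measure ?M (\<Union>L. X j L) \<le> (\<Sum>L. measure ?M (X j L))"
      using X sumX by (intro R.finite_measure_subadditive_countably) auto
    also have "\<dots> \<le> (\<Sum>L. 2 * exp (- (c / 2) * Lj j) * exp (- (c / 2)) ^ L)"
      by (intro suminf_le le sumX summable_mult geo)
    also have "\<dots> = 2 * exp (- (c / 2) * Lj j) * (\<Sum>L. exp (- (c / 2)) ^ L)"
      by (rule suminf_mult[OF geo])
    finally show ?thesis by (simp add: mult_ac)
  qed
  then have "summable (\<lambda>j. measure ?M (\<Union>L. X j L))"
    using c by (intro summable_comparison_test'[OF summable_mult[OF Lj[of "c / 2"]], of 0]) auto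
  moreover have "(\<Union>L. X j L) \<in> sets ?M" for j using X by blast
  ultimately have "AE \<omega> in ?M. eventually (\<lambda>j. \<omega> \<in> space ?M - (\<Union>L. X j L)) sequentially"
    by (intro borel_cantelli_AE1) (auto simp: less_top[symmetric])
  then show "AE \<omega> in ?M. \<exists>J. \<forall>j\<ge>J. \<forall>L. Lj j \<le> real L \<longrightarrow> \<bar>\<Sum>i<L. f (\<omega> (j + i))\<bar> \<le> \<epsilon> * real L"
    by eventually_elim (force simp: eventually_sequentially X_def not_less)
next
  fix \<epsilon> \<epsilon>' :: real and \<omega>
  assume "\<epsilon> \<le> \<epsilon>'" "\<exists>J. \<forall>j\<ge>J. \<forall>L. Lj j \<le> real L \<longrightarrow> \<bar>\<Sum>i<L. f (\<omega> (j + i))\<bar> \<le> \<epsilon> * real L"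
  then show "\<exists>J. \<forall>j\<ge>J. \<forall>L. Lj j \<le> real L \<longrightarrow> \<bar>\<Sum>i<L. f (\<omega> (j + i))\<bar> \<le> \<epsilon>' * real L"
    by (meson mult_right_mono of_nat_0_le_iff order_trans)
qed

text \<open>The strong law, from the same deviation bound for windows starting at 0.\<close>

lemma AE_lln_zero: "AE \<omega> in realisation_measure \<mu>. (\<lambda>L. (\<Sum>i<L. f (\<omega> i)) / real L) \<longlonglongrightarrow> 0"
proof -
  let ?M = "realisation_measure \<mu>"
  interpret R: prob_space ?M by (rule prob_space_RM)
  have "AE \<omega> in ?M. \<forall>\<epsilon>>0. \<exists>J. \<forall>L\<ge>J. \<bar>\<Sum>i<L. f (\<omega> i)\<bar> \<le> \<epsilon> * real L"
  proof (rule AE_all_pos)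
    fix \<epsilon> :: real assume "0 < \<epsilon>"
    then obtain c where c: "0 < c"
      and dev: "\<And>j L. measure ?M {\<omega>. \<epsilon> * real L < \<bar>\<Sum>i<L. f (\<omega> (j + i))\<bar>} \<le> 2 * exp (- c * real L)"
      using window_deviation by blast
    have "summable (\<lambda>L. exp (- c) ^ L)" using c by (intro summable_geometric) simp
    then have geo: "summable (\<lambda>L. 2 * exp (- c * real L))"
      by (intro summable_mult) (simp add: exp_of_nat_mult[symmetric] mult.commute)
    have "summable (\<lambda>L. measure ?M {\<omega>. \<epsilon> * real L < \<bar>\<Sum>i<L. f (\<omega> i)\<bar>})"
      by (rule summable_comparison_test'[OF geo, of 0]) (use dev[of _ 0] in simp)
    then have "AE \<omega> in ?M. eventually (\<lambda>L. \<omega> \<in> space ?M - {\<omega>. \<epsilon> * real L < \<bar>\<Sum>i<L. f (\<omega> i)\<bar>}) sequentially"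
      using deviation_sets[of \<epsilon> _ 0] by (intro borel_cantelli_AE1) (auto simp: less_top[symmetric])
    then show "AE \<omega> in ?M. \<exists>J. \<forall>L\<ge>J. \<bar>\<Sum>i<L. f (\<omega> i)\<bar> \<le> \<epsilon> * real L"
      by eventually_elim (auto simp: eventually_sequentially not_less)
  next
    fix \<epsilon> \<epsilon>' :: real and \<omega>
    assume "\<epsilon> \<le> \<epsilon>'" "\<exists>J. \<forall>L\<ge>J. \<bar>\<Sum>i<L. f (\<omega> i)\<bar> \<le> \<epsilon> * real L"
    then show "\<exists>J. \<forall>L\<ge>J. \<bar>\<Sum>i<L. f (\<omega> i)\<bar> \<le> \<epsilon>' * real L"
      by (meson mult_right_mono of_nat_0_le_iff order_trans)
  qed
  then show ?thesis
  proof eventually_elim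
    case (elim \<omega>)
    show ?case
    proof (rule LIMSEQ_I)
      fix r :: real assume "0 < r"
      then obtain J where J: "\<And>L. J \<le> L \<Longrightarrow> \<bar>\<Sum>i<L. f (\<omega> i)\<bar> \<le> r / 2 * real L"
        using elim[rule_format, of "r / 2"] by auto
      have "norm ((\<Sum>i<L. f (\<omega> i)) / real L - 0) < r" if "J + 1 \<le> L" for L
      proof -
        have "\<bar>\<Sum>i<L. f (\<omega> i)\<bar> / real L \<le> r / 2" using J[of L] that by (simp add: divide_le_eq)
        then show ?thesis
          using \<open>0 < r\<close> unfolding real_norm_def diff_zero abs_divide abs_of_nat by linarith
      qed
      then show "\<exists>no. \<forall>L\<ge>no. norm ((\<Sum>i<L. f (\<omega> i)) / real L - 0) < r" by blast
    qed
  qed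
qed

end

lemma AE_lln:
  assumes fin: "finite (set_pmf \<mu>)"
  shows "AE \<omega> in realisation_measure \<mu>. (\<lambda>L. (\<Sum>i<L. f (\<omega> i)) / real L) \<longlonglongrightarrow> (\<Sum>l\<in>set_pmf \<mu>. pmf \<mu> l * f l)"
proof -
  define c where "c = (\<Sum>l\<in>set_pmf \<mu>. pmf \<mu> l * f l)"
  have "(\<Sum>l\<in>set_pmf \<mu>. pmf \<mu> l * (f l - c)) = 0"
    using sum_pmf_eq_1[OF fin order_refl] by (simp add: right_diff_distrib sum_subtractf sum_distrib_right[symmetric] c_def)
  from AE_lln_zero[OF fin this] show ?thesis
  proof eventually_elim
    case (elim \<omega>)
    have "(\<lambda>L. (\<Sum>i<L. f (\<omega> i) - c) / real L + c) \<longlonglongrightarrow> 0 + c" using elim by (intro tendsto_add tendsto_const)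
    moreover have "eventually (\<lambda>L. (\<Sum>i<L. f (\<omega> i) - c) / real L + c = (\<Sum>i<L. f (\<omega> i)) / real L) sequentially"
      using eventually_gt_at_top[of 0] by eventually_elim (simp add: sum_subtractf diff_divide_distrib)
    ultimately show ?case unfolding c_def[symmetric] by (simp add: filterlim_cong)
  qed
qed

lemma gauge_exp: "gauge_of \<psi> (exp (- real k)) = \<psi> (exp (- real k)) * real k"
  by (simp add: gauge_of_def)

text \<open>Each term is repeated twice. This passes from the scales \<open>exp (- k)\<close> of the
  series to the scales \<open>exp (- j / 2)\<close> of \<open>window_average\<close>.\<close>

lemma summable_div2:
  fixes h :: "nat \<Rightarrow> real"
  assumes h: "summable h" "\<And>k. 0 \<le> h k"
  shows "summable (\<lambda>j. h (j div 2))"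
proof (rule summableI_nonneg_bounded)
  fix n
  have pair: "(\<Sum>j<2 * n. h (j div 2)) = 2 * (\<Sum>k<n. h k)" for n by (induction n) auto
  have "(\<Sum>j<n. h (j div 2)) \<le> (\<Sum>j<2 * n. h (j div 2))" using h by (intro sum_mono2) auto
  also have "\<dots> \<le> 2 * suminf h" unfolding pair using sum_le_suminf[OF h(1), of "{..<n}"] h(2) by simp
  finally show "(\<Sum>j<n. h (j div 2)) \<le> 2 * suminf h" .
qed (use h in auto)

text \<open>Convergence forces \<open>a k\<close> to infinity, domination passes this on to
  \<open>b k\<close>, and of the two monotone alternatives for the gauge only the decreasing one
  remains. As \<open>a k \<le> c * b k\<close> eventually for every \<open>c > 0\<close>, the series
  of \<open>exp (- c * b k)\<close> converges for every such \<open>c\<close>.\<close>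

lemma gauge_of_dominating:
  assumes \<phi>: "dimension_function \<phi>" and \<psi>: "dimension_function \<psi>"
    and sum: "summable (\<lambda>k. exp (- (\<phi> (exp (- real (Suc k))) * real (Suc k))))"
    and dom: "((\<lambda>x. \<phi> x / \<psi> x) \<longlongrightarrow> 0) (at_right 0)"
  shows "antimono_on {0<..<1} (gauge_of \<psi>)" "filterlim (gauge_of \<psi>) at_top (at_right 0)"
    "0 < c \<Longrightarrow> summable (\<lambda>j. exp (- c * gauge_of \<psi> (exp (- (real j / 2)))))"
proof -
  define a where "a k = \<phi> (exp (- real (Suc k))) * real (Suc k)" for k
  define b where "b k = gauge_of \<psi> (exp (- real (Suc k)))" for k
  have b: "b k = \<psi> (exp (- real (Suc k))) * real (Suc k)" for k unfolding b_def by (rule gauge_exp)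
  have unit: "exp (- real (Suc k)) \<in> {0<..<1}" for k by simp
  have \<psi>0: "0 < \<psi> x" if "x \<in> {0<..<1}" for x using \<psi> that by (auto simp: dimension_function_def)
  have seq: "filterlim (\<lambda>k. exp (- real (Suc k))) (at_right 0) sequentially" by real_asymp
  have ab: "eventually (\<lambda>k. a k \<le> e * b k) sequentially" if "0 < e" for e
  proof -
    have "eventually (\<lambda>x. \<phi> x / \<psi> x < e) (at_right 0)" using dom that by (rule order_tendstoD(2))
    then have "eventually (\<lambda>k. \<phi> (exp (- real (Suc k))) / \<psi> (exp (- real (Suc k))) < e) sequentially"
      by (rule eventually_compose_filterlim[OF _ seq])
    then show ?thesis
    proof eventually_elim
      case (elim k)
      then have "\<phi> (exp (- real (Suc k))) \<le> e * \<psi> (exp (- real (Suc k)))"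
        using \<psi>0[OF unit[of k]] by (simp add: divide_less_eq)
      from mult_right_mono[OF this, of "real (Suc k)"] show ?case unfolding a_def b by (simp only: mult.assoc)
    qed
  qed
  have "(\<lambda>k. exp (- a k)) \<longlonglongrightarrow> 0" using summable_LIMSEQ_zero[OF sum] by (simp add: a_def)
  have b_large: "eventually (\<lambda>k. M \<le> b k) sequentially" for M
  proof -
    have "eventually (\<lambda>k. exp (- a k) < exp (- M)) sequentially"
      using \<open>(\<lambda>k. exp (- a k)) \<longlonglongrightarrow> 0\<close> by (intro order_tendstoD(2)) auto
    with ab[of 1, OF zero_less_one] show ?thesis by eventually_elim auto
  qed
  have "\<not> mono_on {0<..<1} (gauge_of \<psi>)"
  proof
    assume m: "mono_on {0<..<1} (gauge_of \<psi>)"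
    have "b k \<le> b 0" for k unfolding b_def by (rule mono_onD[OF m unit unit]) simp
    moreover obtain k where "b 0 + 1 \<le> b k" using eventually_happens[OF b_large[of "b 0 + 1"]] by auto
    ultimately show False by (metis add_le_same_cancel1 not_one_le_zero order_trans)
  qed
  then show anti: "antimono_on {0<..<1} (gauge_of \<psi>)"
    using \<psi> unfolding dimension_function_def monotone_on_unit_def gauge_of_def by blast
  show "filterlim (gauge_of \<psi>) at_top (at_right 0)"
    unfolding filterlim_at_top
  proof
    fix M
    obtain k where k: "M \<le> b k" using eventually_happens[OF b_large[of M]] by auto
    show "eventually (\<lambda>x. M \<le> gauge_of \<psi> x) (at_right 0)"
      unfolding eventually_at_right_field
    proof (intro exI[of _ "exp (- real (Suc k))"] conjI allI impI)
      fix x :: real assume x: "0 < x" "x < exp (- real (Suc k))"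
      then have "x \<in> {0<..<1}"
        using unit[of k] unfolding greaterThanLessThan_iff by linarith
      then have "b k \<le> gauge_of \<psi> x" unfolding b_def using anti unit[of k] x by (auto simp: monotone_on_def)
      then show "M \<le> gauge_of \<psi> x" using k by linarith
    qed simp
  qed
  assume c: "0 < c"
  have "eventually (\<lambda>k. norm (exp (- c * b k)) \<le> exp (- a k)) sequentially"
    using ab[OF c] by eventually_elim simp
  then have "summable (\<lambda>k. exp (- c * b k))"
    by (rule summable_comparison_test_ev) (use sum in \<open>simp add: a_def\<close>)
  then have "summable (\<lambda>j. exp (- c * b (j div 2)))" by (rule summable_div2) simp
  \<comment> \<open>The shift by 2 puts the argument inside the open unit interval and gives
    \<open>Suc (j div 2) \<le> (j + 2) / 2\<close>, which allows the comparison with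
    \<open>b (j div 2)\<close>.\<close>
  then have "summable (\<lambda>j. exp (- c * gauge_of \<psi> (exp (- (real (j + 2) / 2)))))"
  proof (rule summable_comparison_test'[where N = 0])
    fix j :: nat
    have "2 * Suc (j div 2) \<le> j + 2" by simp
    then have "real (2 * Suc (j div 2)) \<le> real (j + 2)" by (simp only: of_nat_le_iff)
    then have "real (Suc (j div 2)) \<le> real (j + 2) / 2" unfolding of_nat_mult of_nat_numeral by argo
    then have "exp (- (real (j + 2) / 2)) \<le> exp (- real (Suc (j div 2)))"
      unfolding exp_le_cancel_iff neg_le_iff_le .
    moreover have "exp (- (real (j + 2) / 2)) \<in> {0<..<1}" by simp
    ultimately have "b (j div 2) \<le> gauge_of \<psi> (exp (- (real (j + 2) / 2)))"
      unfolding b_def using anti unit[of "j div 2"] by (auto simp: monotone_on_def)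
    then show "norm (exp (- c * gauge_of \<psi> (exp (- (real (j + 2) / 2))))) \<le> exp (- c * b (j div 2))"
      using c by simp
  qed
  then show "summable (\<lambda>j. exp (- c * gauge_of \<psi> (exp (- (real j / 2)))))"
    by (rule summable_iff_shift[THEN iffD1, of _ 2])
qed

text \<open>A non-increasing \<open>\<phi>\<close> would be at least
  \<open>\<phi> (exp (- 1))\<close> along the series, which would be dominated by a geometric one.
  If the inequality held for finitely many \<open>K\<close> only, the terms would eventually be at
  most the inverse squares.\<close>

lemma divergent_dimension_function:
  assumes \<phi>: "dimension_function \<phi>"
    and div: "\<not> summable (\<lambda>k. exp (- (\<phi> (exp (- real (Suc k))) * real (Suc k))))"
  shows "mono_on {0<..<1} \<phi>" "infinite {K. \<phi> (exp (- real K)) * real K \<le> 2 * ln (real K)}"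
proof -
  have unit: "exp (- real (Suc k)) \<in> {0<..<1}" for k by simp
  have "\<not> antimono_on {0<..<1} \<phi>"
  proof
    assume m: "antimono_on {0<..<1} \<phi>"
    define c where "c = \<phi> (exp (- real (Suc 0)))"
    have c: "0 < c" using \<phi> unit[of 0] by (simp add: dimension_function_def c_def)
    have "c \<le> \<phi> (exp (- real (Suc k)))" for k
      unfolding c_def by (rule monotone_onD[OF m unit unit]) simp
    then have le: "c * real (Suc k) \<le> \<phi> (exp (- real (Suc k))) * real (Suc k)" for k by (intro mult_right_mono) auto
    have "summable (\<lambda>k. exp (- c) ^ k)" using c by (intro summable_geometric) simp
    then have "summable (\<lambda>k. exp (- c) ^ Suc k)" by (subst summable_Suc_iff)
    then have "summable (\<lambda>k. exp (- (\<phi> (exp (- real (Suc k))) * real (Suc k))))"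
    proof (rule summable_comparison_test'[where N = 0])
      fix k
      show "norm (exp (- (\<phi> (exp (- real (Suc k))) * real (Suc k)))) \<le> exp (- c) ^ Suc k"
        using le[of k] unfolding exp_of_nat_mult[symmetric] by (simp add: mult.commute)
    qed
    then show False using div by blast
  qed
  then show "mono_on {0<..<1} \<phi>"
    using \<phi> unfolding dimension_function_def monotone_on_unit_def by blast
  show "infinite {K. \<phi> (exp (- real K)) * real K \<le> 2 * ln (real K)}"
  proof
    assume "finite {K. \<phi> (exp (- real K)) * real K \<le> 2 * ln (real K)}"
    then obtain K0 where K0: "\<And>K. \<phi> (exp (- real K)) * real K \<le> 2 * ln (real K) \<Longrightarrow> K \<le> K0"
      unfolding finite_nat_set_iff_bounded_le by blast
    have "summable (\<lambda>k. inverse (real (Suc k)) ^ 2)"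
      using inverse_power_summable[of 2, where 'a = real] unfolding summable_Suc_iff[of "\<lambda>k. inverse (real k) ^ 2"]
      by (simp add: power_inverse)
    then have "summable (\<lambda>k. exp (- (\<phi> (exp (- real (Suc k))) * real (Suc k))))"
    proof (rule summable_comparison_test'[where N = K0])
      fix k assume "K0 \<le> k"
      then have "2 * ln (real (Suc k)) \<le> \<phi> (exp (- real (Suc k))) * real (Suc k)"
        using K0[of "Suc k"] by linarith
      then have "exp (- (\<phi> (exp (- real (Suc k))) * real (Suc k))) \<le> exp (- (2 * ln (real (Suc k))))" by simp
      also have "\<dots> = inverse (real (Suc k)) ^ 2"
        by (simp add: exp_minus exp_double power_inverse del: of_nat_Suc)
      finally show "norm (exp (- (\<phi> (exp (- real (Suc k))) * real (Suc k)))) \<le> inverse (real (Suc k)) ^ 2" by simp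
    qed
    then show False using div by blast
  qed
qed

section \<open>Almost sure statements\<close>

context random_bm_carpet
begin

definition mean_of :: "('l \<Rightarrow> real) \<Rightarrow> real" where
  "mean_of f = (\<Sum>l\<in>\<Lambda>. pmf \<mu> l * f l)"

text \<open>The typical exponents log C / log n and, for columns, log B / log m, all in terms of
  geometric means.\<close>

definition "typical_rows = mean_of (\<lambda>l. ln (real (maxrows l))) / mean_of (\<lambda>l. ln (real (n l)))"
definition "typical_cols = mean_of (\<lambda>l. ln (real (ncols l))) / mean_of (\<lambda>l. ln (real (m l)))"

lemma ln_geometric_mean: "ln (geometric_mean \<Lambda> \<mu> f) = mean_of (\<lambda>l. ln (real (f l)))"
  by (simp add: geometric_mean_def mean_of_def)

lemma finite_support: "finite (set_pmf \<mu>)"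
  using finite_index support by simp

lemma pmf_pos: "l \<in> \<Lambda> \<Longrightarrow> 0 < pmf \<mu> l"
  using support by (auto simp: pmf_positive)

lemma mean_pos: "(\<And>l. l \<in> \<Lambda> \<Longrightarrow> 0 < f l) \<Longrightarrow> 0 < mean_of f"
  unfolding mean_of_def using finite_index index_nonempty pmf_pos by (intro sum_pos) auto

lemma mean_nonneg: "(\<And>l. l \<in> \<Lambda> \<Longrightarrow> 0 \<le> f l) \<Longrightarrow> 0 \<le> mean_of f"
  unfolding mean_of_def using pmf_pos by (intro sum_nonneg mult_nonneg_nonneg) auto

lemma mean_ln_m_pos: "0 < mean_of (\<lambda>l. ln (real (m l)))"
  by (rule mean_pos) (use subdivisions in force)

lemma mean_ln_m_less: "mean_of (\<lambda>l. ln (real (m l))) < mean_of (\<lambda>l. ln (real (n l)))"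
  unfolding mean_of_def using finite_index index_nonempty pmf_pos ln_m_less_ln_n by (intro sum_strict_mono) auto

lemma typical_nonneg: "0 \<le> typical_rows" "0 \<le> typical_cols"
  unfolding typical_rows_def typical_cols_def
  using mean_ln_m_pos mean_ln_m_less maxrows_pos ncols_pos by (auto intro!: divide_nonneg_pos mean_nonneg)

lemma typical_centred:
  "mean_of (\<lambda>l. ln (real (maxrows l)) - typical_rows * ln (real (n l))) = 0"
  "mean_of (\<lambda>l. ln (real (ncols l)) - typical_cols * ln (real (m l))) = 0"
proof -
  have lin: "mean_of (\<lambda>l. f l - c * g l) = mean_of f - c * mean_of g" for f g c
    by (simp add: mean_of_def right_diff_distrib sum_subtractf sum_distrib_left mult_ac)
  show "mean_of (\<lambda>l. ln (real (maxrows l)) - typical_rows * ln (real (n l))) = 0"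
    "mean_of (\<lambda>l. ln (real (ncols l)) - typical_cols * ln (real (m l))) = 0"
    unfolding lin typical_rows_def typical_cols_def using mean_ln_m_pos mean_ln_m_less by simp_all
qed

lemma realisation: "AE \<omega> in realisation_measure \<mu>. carpet_realisation \<Lambda> \<mu> m n N a b \<omega>"
  using AE_letter[of \<mu>]
  by eventually_elim
    (auto simp: carpet_realisation_def carpet_realisation_axioms_def support random_bm_carpet_axioms)

text \<open>Both sides are computed on one event of full measure and equal
  \<open>typical_rows + typical_cols\<close>; the value of the quasi-Assouad dimension is derived on
  the way.\<close>

lemma spectrum_eq_quasi_assouad:
  assumes \<phi>: "dimension_function \<phi>" and \<psi>: "dimension_function \<psi>"
    and sum: "summable (\<lambda>k. exp (- (\<phi> (exp (- real (Suc k))) * real (Suc k))))"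
    and dom: "((\<lambda>x. \<phi> x / \<psi> x) \<longlongrightarrow> 0) (at_right 0)"
    and le: "\<forall>\<^sub>F x in at_right 0. \<psi> x \<le> ln (geometric_mean \<Lambda> \<mu> n) / ln (geometric_mean \<Lambda> \<mu> m) - 1"
  shows "AE \<omega> in realisation_measure \<mu>.
    gen_assouad_spectrum \<psi> (carpet m n N a b \<omega>) = quasi_assouad_dim (carpet m n N a b \<omega>)"
proof -
  let ?X = "\<lambda>l. ln (real (maxrows l)) - typical_rows * ln (real (n l))"
  let ?Y = "\<lambda>l. ln (real (ncols l)) - typical_cols * ln (real (m l))"
  define Lj where "Lj j = gauge_of \<psi> (exp (- (real j / 2))) / (2 * log_max)" for j :: nat
  note gauge = gauge_of_dominating[OF \<phi> \<psi> sum dom]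
  have Lj: "summable (\<lambda>j. exp (- c * Lj j))" if "0 < c" for c
    using gauge(3)[of "c / (2 * log_max)"] that log_max_pos by (simp add: Lj_def)
  have X0: "(\<Sum>l\<in>set_pmf \<mu>. pmf \<mu> l * ?X l) = 0" and Y0: "(\<Sum>l\<in>set_pmf \<mu>. pmf \<mu> l * ?Y l) = 0"
    using typical_centred unfolding mean_of_def support by blast+
  have \<psi>0: "0 < \<psi> x" if "0 < x" "x < 1" for x using \<psi> that by (auto simp: dimension_function_def)
  have windows: "AE \<omega> in realisation_measure \<mu>. \<forall>\<epsilon>>0. \<exists>J. \<forall>j\<ge>J. \<forall>L. Lj j \<le> real L \<longrightarrow>
      \<bar>\<Sum>i<L. f (\<omega> (j + i))\<bar> \<le> \<epsilon> * real L" if "(\<Sum>l\<in>set_pmf \<mu>. pmf \<mu> l * f l) = 0" for f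
    by (rule AE_windows[OF finite_support that]) (rule Lj)
  show ?thesis
    using realisation windows[OF X0] windows[OF Y0]
      AE_lln_zero[OF finite_support X0] AE_lln_zero[OF finite_support Y0]
      AE_lln[OF finite_support, of "\<lambda>l. ln (real (n l))"] AE_lln[OF finite_support, of "\<lambda>l. ln (real (m l))"]
  proof eventually_elim
    case (elim \<omega>)
    interpret carpet_realisation \<Lambda> \<mu> m n N a b \<omega> by (rule elim(1))
    have ln: "(\<lambda>L. (\<Sum>i<L. lnn i) / L) \<longlonglongrightarrow> mean_of (\<lambda>l. ln (real (n l)))"
      "(\<lambda>L. (\<Sum>i<L. lnm i) / L) \<longlonglongrightarrow> mean_of (\<lambda>l. ln (real (m l)))"
      using elim(6,7) by (simp_all add: mean_of_def support)
    note base = ln mean_ln_m_pos mean_ln_m_less typical_nonneg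
    have "gen_assouad_spectrum \<psi> (carpet m n N a b \<omega>) = ereal (typical_rows + typical_cols)"
    proof (rule spectrum_eq_of_windows[OF base \<psi>0 gauge(1,2)])
      show "\<forall>\<^sub>F R in at_right 0. \<psi> R \<le> mean_of (\<lambda>l. ln (real (n l))) / mean_of (\<lambda>l. ln (real (m l))) - 1"
        using le unfolding ln_geometric_mean .
    qed (use elim(2,3) in \<open>auto simp: Lj_def\<close>)
    moreover have "quasi_assouad_dim (carpet m n N a b \<omega>) = ereal (typical_rows + typical_cols)"
      by (rule quasi_assouad_dim_eq[OF base elim(4,5)])
    ultimately show ?case by simp
  qed
qed

text \<open>The almost sure event involves only \<open>\<phi>\<close> and so serves all
  \<open>\<psi>\<close> at once. On it \<open>spectrum_ge_of_runs\<close>,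
  \<open>gen_assouad_spectrum_le_assouad_dim\<close> and \<open>assouad_dim_le\<close> close a cycle
  of inequalities.\<close>

lemma spectrum_eq_assouad:
  assumes \<phi>: "dimension_function \<phi>"
    and div: "\<not> summable (\<lambda>k. exp (- (\<phi> (exp (- real (Suc k))) * real (Suc k))))"
  shows "\<exists>C>0. AE \<omega> in realisation_measure \<mu>. \<forall>\<psi>. dimension_function \<psi> \<longrightarrow>
    (\<forall>x\<in>{0<..<1}. \<psi> x \<le> C * \<phi> x) \<longrightarrow> filterlim (gauge_of \<psi>) at_top (at_right 0) \<longrightarrow>
    gen_assouad_spectrum \<psi> (carpet m n N a b \<omega>) = assouad_dim (carpet m n N a b \<omega>)"
proof -
  obtain l1 where l1: "l1 \<in> \<Lambda>" "ln (real (maxrows l1)) = rows_ratio * ln (real (n l1))"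
    using ratio_attained(1) by blast
  obtain l2 where l2: "l2 \<in> \<Lambda>" "ln (real (ncols l2)) = cols_ratio * ln (real (m l2))"
    using ratio_attained(2) by blast
  \<comment> \<open>The values \<open>ln 3\<close> and \<open>ln 2\<close> outside
    \<open>\<Lambda>\<close> keep the uniform bounds valid for all letters;
    \<open>ln 3 \<le> log_max\<close> since each \<open>n l\<close> is at least 3.\<close>
  define gn where "gn l = (if l \<in> \<Lambda> then ln (real (n l)) else ln 3)" for l
  define gm where "gm l = (if l \<in> \<Lambda> then ln (real (m l)) else ln 2)" for l
  define \<delta> where "\<delta> = Min (insert (ln 3 - ln 2) ((\<lambda>l. ln (real (n l)) - ln (real (m l))) ` \<Lambda>))"
  have gm: "ln 2 \<le> gm l" for l using ln_m_ge by (simp add: gm_def)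
  have "\<delta> \<le> gn l - gm l" for l
    unfolding \<delta>_def using finite_index by (intro Min_le) (auto simp: gn_def gm_def)
  then have gap: "gm l + \<delta> \<le> gn l" for l by (simp add: algebra_simps)
  have "ln 3 \<le> ln (real (n l1))" using subdivisions[OF l1(1)] by simp
  then have gn: "gn l \<le> log_max" for l
    using ln_n_le_log_max[of l] ln_n_le_log_max[OF l1(1)] by (auto simp: gn_def)
  have \<delta>: "0 < \<delta>" unfolding \<delta>_def using finite_index ln_m_less_ln_n by (subst Min_gr_iff) auto
  let ?xpos = "xpos gn gm"
  obtain \<beta> where \<beta>: "0 < \<beta>" and runs: "\<And>w0 Ks. 1 \<le> w0 \<Longrightarrow> infinite Ks \<Longrightarrow>
    AE \<omega> in realisation_measure \<mu>. \<forall>K0. \<exists>K\<in>Ks. K0 \<le> K \<and>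
      (\<exists>J w. 2 * K \<le> J \<and> J \<le> 4 * K \<and> \<beta> * ln (real K) + w0 \<le> real w \<and>
        run J w l1 \<omega> \<and> run (?xpos J \<omega>) w l2 \<omega> \<and> J + w \<le> ?xpos J \<omega>)"
    using AE_double_run[of gm \<delta> gn log_max l1 \<mu> l2, OF gm gap gn \<delta>] l1(1) l2(1) support by blast
  \<comment> \<open>Chosen so that \<open>8 * C * log_max = ln 2 * \<beta>\<close>, where 8 combines
    \<open>t \<le> 4 * log_max * K\<close> with the factor 2 in \<open>2 * ln K\<close>;
    \<open>w0\<close> then absorbs the additive \<open>log_max\<close>.\<close>
  define C where "C = ln 2 * \<beta> / (8 * log_max)"
  define w0 where "w0 = max 1 (log_max / ln 2)"
  have C: "0 < C" using \<beta> log_max_pos by (simp add: C_def)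
  note dv = divergent_dimension_function[OF \<phi> div]
  have w0: "1 \<le> w0" "log_max \<le> ln 2 * w0"
  proof -
    show "1 \<le> w0" by (simp add: w0_def)
    have "log_max = ln 2 * (log_max / ln 2)" by simp
    also have "\<dots> \<le> ln 2 * w0" by (intro mult_left_mono) (auto simp: w0_def)
    finally show "log_max \<le> ln 2 * w0" .
  qed
  have "AE \<omega> in realisation_measure \<mu>. \<forall>\<psi>. dimension_function \<psi> \<longrightarrow>
    (\<forall>x\<in>{0<..<1}. \<psi> x \<le> C * \<phi> x) \<longrightarrow> filterlim (gauge_of \<psi>) at_top (at_right 0) \<longrightarrow>
    gen_assouad_spectrum \<psi> (carpet m n N a b \<omega>) = assouad_dim (carpet m n N a b \<omega>)"
    using realisation runs[OF w0(1) dv(2)]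
  proof eventually_elim
    case (elim \<omega>)
    interpret carpet_realisation \<Lambda> \<mu> m n N a b \<omega> by (rule elim(1))
    have g: "gn (\<omega> j) = lnn j" "gm (\<omega> j) = lnm j" for j using letters by (simp_all add: gn_def gm_def)
    have xpos_eq: "?xpos J \<omega> = xlevel (\<Sum>j<J. lnn j)" for J
      unfolding xpos_def[OF gm gap gn \<delta>] g ..
    show ?case
    proof (intro allI impI)
      fix \<psi> assume \<psi>: "dimension_function \<psi>" and le: "\<forall>x\<in>{0<..<1}. \<psi> x \<le> C * \<phi> x"
        and top: "filterlim (gauge_of \<psi>) at_top (at_right 0)"
      have \<psi>0: "0 < \<psi> x" if "0 < x" "x < 1" for x using \<psi> that by (auto simp: dimension_function_def)
      have "ereal (rows_ratio + cols_ratio) \<le> gen_assouad_spectrum \<psi> (carpet m n N a b \<omega>)"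
      proof (rule spectrum_ge_of_runs[OF l1 l2 \<psi>0 top])
        fix t0 :: real
        \<comment> \<open>With \<open>6 \<le> K\<close> the surplus \<open>K / 3\<close> in
          \<open>4 / 3 * K \<le> t\<close> outweighs \<open>ln 3\<close>, which yields
          \<open>R \<le> exp (- K)\<close>.\<close>
        obtain K J w where K: "\<phi> (exp (- real K)) * real K \<le> 2 * ln (real K)" "6 + nat \<lceil>t0\<rceil> \<le> K"
          and J: "2 * K \<le> J" "J \<le> 4 * K" "\<beta> * ln (real K) + w0 \<le> real w"
          and r: "run J w l1 \<omega>" "run (?xpos J \<omega>) w l2 \<omega>" "J + w \<le> ?xpos J \<omega>"
          using elim(2)[rule_format, of "6 + nat \<lceil>t0\<rceil>"] by blast
        define t where "t = (\<Sum>j<J. lnn j)"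
        define R where "R = 3 * exp (- t)"
        have ln3: "ln 3 \<le> (2::real)"
        proof -
          have "ln 3 \<le> (3::real) - 1" by (rule ln_le_minus_one) simp
          then show ?thesis by simp
        qed
        have "ln 2 * real J \<le> t"
          unfolding t_def by (rule sum_ge_linear[of "ln 2" _ log_max, OF ln2_pos lnn_bounds])
        moreover have "2 / 3 * real (2 * K) \<le> ln 2 * real J"
          using ln2_ge_two_thirds J(1) by (intro mult_mono) auto
        ultimately have tK: "4 / 3 * real K \<le> t" by linarith
        have K6: "6 \<le> real K" and t0K: "t0 \<le> real K" using K(2) by linarith+
        have "t \<le> log_max * real J"
          unfolding t_def using sum_bounded_above[of "{..<J}" lnn log_max] lnn_bounds by (simp add: mult.commute)
        also have "\<dots> \<le> log_max * (4 * real K)" using J(2) log_max_pos by (intro mult_left_mono) auto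
        finally have tK': "t \<le> 4 * log_max * real K" by simp
        have lnR: "ln R = ln 3 - t" by (simp add: R_def ln_mult)
        have "real K \<le> - ln R" using lnR tK K6 ln3 by argo
        then have RK: "R \<le> exp (- real K)" using ln_le_cancel_iff[of R "exp (- real K)"] by (simp add: R_def)
        have "exp (- real K) < 1" using K6 by simp
        moreover have "0 < R" by (simp add: R_def)
        ultimately have unit: "R \<in> {0<..<1}" "exp (- real K) \<in> {0<..<1}"
          unfolding greaterThanLessThan_iff using RK by linarith+
        have "ln R < 0" "0 < ln (3::real)" using unit by simp_all
        then have "\<bar>ln R\<bar> \<le> t" using lnR by linarith
        then have "gauge_of \<psi> R \<le> \<psi> R * t"
          unfolding gauge_of_def using unit \<psi>0[of R] by (intro mult_left_mono) auto
        also have "\<dots> \<le> C * \<phi> R * t" using le unit tK by (intro mult_right_mono) auto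
        \<comment> \<open>Divergence has made \<open>\<phi>\<close> non-decreasing, so its value at
          the smaller \<open>R\<close> is bounded by the one at \<open>exp (- K)\<close>, where the
          bound by \<open>2 * ln K\<close> is available.\<close>
        also have "\<dots> \<le> C * \<phi> (exp (- real K)) * t"
          using monotone_onD[OF dv(1) unit RK] C tK by (intro mult_right_mono mult_left_mono) auto
        also have "\<dots> \<le> C * \<phi> (exp (- real K)) * (4 * log_max * real K)"
          using tK' C \<phi> unit(2) by (intro mult_left_mono) (auto simp: dimension_function_def less_imp_le)
        also have "\<dots> = 4 * C * log_max * (\<phi> (exp (- real K)) * real K)" by simp
        also have "\<dots> \<le> 4 * C * log_max * (2 * ln (real K))"
          using K(1) C log_max_pos by (intro mult_left_mono) auto
        also have "\<dots> = ln 2 * (\<beta> * ln (real K))" using log_max_pos by (simp add: C_def)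
        finally have "gauge_of \<psi> R + log_max \<le> ln 2 * (\<beta> * ln (real K)) + ln 2 * w0" using w0(2) by linarith
        also have "\<dots> \<le> ln 2 * real w" unfolding distrib_left[symmetric] using J(3) by (intro mult_left_mono) auto
        finally have "gauge_of \<psi> R + log_max \<le> ln 2 * real w" .
        moreover have "t0 \<le> t" using tK t0K K6 by linarith
        ultimately show "\<exists>J w. t0 \<le> (\<Sum>j<J. lnn j) \<and> (\<forall>j<w. \<omega> (J + j) = l1) \<and>
          (\<forall>j<w. \<omega> (xlevel (\<Sum>j<J. lnn j) + j) = l2) \<and> J + w \<le> xlevel (\<Sum>j<J. lnn j) \<and>
          gauge_of \<psi> (3 * exp (- (\<Sum>j<J. lnn j))) + log_max \<le> ln 2 * real w"
          using r unfolding run_def xpos_eq R_def t_def by blast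
      qed
      moreover have "assouad_dim (carpet m n N a b \<omega>) \<le> ereal (rows_ratio + cols_ratio)" by (rule assouad_dim_le)
      moreover have "gen_assouad_spectrum \<psi> (carpet m n N a b \<omega>) \<le> assouad_dim (carpet m n N a b \<omega>)"
        by (rule gen_assouad_spectrum_le_assouad_dim[OF \<psi>0])
      ultimately show "gen_assouad_spectrum \<psi> (carpet m n N a b \<omega>) = assouad_dim (carpet m n N a b \<omega>)" by order
    qed
  qed
  then show ?thesis using C by blast
qed

end

theorem theorem2p7:
  fixes \<Lambda> :: "'l set" and \<mu> :: "'l pmf"
    and m n N :: "'l \<Rightarrow> nat" and a b :: "'l \<Rightarrow> nat \<Rightarrow> nat"
  assumes "random_bm_carpet \<Lambda> \<mu> m n N a b"
  shows
    "(\<forall>\<phi>. dimension_function \<phi> \<longrightarrow>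
        (\<forall>x\<in>{0<..<1}. \<phi> x \<le> ln (geometric_mean \<Lambda> \<mu> n) / ln (geometric_mean \<Lambda> \<mu> m) - 1) \<longrightarrow>
        summable (\<lambda>k. exp (- (\<phi> (exp (- real (Suc k))) * real (Suc k)))) \<longrightarrow>
        (\<forall>\<psi>. dimension_function \<psi> \<longrightarrow>
           ((\<lambda>x. \<phi> x / \<psi> x) \<longlongrightarrow> 0) (at_right 0) \<longrightarrow>
           (\<forall>\<^sub>F x in at_right 0.
              \<psi> x \<le> ln (geometric_mean \<Lambda> \<mu> n) / ln (geometric_mean \<Lambda> \<mu> m) - 1) \<longrightarrow>
           (AE \<omega> in realisation_measure \<mu>.
              gen_assouad_spectrum \<psi> (carpet m n N a b \<omega>)
                = quasi_assouad_dim (carpet m n N a b \<omega>))))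
     \<and>
     (\<forall>\<phi>. dimension_function \<phi> \<longrightarrow>
        \<not> summable (\<lambda>k. exp (- (\<phi> (exp (- real (Suc k))) * real (Suc k)))) \<longrightarrow>
        (\<exists>C>0. AE \<omega> in realisation_measure \<mu>.
           \<forall>\<psi>. dimension_function \<psi> \<longrightarrow>
             (\<forall>x\<in>{0<..<1}. \<psi> x \<le> C * \<phi> x) \<longrightarrow>
             filterlim (\<lambda>x. \<psi> x * \<bar>ln x\<bar>) at_top (at_right 0) \<longrightarrow>
             gen_assouad_spectrum \<psi> (carpet m n N a b \<omega>)
               = assouad_dim (carpet m n N a b \<omega>)))"
proof -
  interpret random_bm_carpet \<Lambda> \<mu> m n N a b by (rule assms)
  show ?thesis
    using spectrum_eq_quasi_assouad spectrum_eq_assouad[unfolded gauge_of_def[abs_def]] by blast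
qed

end
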